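(* Let $g,h\in\mathbb{R}$ with $h\neq0$, $N\geq1$, $v$ as in the context, and $\theta\geq0$. Let $\lambda$ be an eigenvalue of $H^{(N)}$ with $\lambda\notin\sigma^{(N)}_{\mathrm{cluster}}$. Then $\lambda$ has finite multiplicity, and there exists a constant $C(N,\theta,\lambda)$ such that for every normalized eigenvector $\psi_\lambda$ of $H^{(N)}$ with eigenvalue $\lambda$ and all $(x_1,\dots,x_N)\in\mathbb{Z}^N$, $$|\langle\psi_\lambda\mid x_1,\dots,x_N\rangle|<C(N,\theta,\lambda)\,e^{-\theta(|x_1|+\cdots+|x_N|)}.$$
   Context: $v:\mathbb{Z}\to\mathbb{R}$ is bounded with $v(n)\to0$ as $n\to\pm\infty$. $(e_j)$ is the canonical basis of $\ell^2(\mathbb{Z})$, $Xe_j=je_j$, $\Delta e_j=-(e_{j-1}+e_{j+1})$, $H_0=g\Delta-2hX$. For $M\ge1$, on $\ell^2(\mathbb{Z}^M)$ with position basis $|x_1,\dots,x_M\rangle=e_{x_1}\otimes\cdots\otimes e_{x_M}$, $H_0^{(M)}=\sum_{k=1}^M 1\otimes\cdots\otimes H_0\otimes\cdots\otimes1$ (self-adjoint closure) and $H^{(M)}=H_0^{(M)}+\sum_{1\le i<j\le M}V_{ij}$, with $V_{ij}$ multiplication by $v(x_i-x_j)$. The cluster spectrum is $$\sigma^{(N)}_{\mathrm{cluster}}=\bigcup_{P}\big(\sigma(H^{(p_1)})+\cdots+\sigma(H^{(p_{|P|})})\big),$$ the union over all partitions $P=\{p_1,\dots,p_{|P|}\}$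 of the integer $N$ into $|P|\ge2$ positive integers summing to $N$, with $+$ the Minkowski sum of subsets of $\mathbb{R}$. *)

theory Defs
  imports "HOL-Analysis.Analysis"
begin

text \<open>Configurations of M particles on Z are int lists of length M;
  states of ell^2(Z^M) are functions int list => complex vanishing off length-M lists
  and square summable.\<close>

definition l2 :: "nat \<Rightarrow> (int list \<Rightarrow> complex) set" where
  "l2 M = {\<psi>. (\<forall>x. length x \<noteq> M \<longrightarrow> \<psi> x = 0) \<and>
              (\<lambda>x. (cmod (\<psi> x))\<^sup>2) summable_on UNIV}"

definition l2norm :: "(int list \<Rightarrow> complex) \<Rightarrow> real" where
  "l2norm \<psi> = sqrt (\<Sum>\<^sub>\<infinity>x. (cmod (\<psi> x))\<^sup>2)"

text \<open>The action of H^(M) = H_0^(M) + sum_{i<j} V_ij, with H_0 = g Delta - 2 h X.\<close>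
definition Hop :: "real \<Rightarrow> real \<Rightarrow> (int \<Rightarrow> real) \<Rightarrow> nat \<Rightarrow>
    (int list \<Rightarrow> complex) \<Rightarrow> (int list \<Rightarrow> complex)" where
  "Hop g h v M \<psi> = (\<lambda>x. if length x = M then
      (\<Sum>k<M. complex_of_real g * (- (\<psi> (x[k := x!k - 1]) + \<psi> (x[k := x!k + 1])))
               - complex_of_real (2 * h * of_int (x!k)) * \<psi> x)
      + (\<Sum>j<M. \<Sum>i<j. complex_of_real (v (x!i - x!j)) * \<psi> x)
    else 0)"

text \<open>Domain of the self-adjoint operator H^(M): the maximal domain
  (equal to the domain of the self-adjoint closure, since Delta and V are bounded
  and finitely supported vectors form a core for multiplication by x_1+...+x_M).\<close>
definition Hdom :: "real \<Rightarrow> real \<Rightarrow> (int \<Rightarrow> real) \<Rightarrow> nat \<Rightarrow> (int list \<Rightarrow> complex) set" where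
  "Hdom g h v M = {\<psi> \<in> l2 M. Hop g h v M \<psi> \<in> l2 M}"

text \<open>Spectrum (real, as H^(M) is self-adjoint): lambda is in the resolvent set iff
  H - lambda : Hdom -> l2 has a bounded two-sided inverse.\<close>
definition spec :: "real \<Rightarrow> real \<Rightarrow> (int \<Rightarrow> real) \<Rightarrow> nat \<Rightarrow> real set" where
  "spec g h v M = {E. \<not> (\<exists>R C.
      (\<forall>\<phi>\<in>l2 M. R \<phi> \<in> Hdom g h v M \<and> l2norm (R \<phi>) \<le> C * l2norm \<phi> \<and>
          (\<lambda>x. Hop g h v M (R \<phi>) x - complex_of_real E * R \<phi> x) = \<phi>) \<and>
      (\<forall>\<psi>\<in>Hdom g h v M. R (\<lambda>x. Hop g h v M \<psi> x - complex_of_real E * \<psi> x) = \<psi>))}"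

definition eigenspace :: "real \<Rightarrow> real \<Rightarrow> (int \<Rightarrow> real) \<Rightarrow> nat \<Rightarrow> real \<Rightarrow> (int list \<Rightarrow> complex) set" where
  "eigenspace g h v M E = {\<psi> \<in> Hdom g h v M. Hop g h v M \<psi> = (\<lambda>x. complex_of_real E * \<psi> x)}"

definition is_eigenvalue :: "real \<Rightarrow> real \<Rightarrow> (int \<Rightarrow> real) \<Rightarrow> nat \<Rightarrow> real \<Rightarrow> bool" where
  "is_eigenvalue g h v M E \<longleftrightarrow> (\<exists>\<psi> \<in> eigenspace g h v M E. \<psi> \<noteq> (\<lambda>x. 0))"

definition finite_multiplicity :: "real \<Rightarrow> real \<Rightarrow> (int \<Rightarrow> real) \<Rightarrow> nat \<Rightarrow> real \<Rightarrow> bool" where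
  "finite_multiplicity g h v M E \<longleftrightarrow> (\<exists>B. finite B \<and> B \<subseteq> eigenspace g h v M E \<and>
     (\<forall>\<psi> \<in> eigenspace g h v M E. \<exists>c. \<psi> = (\<lambda>x. \<Sum>b\<in>B. c b * b x)))"

fun msum :: "real set list \<Rightarrow> real set" where
  "msum [] = {0}"
| "msum (A # As) = {a + b | a b. a \<in> A \<and> b \<in> msum As}"

text \<open>Partitions of N into at least two positive parts, represented as lists
  (order is irrelevant for Minkowski sums).\<close>
definition cluster_spec :: "real \<Rightarrow> real \<Rightarrow> (int \<Rightarrow> real) \<Rightarrow> nat \<Rightarrow> real set" where
  "cluster_spec g h v N = (\<Union>ps \<in> {ps. length ps \<ge> 2 \<and> (\<forall>p\<in>set ps. p > 0) \<and> sum_list ps = N}.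
      msum (map (spec g h v) ps))"

end

theory Submission
  imports Defs "HOL-Complex_Analysis.Complex_Analysis"
begin

text \<open>
  Conjugating \<open>H\<close> with \<open>exp (\<theta> \<cdot> x)\<close> gives, for every real tilt \<open>\<theta>\<close>, a bounded perturbation of the
  same diagonal operator, and all estimates are a priori lower bounds for these tilted operators in the
  supremum norm on bounded functions. A tent-shaped cutoff around a near-maximum of a function replaces
  partitions of unity: where two clusters are far apart the operator is close to a decoupled one, and
  where all particles are close together the field term dominates. Hence lower bounds for all decoupled
  two-cluster operators give a lower bound for \<open>H - E\<close> on functions vanishing on a finite box, for every
  tilt at once, and these bounds carry exponential decay of an eigenfunction from one tilt to every
  other one.

  The decoupled bounds come from induction over the clusters. If the bound for a cluster fails at some
  tilt, a limit of approximate kernel vectors solves the eigenvalue equation, and decay for every tilt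
  makes it square summable, so the energy lies in the spectrum of the cluster. Two clusters are combined
  by Liouville's theorem: for an approximate kernel vector \<open>\<phi>\<close> of \<open>A + B - E\<close>, the functions
  \<open>(A - \<alpha>)\<inverse>\<phi>\<close> and \<open>- (B - (E - \<alpha>))\<inverse>\<phi>\<close> of \<open>\<alpha>\<close> almost agree, together they cover the plane, and
  translation covariance makes the bounds on them uniform, so both are small.
\<close>

text \<open>The obstacle is that a tilted operator is not self-adjoint. Neither a spectral theorem
  nor the rule that commuting self-adjoint summands have additive spectra is available for a
  decoupled pair of clusters, and the Liouville argument takes their place. The supremum norm is
  chosen because a lower bound can then be tested at a single near-maximum, where errors below half
  the maximum are absorbed, and because approximate kernel vectors have pointwise limits along a
  diagonal subsequence, whether or not they are square summable. The field enters twice. It controls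
  the motion of the centre of mass, since a tightly packed configuration far out has a huge diagonal
  entry. And translating a whole cluster shifts the energy by a multiple of
  \<open>2 * h * card D\<close>, so bounds are periodic in the energy and a compact rectangle of
  energies suffices. Tilts cannot be treated one at a time: a failure at one tilt is excluded only
  by decay of the resulting solution in all directions, which uses the outer bounds at every tilt on
  the way.\<close>

type_synonym conf = "nat \<Rightarrow> int"

section \<open>Tilted operators and a priori lower bounds\<close>

definition steps :: "nat set \<Rightarrow> (nat \<times> int) set" where
  "steps D = D \<times> {-1, 1}"

definition move :: "conf \<Rightarrow> nat \<times> int \<Rightarrow> conf" where
  "move x p = x(fst p := x (fst p) + snd p)"

text \<open>The exponential is
  \<open>exp (\<theta> \<cdot> x) * exp (- \<theta> \<cdot> move x p)\<close>, the ratio of the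
  weights at the two ends of the step.\<close>

definition hopc :: "real \<Rightarrow> (nat \<Rightarrow> real) \<Rightarrow> nat \<times> int \<Rightarrow> real" where
  "hopc g \<theta> p = - g * exp (- (of_int (snd p) * \<theta> (fst p)))"

definition hopn :: "real \<Rightarrow> nat set \<Rightarrow> (nat \<Rightarrow> real) \<Rightarrow> real" where
  "hopn g D \<theta> = (\<Sum>p\<in>steps D. \<bar>hopc g \<theta> p\<bar>)"

text \<open>\<open>exp (\<theta> \<cdot> x) (T + W - \<alpha>) exp (- \<theta> \<cdot> x)\<close>, where \<open>T\<close> is the hopping term of the particles in \<open>D\<close>.
  Coordinates outside \<open>D\<close> are inert parameters, so operators of different clusters act on the same space.\<close>

definition Op :: "real \<Rightarrow> nat set \<Rightarrow> (nat \<Rightarrow> real) \<Rightarrow> (conf \<Rightarrow> real) \<Rightarrow> complex \<Rightarrow> (conf \<Rightarrow> complex) \<Rightarrow> conf \<Rightarrow> complex" where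
  "Op g D \<theta> W \<alpha> \<phi> x = (\<Sum>p\<in>steps D. of_real (hopc g \<theta> p) * \<phi> (move x p)) + (of_real (W x) - \<alpha>) * \<phi> x"

definition bd :: "('a \<Rightarrow> complex) \<Rightarrow> bool" where
  "bd \<phi> \<longleftrightarrow> (\<exists>M. \<forall>x. cmod (\<phi> x) \<le> M)"

text \<open>Only an a priori estimate; surjectivity is a separate matter (\<open>solv\<close>).
  Quantifying over \<open>e\<close> avoids the supremum of the image, which may be infinite for a
  bounded \<open>\<phi>\<close> when \<open>W\<close> is unbounded.\<close>

definition LB :: "real \<Rightarrow> nat set \<Rightarrow> (nat \<Rightarrow> real) \<Rightarrow> (conf \<Rightarrow> real) \<Rightarrow> complex \<Rightarrow> real \<Rightarrow> bool" where
  "LB g D \<theta> W \<alpha> C \<longleftrightarrow> (\<forall>\<phi> e. bd \<phi> \<longrightarrow> (\<forall>x. cmod (Op g D \<theta> W \<alpha> \<phi> x) \<le> e) \<longrightarrow> (\<forall>x. cmod (\<phi> x) \<le> C * e))"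

definition tot :: "nat set \<Rightarrow> conf \<Rightarrow> int" where
  "tot D x = (\<Sum>k\<in>D. x k)"

definition pot :: "(int \<Rightarrow> real) \<Rightarrow> nat set \<Rightarrow> conf \<Rightarrow> real" where
  "pot v D x = (\<Sum>j\<in>D. \<Sum>i\<in>{i\<in>D. i < j}. v (x i - x j))"

definition U :: "real \<Rightarrow> (int \<Rightarrow> real) \<Rightarrow> nat set \<Rightarrow> conf \<Rightarrow> real" where
  "U h v D x = pot v D x - 2 * h * of_int (tot D x)"

lemma finite_steps [simp]: "finite D \<Longrightarrow> finite (steps D)"
  by (simp add: steps_def)

lemma hopn_nonneg: "hopn g D \<theta> \<ge> 0"
  by (simp add: hopn_def sum_nonneg)

lemma bdI:
  fixes \<phi> :: "'a \<Rightarrow> complex"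
  shows "(\<And>x. cmod (\<phi> x) \<le> M) \<Longrightarrow> bd \<phi>"
  by (auto simp: bd_def)

lemma LBD: "LB g D \<theta> W \<alpha> C \<Longrightarrow> bd \<phi> \<Longrightarrow> (\<And>x. cmod (Op g D \<theta> W \<alpha> \<phi> x) \<le> e) \<Longrightarrow> cmod (\<phi> x) \<le> C * e"
  unfolding LB_def by blast

lemma LB_mono: "LB g D \<theta> W \<alpha> C \<Longrightarrow> C \<le> C' \<Longrightarrow> LB g D \<theta> W \<alpha> C'"
  unfolding LB_def
  by (meson mult_right_mono norm_ge_zero order_trans)

lemma bd_near_sup:
  fixes \<phi> :: "'a \<Rightarrow> complex"
  assumes "bd \<phi>" "\<phi> z \<noteq> 0"
  obtains M x0 where "M > 0" "\<And>x. cmod (\<phi> x) \<le> M" "M / 2 \<le> cmod (\<phi> x0)"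
proof -
  let ?S = "range (\<lambda>x. cmod (\<phi> x))"
  have bdd: "bdd_above ?S" using assms(1) by (auto simp: bd_def bdd_above_def)
  define M where "M = Sup ?S"
  have le: "cmod (\<phi> x) \<le> M" for x
    unfolding M_def by (rule cSup_upper[OF _ bdd]) simp
  have pos: "M > 0" using le[of z] assms(2) by (meson less_le_trans zero_less_norm_iff)
  hence "M / 2 < Sup ?S" unfolding M_def by linarith
  then obtain x0 where "M / 2 < cmod (\<phi> x0)"
    using less_cSupE[of "M / 2" ?S] by blast
  with that[of M x0] pos le show ?thesis by simp
qed

text \<open>Absorption principle: since \<open>x0\<close> carries at least half of the global bound
  \<open>M\<close>, error terms that are small multiples of \<open>M\<close> can be absorbed in the
  estimate at \<open>x0\<close>.\<close>

lemma LBI: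
  assumes "C \<ge> 0"
    and "\<And>\<phi> e M x0. M > 0 \<Longrightarrow> (\<And>x. cmod (\<phi> x) \<le> M) \<Longrightarrow> M / 2 \<le> cmod (\<phi> x0) \<Longrightarrow>
        (\<And>x. cmod (Op g D \<theta> W \<alpha> \<phi> x) \<le> e) \<Longrightarrow> M \<le> C * e"
  shows "LB g D \<theta> W \<alpha> C"
  unfolding LB_def
proof (intro allI impI)
  fix \<phi> :: "conf \<Rightarrow> complex" and e x
  assume b: "bd \<phi>" and e: "\<forall>x. cmod (Op g D \<theta> W \<alpha> \<phi> x) \<le> e"
  have e0: "e \<ge> 0" using e by (meson norm_ge_zero order_trans)
  show "cmod (\<phi> x) \<le> C * e"
  proof (cases "\<phi> x = 0")
    case True then show ?thesis using e0 assms(1) by simp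
  next
    case False
    from bd_near_sup[of \<phi> x, OF b False] obtain M x0 where M: "M > 0" "\<And>x. cmod (\<phi> x) \<le> M" "M / 2 \<le> cmod (\<phi> x0)"
      by metis
    have "M \<le> C * e" using assms(2)[of M \<phi> x0 e] M e by blast
    then show ?thesis using M(2)[of x] by linarith
  qed
qed

lemma Op_shift: "Op g D \<theta> W (\<alpha> + \<delta>) \<phi> x = Op g D \<theta> W \<alpha> \<phi> x - \<delta> * \<phi> x"
  by (simp add: Op_def algebra_simps)

lemma Op_add: "Op g D \<theta> W \<alpha> (\<lambda>x. \<phi> x + \<psi> x) x = Op g D \<theta> W \<alpha> \<phi> x + Op g D \<theta> W \<alpha> \<psi> x"
  by (simp add: Op_def algebra_simps sum.distrib)

lemma Op_diff: "Op g D \<theta> W \<alpha> (\<lambda>x. \<phi> x - \<psi> x) x = Op g D \<theta> W \<alpha> \<phi> x - Op g D \<theta> W \<alpha> \<psi> x"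
  by (simp add: Op_def algebra_simps sum_subtractf)

lemma Op_cmult: "Op g D \<theta> W \<alpha> (\<lambda>x. c * \<phi> x) x = c * Op g D \<theta> W \<alpha> \<phi> x"
  by (simp add: Op_def algebra_simps sum_distrib_left)

lemma bd_add: "bd \<phi> \<Longrightarrow> bd \<psi> \<Longrightarrow> bd (\<lambda>x. \<phi> x + \<psi> x)"
  unfolding bd_def by (meson add_mono norm_triangle_le order_refl)

lemma bd_cmult: "bd \<phi> \<Longrightarrow> bd (\<lambda>x. c * \<phi> x)"
  unfolding bd_def by (metis mult_left_mono norm_ge_zero norm_mult)

lemma bd_minus: "bd \<phi> \<Longrightarrow> bd (\<lambda>x. - \<phi> x)"
  unfolding bd_def by simp

lemma bd_diff: "bd \<phi> \<Longrightarrow> bd \<psi> \<Longrightarrow> bd (\<lambda>x. \<phi> x - \<psi> x)"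
  using bd_add[of \<phi> "\<lambda>x. - \<psi> x"] bd_minus[of \<psi>] by simp

text \<open>The shift adds at most \<open>cmod \<delta> * M\<close> to the image. At a near-maximum
  this leaves \<open>M / 2 - M / 4 = M / 4\<close> to be bounded by \<open>C * e\<close>, whence the
  factor 4.\<close>

lemma LB_pert:
  assumes lb: "LB g D \<theta> W \<alpha> C" and C: "C > 0" and d: "cmod \<delta> * C \<le> 1/4"
  shows "LB g D \<theta> W (\<alpha> + \<delta>) (4 * C)"
proof (rule LBI)
  show "0 \<le> 4 * C" using C d by simp
  fix \<phi> :: "conf \<Rightarrow> complex" and e M x0
  assume M: "M > 0" "\<And>x. cmod (\<phi> x) \<le> M" "M / 2 \<le> cmod (\<phi> x0)"
    and e: "\<And>x. cmod (Op g D \<theta> W (\<alpha> + \<delta>) \<phi> x) \<le> e"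
  have "cmod (Op g D \<theta> W \<alpha> \<phi> x) \<le> e + cmod \<delta> * M" for x
  proof -
    have "Op g D \<theta> W \<alpha> \<phi> x = Op g D \<theta> W (\<alpha> + \<delta>) \<phi> x + \<delta> * \<phi> x"
      by (simp add: Op_shift)
    hence "cmod (Op g D \<theta> W \<alpha> \<phi> x) \<le> cmod (Op g D \<theta> W (\<alpha> + \<delta>) \<phi> x) + cmod \<delta> * cmod (\<phi> x)"
      by (metis norm_mult norm_triangle_ineq)
    thus ?thesis using e[of x] M(2)[of x] by (smt (verit) mult_left_mono norm_ge_zero)
  qed
  from LBD[OF lb bdI[of \<phi>, OF M(2)] this, of x0]
  have "M / 2 \<le> C * e + (cmod \<delta> * C) * M" using M(3) by (simp add: algebra_simps)
  also have "\<dots> \<le> C * e + M / 4" using d M(1) mult_right_mono[of "cmod \<delta> * C" "1/4" M] by simp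
  finally show "M \<le> 4 * C * e" by simp
qed

lemma hop_bound:
  assumes "finite D" "\<And>p. p \<in> steps D \<Longrightarrow> cmod (f p) \<le> M"
  shows "cmod (\<Sum>p\<in>steps D. of_real (hopc g \<theta> p) * f p) \<le> hopn g D \<theta> * M"
proof -
  have "cmod (\<Sum>p\<in>steps D. of_real (hopc g \<theta> p) * f p) \<le> (\<Sum>p\<in>steps D. \<bar>hopc g \<theta> p\<bar> * M)"
    by (rule sum_norm_le) (auto simp: norm_mult intro!: mult_left_mono assms)
  also have "\<dots> = hopn g D \<theta> * M" by (simp add: hopn_def sum_distrib_right)
  finally show ?thesis .
qed

text \<open>\<open>W\<close> is real, so every diagonal entry has modulus at least
  \<open>\<bar>Im \<alpha>\<bar>\<close> and beats the hopping term by \<open>y\<close>. The exact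
  supremum is used, because a near-maximum would lose the estimate when \<open>y\<close> is small
  compared with \<open>hopn\<close>. The rate \<open>1 / y\<close> later forces the Liouville
  constant to vanish.\<close>

lemma LB_large_Im:
  assumes fin: "finite D" and y: "y > 0" "\<bar>Im \<alpha>\<bar> \<ge> hopn g D \<theta> + y"
  shows "LB g D \<theta> W \<alpha> (1 / y)"
  unfolding LB_def
proof (intro allI impI)
  fix \<phi> :: "conf \<Rightarrow> complex" and e x
  assume b: "bd \<phi>" and e: "\<forall>x. cmod (Op g D \<theta> W \<alpha> \<phi> x) \<le> e"
  let ?S = "range (\<lambda>x. cmod (\<phi> x))"
  have bdd: "bdd_above ?S" using b by (auto simp: bd_def bdd_above_def)
  define M where "M = Sup ?S"
  have le: "cmod (\<phi> x) \<le> M" for x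
    unfolding M_def by (rule cSup_upper[OF _ bdd]) simp
  have "(hopn g D \<theta> + y) * cmod (\<phi> x) \<le> e + hopn g D \<theta> * M" for x
  proof -
    have "\<bar>Im \<alpha>\<bar> \<le> cmod (of_real (W x) - \<alpha>)" using abs_Im_le_cmod[of "of_real (W x) - \<alpha>"] by simp
    hence "(hopn g D \<theta> + y) * cmod (\<phi> x) \<le> cmod ((of_real (W x) - \<alpha>) * \<phi> x)"
      using y by (auto simp: norm_mult intro!: mult_right_mono)
    also have "(of_real (W x) - \<alpha>) * \<phi> x = Op g D \<theta> W \<alpha> \<phi> x - (\<Sum>p\<in>steps D. of_real (hopc g \<theta> p) * \<phi> (move x p))"
      by (simp add: Op_def)
    also have "cmod \<dots> \<le> e + hopn g D \<theta> * M"
      using norm_triangle_ineq4 e hop_bound[OF fin, of "\<lambda>p. \<phi> (move x p)" M g \<theta>] le by (smt (verit))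
    finally show ?thesis .
  qed
  hence "cmod (\<phi> x) \<le> (e + hopn g D \<theta> * M) / (hopn g D \<theta> + y)" for x
    using y hopn_nonneg[of g D \<theta>] by (simp add: pos_le_divide_eq mult.commute)
  hence "M \<le> (e + hopn g D \<theta> * M) / (hopn g D \<theta> + y)"
    unfolding M_def by (intro cSup_least) auto
  hence "M * (hopn g D \<theta> + y) \<le> e + hopn g D \<theta> * M"
    using y hopn_nonneg[of g D \<theta>] by (simp add: pos_le_divide_eq)
  hence "M * y \<le> e" by (simp add: algebra_simps)
  hence "M \<le> 1 / y * e" using y by (simp add: pos_le_divide_eq)
  thus "cmod (\<phi> x) \<le> 1 / y * e" using le[of x] by linarith
qed

lemma tot_translate:
  assumes "finite D"
  shows "tot D (\<lambda>k. if k \<in> D then x k + m else x k) = tot D x + int (card D) * m"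
  by (simp add: tot_def sum.distrib)

lemma pot_translate: "pot v D (\<lambda>k. if k \<in> D then x k + m else x k) = pot v D x"
  unfolding pot_def by (intro sum.cong refl) auto

text \<open>Moving the whole cluster by \<open>m\<close> leaves all differences unchanged and alters
  the field term by a constant, which the spectral parameter compensates. This is the Wannier-Stark
  ladder structure.\<close>

lemma Op_translate:
  assumes "finite D"
  defines "\<tau> \<equiv> (\<lambda>m x k. if k \<in> D then x k + m else x k)"
  shows "Op g D \<theta> (U h v D) (\<alpha> + of_real (2 * h * real (card D) * of_int m)) (\<lambda>x. \<phi> (\<tau> m x)) x
      = Op g D \<theta> (U h v D) \<alpha> \<phi> (\<tau> m x)"
proof -
  have "\<tau> m (move x p) = move (\<tau> m x) p" if "p \<in> steps D" for p
    using that by (auto simp: \<tau>_def move_def steps_def)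
  moreover have "U h v D x = U h v D (\<tau> m x) + 2 * h * real (card D) * of_int m"
    unfolding U_def \<tau>_def by (simp add: tot_translate[OF assms(1)] pot_translate algebra_simps)
  hence "complex_of_real (U h v D x) - (\<alpha> + of_real (2 * h * real (card D) * of_int m)) = complex_of_real (U h v D (\<tau> m x)) - \<alpha>"
    by simp
  ultimately show ?thesis by (simp only: Op_def cong: sum.cong)
qed

lemma LB_translate:
  assumes "finite D" "LB g D \<theta> (U h v D) (\<alpha> + of_real (2 * h * real (card D) * of_int m)) C"
  shows "LB g D \<theta> (U h v D) \<alpha> C"
  unfolding LB_def
proof (intro allI impI)
  fix \<phi> :: "conf \<Rightarrow> complex" and e x
  assume b: "bd \<phi>" and e: "\<forall>x. cmod (Op g D \<theta> (U h v D) \<alpha> \<phi> x) \<le> e"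
  let ?\<tau> = "\<lambda>m x k. if k \<in> D then x k + m else x k"
  have "bd (\<lambda>x. \<phi> (?\<tau> m x))" using b by (auto simp: bd_def)
  from LBD[OF assms(2) this, of e "?\<tau> (-m) x"]
  have "cmod (\<phi> (?\<tau> m (?\<tau> (-m) x))) \<le> C * e"
    using e by (simp only: Op_translate[OF assms(1)])
  moreover have "?\<tau> m (?\<tau> (-m) x) = x" by auto
  ultimately show "cmod (\<phi> x) \<le> C * e" by simp
qed

section \<open>Tent cutoffs\<close>

definition tent :: "nat set \<Rightarrow> conf \<Rightarrow> real \<Rightarrow> conf \<Rightarrow> real" where
  "tent D x0 R x = max 0 (1 - (\<Sum>k\<in>D. \<bar>of_int (x k - x0 k)\<bar>) / R)"

lemma tent_at [simp]: "tent D x0 R x0 = 1"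
  by (simp add: tent_def)

lemma tent_nonneg: "tent D x0 R x \<ge> 0"
  by (simp add: tent_def)

lemma tent_le_1: "R > 0 \<Longrightarrow> tent D x0 R x \<le> 1"
  by (simp add: tent_def sum_nonneg)

lemma tent_supp:
  assumes "finite D" "R > 0" "tent D x0 R x \<noteq> 0" "k \<in> D"
  shows "\<bar>of_int (x k - x0 k)\<bar> < R"
proof -
  have "(\<Sum>k\<in>D. \<bar>of_int (x k - x0 k)\<bar>) < R"
    using assms by (auto simp: tent_def max_def field_simps split: if_splits)
  moreover have "\<bar>of_int (x k - x0 k)\<bar> \<le> (\<Sum>k\<in>D. \<bar>of_int (x k - x0 k)\<bar> :: real)"
    using assms by (intro member_le_sum) auto
  ultimately show ?thesis by linarith
qed

lemma tent_lipschitz: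
  assumes "finite D" "R > 0" "p \<in> steps D"
  shows "\<bar>tent D x0 R (move x p) - tent D x0 R x\<bar> \<le> 1 / R"
proof -
  obtain k s where p: "p = (k, s)" "k \<in> D" "s = 1 \<or> s = -1" using assms(3) by (auto simp: steps_def)
  define S where "S = (\<Sum>j\<in>D - {k}. \<bar>of_int (x j - x0 j)\<bar> :: real)"
  have 1: "(\<Sum>j\<in>D. \<bar>of_int (x j - x0 j)\<bar>) = \<bar>of_int (x k - x0 k)\<bar> + S"
    unfolding S_def using assms p by (simp add: sum.remove)
  have "(\<Sum>j\<in>D - {k}. \<bar>of_int (move x p j - x0 j)\<bar>) = S"
    unfolding S_def by (intro sum.cong) (auto simp: move_def p)
  hence 2: "(\<Sum>j\<in>D. \<bar>of_int (move x p j - x0 j)\<bar>) = \<bar>of_int (x k + s - x0 k)\<bar> + S"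
    using assms p by (simp add: sum.remove move_def)
  have "\<bar>(\<bar>of_int (x k + s - x0 k)\<bar> + S) - (\<bar>of_int (x k - x0 k)\<bar> + S)\<bar> \<le> (1::real)"
    using p(3) by auto
  hence "\<bar>(\<bar>of_int (x k + s - x0 k)\<bar> + S) / R - (\<bar>of_int (x k - x0 k)\<bar> + S) / R\<bar> \<le> 1 / R"
    using assms(2) by (simp add: diff_divide_distrib[symmetric] divide_right_mono)
  moreover have "\<bar>max 0 (1 - a) - max 0 (1 - b)\<bar> \<le> \<bar>a - b\<bar>" for a b :: real
    by (auto simp: max_def)
  ultimately show ?thesis unfolding tent_def 1 2 by (meson order_trans)
qed

text \<open>The diagonal part commutes with the cutoff, so only hopping differences survive, and
  these are controlled by the slope \<open>1 / R\<close> of the tent. A wide tent localises at small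
  cost while keeping the value at its centre.\<close>

lemma Op_tent:
  assumes "finite D" "R > 0" "\<And>x. cmod (\<phi> x) \<le> M"
  shows "cmod (Op g D \<theta> W \<alpha> (\<lambda>x. of_real (tent D x0 R x) * \<phi> x) x - of_real (tent D x0 R x) * Op g D \<theta> W \<alpha> \<phi> x)
      \<le> hopn g D \<theta> * (M / R)"
proof -
  let ?J = "tent D x0 R"
  have "Op g D \<theta> W \<alpha> (\<lambda>x. of_real (?J x) * \<phi> x) x - of_real (?J x) * Op g D \<theta> W \<alpha> \<phi> x
      = (\<Sum>p\<in>steps D. of_real (hopc g \<theta> p) * (of_real (?J (move x p) - ?J x) * \<phi> (move x p)))"
    by (simp add: Op_def algebra_simps sum_distrib_left sum_subtractf)
  also have "cmod \<dots> \<le> hopn g D \<theta> * (M / R)"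
  proof (rule hop_bound[OF assms(1)])
    fix p assume "p \<in> steps D"
    hence "\<bar>?J (move x p) - ?J x\<bar> \<le> 1 / R" using tent_lipschitz assms by blast
    hence "\<bar>?J (move x p) - ?J x\<bar> * cmod (\<phi> (move x p)) \<le> 1 / R * M"
      using assms by (intro mult_mono) auto
    thus "cmod (of_real (?J (move x p) - ?J x) * \<phi> (move x p)) \<le> M / R" by (simp only: norm_mult norm_of_real) simp
  qed
  finally show ?thesis .
qed

section \<open>Resolvents of the tilted operators\<close>

text \<open>Banach's fixed point theorem for bounded functions, with the contraction phrased through
  pointwise bounds \<open>b\<close> instead of a metric. The iterates from 0 telescope into a series
  dominated by \<open>q ^ n * M\<close>.\<close>

lemma sup_contraction_fixpoint:
  fixes T :: "('a \<Rightarrow> complex) \<Rightarrow> 'a \<Rightarrow> complex"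
  assumes q: "0 \<le> q" "q < 1"
    and T: "\<And>u w b x. bd u \<Longrightarrow> bd w \<Longrightarrow> (\<And>y. cmod (u y - w y) \<le> b) \<Longrightarrow> cmod (T u x - T w x) \<le> q * b"
    and M: "\<And>x. cmod (T (\<lambda>_. 0) x) \<le> M"
  obtains u where "bd u" "T u = u"
proof -
  define s where "s n = (T ^^ n) (\<lambda>_. 0)" for n
  define d where "d x n = s (Suc n) x - s n x" for x n
  have bs: "bd (s n)" for n
  proof (induction n)
    case 0 then show ?case by (auto simp: s_def bd_def intro: exI[of _ 0])
  next
    case (Suc n)
    then obtain B where B: "\<And>x. cmod (s n x) \<le> B" by (auto simp: bd_def)
    have "cmod (T (s n) x - T (\<lambda>_. 0) x) \<le> q * B" for x
      by (rule T[OF Suc]) (use B in \<open>auto simp: bd_def intro: exI[of _ 0]\<close>)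
    hence "cmod (T (s n) x) \<le> q * B + M" for x
      using norm_triangle_sub[of "T (s n) x" "T (\<lambda>_. 0) x"] M[of x] by (smt (verit))
    then show ?case by (auto simp: s_def intro: bdI)
  qed
  define u where "u x = suminf (d x)" for x
  have d: "cmod (d x n) \<le> q ^ n * M" for x n
  proof (induction n arbitrary: x)
    case 0 then show ?case using M by (simp add: d_def s_def)
  next
    case (Suc n)
    have "cmod (T (s (Suc n)) x - T (s n) x) \<le> q * (q ^ n * M)"
      by (rule T[OF bs bs]) (use Suc in \<open>simp add: d_def\<close>)
    then show ?case by (simp add: d_def s_def mult.assoc)
  qed
  have sg: "summable (\<lambda>i. q ^ (i + n) * M)" for n
    using q by (intro summable_mult2) (simp add: power_add summable_mult2 summable_geometric)
  have sd: "summable (d x)" for x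
    by (rule summable_comparison_test'[OF sg[of 0], of 0]) (use d in auto)
  have tail: "cmod (u x - s n x) \<le> q ^ n * (M / (1 - q))" for x n
  proof -
    have "(\<Sum>i<n. d x i) = s n x"
      unfolding d_def by (subst sum_lessThan_telescope) (simp add: s_def)
    hence "u x - s n x = (\<Sum>i. d x (i + n))"
      unfolding u_def using suminf_minus_initial_segment[OF sd, of x n] by simp
    also have "cmod \<dots> \<le> (\<Sum>i. q ^ (i + n) * M)"
      by (rule norm_suminf_le[OF _ sg]) (use d in auto)
    also have "\<dots> = (\<Sum>i. q ^ i * (q ^ n * M))" by (simp add: power_add mult.assoc)
    also have "\<dots> = (\<Sum>i. q ^ i) * (q ^ n * M)" using q by (simp add: suminf_mult2[symmetric] summable_geometric)
    also have "\<dots> = q ^ n * (M / (1 - q))" using q by (simp add: suminf_geometric)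
    finally show ?thesis .
  qed
  have ub: "bd u" using tail[of _ 0] by (intro bdI[of u "M / (1 - q)"]) (simp add: s_def)
  have "T u x = u x" for x
  proof -
    have "cmod (T u x - u x) \<le> 2 * (M / (1 - q)) * q ^ Suc n" for n
    proof -
      have "cmod (T u x - T (s n) x) \<le> q * (q ^ n * (M / (1 - q)))"
        by (rule T[OF ub bs]) (rule tail)
      moreover have "T (s n) = s (Suc n)" by (simp add: s_def)
      ultimately have "cmod (T u x - s (Suc n) x) \<le> q ^ Suc n * (M / (1 - q))" by (simp add: mult.assoc)
      with tail[of x "Suc n"] show ?thesis
        using norm_triangle_ineq4[of "T u x - s (Suc n) x" "u x - s (Suc n) x"]
        by (simp add: mult.commute[of "q ^ Suc n"] del: power_Suc)
    qed
    moreover have "(\<lambda>n. 2 * (M / (1 - q)) * q ^ Suc n) \<longlonglongrightarrow> 2 * (M / (1 - q)) * 0"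
      using q LIMSEQ_Suc[OF LIMSEQ_power_zero[of q]] by (intro tendsto_mult tendsto_const) simp
    ultimately have "cmod (T u x - u x) \<le> 0"
      by (intro LIMSEQ_le_const) auto
    thus ?thesis by simp
  qed
  then show ?thesis using that[OF ub] by blast
qed

definition solv :: "real \<Rightarrow> nat set \<Rightarrow> (nat \<Rightarrow> real) \<Rightarrow> (conf \<Rightarrow> real) \<Rightarrow> complex \<Rightarrow> bool" where
  "solv g D \<theta> W \<alpha> \<longleftrightarrow> (\<forall>\<phi>. bd \<phi> \<longrightarrow> (\<exists>u. bd u \<and> (\<forall>x. Op g D \<theta> W \<alpha> u x = \<phi> x)))"

text \<open>Dividing by the diagonal entries turns the equation into a fixed point problem with
  ratio at most \<open>hopn / (2 * hopn + 1)\<close>, hence at most 1/2.\<close>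

lemma solv_large_Im:
  assumes fin: "finite D" and y: "\<bar>Im \<alpha>\<bar> \<ge> 2 * hopn g D \<theta> + 1"
  shows "solv g D \<theta> W \<alpha>"
  unfolding solv_def
proof (intro allI impI)
  fix \<phi> :: "conf \<Rightarrow> complex" assume "bd \<phi>"
  then obtain M where M: "\<And>x. cmod (\<phi> x) \<le> M" by (auto simp: bd_def)
  let ?h = "hopn g D \<theta>"
  have h0: "?h \<ge> 0" by (rule hopn_nonneg)
  have big: "2 * ?h + 1 \<le> cmod (of_real (W x) - \<alpha>)" for x
    using abs_Im_le_cmod[of "of_real (W x) - \<alpha>"] y by simp
  define T where "T u x = (\<phi> x - (\<Sum>p\<in>steps D. of_real (hopc g \<theta> p) * u (move x p))) / (of_real (W x) - \<alpha>)" for u x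
  obtain u where u: "bd u" "T u = u"
  proof (rule sup_contraction_fixpoint[of "1/2" T M])
    fix u w :: "conf \<Rightarrow> complex" and b x
    assume b: "\<And>y. cmod (u y - w y) \<le> b"
    have b0: "b \<ge> 0" using b norm_ge_zero order_trans by blast
    have "T u x - T w x = (\<Sum>p\<in>steps D. of_real (hopc g \<theta> p) * (w (move x p) - u (move x p))) / (of_real (W x) - \<alpha>)"
      by (simp add: T_def diff_divide_distrib[symmetric] sum_subtractf algebra_simps)
    hence "cmod (T u x - T w x) = cmod (\<Sum>p\<in>steps D. of_real (hopc g \<theta> p) * (w (move x p) - u (move x p))) / cmod (of_real (W x) - \<alpha>)"
      by (simp add: norm_divide)
    also have "\<dots> \<le> (?h * b) / (2 * ?h + 1)"
      using big[of x] h0 b0 hop_bound[OF fin, of "\<lambda>p. w (move x p) - u (move x p)" b g \<theta>] b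
      by (intro frac_le) (auto simp: norm_minus_commute)
    also have "\<dots> \<le> 1/2 * b"
      using h0 b0 by (simp add: divide_simps) (simp add: algebra_simps)
    finally show "cmod (T u x - T w x) \<le> 1/2 * b" .
  next
    fix x
    have "cmod (\<phi> x) / cmod (of_real (W x) - \<alpha>) \<le> M / 1"
      using big[of x] h0 M[of x] order_trans[OF norm_ge_zero M[of x]] by (intro frac_le) auto
    thus "cmod (T (\<lambda>_. 0) x) \<le> M" by (simp add: T_def norm_divide)
  qed auto
  have "Op g D \<theta> W \<alpha> u x = \<phi> x" for x
  proof -
    have "of_real (W x) - \<alpha> \<noteq> 0" using big[of x] h0 by auto
    moreover have "u x = T u x" using u(2) by simp
    ultimately have "u x * (of_real (W x) - \<alpha>) = \<phi> x - (\<Sum>p\<in>steps D. of_real (hopc g \<theta> p) * u (move x p))"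
      by (simp add: T_def)
    thus ?thesis by (simp add: Op_def algebra_simps)
  qed
  with u(1) show "\<exists>u. bd u \<and> (\<forall>x. Op g D \<theta> W \<alpha> u x = \<phi> x)" by blast
qed

text \<open>Rewritten at \<open>\<alpha>\<close>, the equation has right-hand side
  \<open>\<phi> + \<delta> * u\<close>. A right inverse at \<open>\<alpha>\<close>, which the lower
  bound makes Lipschitz with constant \<open>C\<close>, gives a contraction of ratio
  \<open>C * cmod \<delta>\<close>.\<close>

lemma solv_near:
  assumes lb: "LB g D \<theta> W \<alpha> C" and d: "C * cmod \<delta> \<le> 1/2" and s: "solv g D \<theta> W \<alpha>"
  shows "solv g D \<theta> W (\<alpha> + \<delta>)"
  unfolding solv_def
proof (intro allI impI)
  fix \<phi> :: "conf \<Rightarrow> complex" assume phi: "bd \<phi>"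
  obtain r where r: "\<And>\<psi>. bd \<psi> \<Longrightarrow> bd (r \<psi>)" "\<And>\<psi> x. bd \<psi> \<Longrightarrow> Op g D \<theta> W \<alpha> (r \<psi>) x = \<psi> x"
    using s unfolding solv_def by metis
  have diff: "cmod (r \<psi> x - r \<psi>' x) \<le> C * b"
    if "bd \<psi>" "bd \<psi>'" "\<And>y. cmod (\<psi> y - \<psi>' y) \<le> b" for \<psi> \<psi>' x b
    by (rule LBD[OF lb bd_diff, of "r \<psi>" "r \<psi>'"]) (use r that in \<open>simp_all add: Op_diff\<close>)
  define T where "T u = r (\<lambda>x. \<phi> x + \<delta> * u x)" for u
  have b: "bd (\<lambda>x. \<phi> x + \<delta> * u x)" if "bd u" for u
    using phi that by (intro bd_add bd_cmult)
  obtain M where M: "\<And>x. cmod (r \<phi> x) \<le> M" using r(1)[OF phi] by (auto simp: bd_def)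
  obtain u where u: "bd u" "T u = u"
  proof (rule sup_contraction_fixpoint[of "1/2" T M])
    fix u w :: "conf \<Rightarrow> complex" and \<beta> x
    assume uw: "bd u" "bd w" "\<And>y. cmod (u y - w y) \<le> \<beta>"
    have b0: "\<beta> \<ge> 0" using uw(3) norm_ge_zero order_trans by blast
    have "cmod (T u x - T w x) \<le> C * (cmod \<delta> * \<beta>)"
      unfolding T_def
    proof (rule diff[OF b b])
      fix y
      have "\<phi> y + \<delta> * u y - (\<phi> y + \<delta> * w y) = \<delta> * (u y - w y)" by (simp add: algebra_simps)
      thus "cmod (\<phi> y + \<delta> * u y - (\<phi> y + \<delta> * w y)) \<le> cmod \<delta> * \<beta>"
        using uw(3)[of y] by (simp only: norm_mult) (simp add: mult_left_mono)
    qed (use uw in auto)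
    also have "\<dots> = (C * cmod \<delta>) * \<beta>" by simp
    also have "\<dots> \<le> 1/2 * \<beta>" using d b0 by (rule mult_right_mono)
    finally show "cmod (T u x - T w x) \<le> 1/2 * \<beta>" .
  qed (use M in \<open>auto simp: T_def\<close>)
  have "Op g D \<theta> W (\<alpha> + \<delta>) u x = \<phi> x" for x
  proof -
    have "Op g D \<theta> W \<alpha> u x = Op g D \<theta> W \<alpha> (T u) x" using u by simp
    also have "\<dots> = \<phi> x + \<delta> * u x" unfolding T_def by (rule r(2)[OF b[OF u(1)]])
    finally show ?thesis by (simp add: Op_shift)
  qed
  with u(1) show "\<exists>u. bd u \<and> (\<forall>x. Op g D \<theta> W (\<alpha> + \<delta>) u x = \<phi> x)" by blast
qed

lemma solv_of_LB:
  assumes fin: "finite D" and nr: "\<And>\<beta>. Im \<beta> \<noteq> 0 \<Longrightarrow> \<exists>C. LB g D \<theta> W \<beta> C"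
    and lb: "LB g D \<theta> W \<alpha> C"
  shows "solv g D \<theta> W \<alpha>"
proof -
  define \<sigma> :: real where "\<sigma> = (if Im \<alpha> \<ge> 0 then 1 else -1)"
  define Y where "Y = 2 * hopn g D \<theta> + 1"
  define p where "p s = \<alpha> + \<i> * of_real (\<sigma> * s)" for s
  have Y: "Y > 0" using hopn_nonneg[of g D \<theta>] by (simp add: Y_def)
  have \<sigma>: "\<bar>\<sigma>\<bar> = 1" by (simp add: \<sigma>_def)
  have ex: "\<exists>C. LB g D \<theta> W (p s) C" if "s \<ge> 0" for s
  proof (cases "s = 0")
    case True then show ?thesis using lb by (auto simp: p_def)
  next
    case False
    hence "Im (p s) \<noteq> 0" using that by (auto simp: p_def \<sigma>_def)
    then show ?thesis using nr by blast
  qed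
  have "\<exists>C>0. LB g D \<theta> W (p s) C" if "s \<ge> 0" for s
  proof -
    from ex[OF that] obtain C where "LB g D \<theta> W (p s) C" by blast
    hence "LB g D \<theta> W (p s) (max C 1)" by (rule LB_mono) simp
    thus ?thesis by (intro exI[of _ "max C 1"]) simp
  qed
  then obtain C where C: "\<And>s. s \<ge> 0 \<Longrightarrow> C s > 0 \<and> LB g D \<theta> W (p s) (C s)" by metis
  have "solv g D \<theta> W (p 0)"
  proof (rule connected_induction_simple[of "{0..Y}" Y 0 "\<lambda>s. solv g D \<theta> W (p s)"])
    have "\<bar>Im (p Y)\<bar> \<ge> Y" using Y by (auto simp: p_def \<sigma>_def)
    thus "solv g D \<theta> W (p Y)" using solv_large_Im[OF fin] by (simp add: Y_def)
    fix s assume s: "s \<in> {0..Y}"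
    \<comment> \<open>Within \<open>ball s r\<close> the constant degrades to at most
      \<open>4 * C s\<close>, and two points are less than \<open>2 * r\<close> apart;
      \<open>4 * C s * (2 * r) = 1/2\<close> is what \<open>solv_near\<close> tolerates.\<close>
    define r where "r = 1 / (16 * C s)"
    have Cs: "C s > 0" "LB g D \<theta> W (p s) (C s)" using C s by auto
    have r: "r > 0" using Cs by (simp add: r_def)
    have pd: "p b = p a + \<i> * of_real (\<sigma> * (b - a))" for a b
      by (simp add: p_def algebra_simps)
    have nd: "cmod (\<i> * of_real (\<sigma> * t)) = \<bar>t\<bar>" for t
      by (simp only: norm_mult norm_of_real norm_ii) (simp add: abs_mult \<sigma>)
    have "solv g D \<theta> W (p b)" if ab: "a \<in> ball s r" "b \<in> ball s r" "solv g D \<theta> W (p a)" for a b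
    proof -
      have 1: "\<bar>a - s\<bar> < r" "\<bar>b - a\<bar> < 2 * r" using ab by (auto simp: dist_real_def)
      have "\<bar>a - s\<bar> * C s \<le> r * C s" "4 * C s * \<bar>b - a\<bar> \<le> 4 * C s * (2 * r)"
        using 1 Cs by (auto intro!: mult_left_mono mult_right_mono)
      moreover have "r * C s = 1 / 16" using Cs by (simp add: r_def)
      ultimately have 2: "\<bar>a - s\<bar> * C s \<le> 1/4" "4 * C s * \<bar>b - a\<bar> \<le> 1/2" by (simp_all add: mult.commute mult.left_commute)
      have "LB g D \<theta> W (p a) (4 * C s)"
        using LB_pert[OF Cs(2,1), of "\<i> * of_real (\<sigma> * (a - s))"] 2 unfolding nd pd[of a s] by blast
      from solv_near[OF this, of "\<i> * of_real (\<sigma> * (b - a))"] ab(3) 2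
      show ?thesis unfolding nd pd[of b a] by blast
    qed
    hence "\<forall>a\<in>{0..Y} \<inter> ball s r. \<forall>b\<in>{0..Y} \<inter> ball s r. solv g D \<theta> W (p a) \<longrightarrow> solv g D \<theta> W (p b)"
      by blast
    moreover have "openin (top_of_set {0..Y}) ({0..Y} \<inter> ball s r)" "s \<in> {0..Y} \<inter> ball s r"
      using s r by (auto intro: openin_open_Int)
    ultimately show "\<exists>T. openin (top_of_set {0..Y}) T \<and> s \<in> T \<and> (\<forall>x\<in>T. \<forall>y\<in>T. solv g D \<theta> W (p x) \<longrightarrow> solv g D \<theta> W (p y))"
      by blast
  qed (use Y in auto)
  thus ?thesis by (simp add: p_def)
qed

text \<open>The choice is harmless: by \<open>LB_unique\<close> a lower bound leaves at most one
  bounded solution.\<close>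

definition res :: "real \<Rightarrow> nat set \<Rightarrow> (nat \<Rightarrow> real) \<Rightarrow> (conf \<Rightarrow> real) \<Rightarrow> complex \<Rightarrow> (conf \<Rightarrow> complex) \<Rightarrow> conf \<Rightarrow> complex" where
  "res g D \<theta> W \<alpha> \<phi> = (SOME u. bd u \<and> (\<forall>x. Op g D \<theta> W \<alpha> u x = \<phi> x))"

lemma
  assumes "solv g D \<theta> W \<alpha>" "bd \<phi>"
  shows bd_res: "bd (res g D \<theta> W \<alpha> \<phi>)" and Op_res: "Op g D \<theta> W \<alpha> (res g D \<theta> W \<alpha> \<phi>) x = \<phi> x"
proof -
  have "\<exists>u. bd u \<and> (\<forall>x. Op g D \<theta> W \<alpha> u x = \<phi> x)" using assms by (auto simp: solv_def)
  from someI_ex[OF this] show "bd (res g D \<theta> W \<alpha> \<phi>)" "Op g D \<theta> W \<alpha> (res g D \<theta> W \<alpha> \<phi>) x = \<phi> x"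
    by (auto simp: res_def)
qed

lemma res_bound:
  assumes "LB g D \<theta> W \<alpha> C" "solv g D \<theta> W \<alpha>" "\<And>x. cmod (\<phi> x) \<le> M"
  shows "cmod (res g D \<theta> W \<alpha> \<phi> x) \<le> C * M"
  by (rule LBD[OF assms(1)]) (simp_all add: bd_res Op_res assms bdI[of \<phi>, OF assms(3)])

lemma LB_unique:
  assumes "LB g D \<theta> W \<alpha> C" "bd u" "bd w" "\<And>x. Op g D \<theta> W \<alpha> u x = Op g D \<theta> W \<alpha> w x"
  shows "u = w"
proof
  fix x
  have "cmod (u x - w x) \<le> C * 0"
    by (rule LBD[OF assms(1) bd_diff, of u w]) (use assms in \<open>simp_all add: Op_diff\<close>)
  thus "u x = w x" by simp
qed

text \<open>By the resolvent identity the derivative at \<open>\<alpha>\<close> is the resolvent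
  applied twice. The error of the difference quotient is the resolvent at \<open>\<alpha>\<close>
  applied to the increment of the resolvent, which is of order
  \<open>cmod (\<beta> - \<alpha>)\<close> by the common bound \<open>K\<close>.\<close>

lemma res_holomorphic:
  assumes op: "open \<Omega>" and K: "\<And>\<alpha>. \<alpha> \<in> \<Omega> \<Longrightarrow> LB g D \<theta> W \<alpha> K" and s: "\<And>\<alpha>. \<alpha> \<in> \<Omega> \<Longrightarrow> solv g D \<theta> W \<alpha>"
    and phi: "bd \<phi>"
  shows "(\<lambda>\<alpha>. res g D \<theta> W \<alpha> \<phi> x) holomorphic_on \<Omega>"
proof -
  obtain M where M: "\<And>x. cmod (\<phi> x) \<le> M" using phi by (auto simp: bd_def)
  let ?r = "res g D \<theta> W"
  have "((\<lambda>\<alpha>. ?r \<alpha> \<phi> x) has_field_derivative ?r \<alpha> (?r \<alpha> \<phi>) x) (at \<alpha>)" if a: "\<alpha> \<in> \<Omega>" for \<alpha>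
    unfolding has_field_derivative_iff
  proof (rule Lim_transform_within_open[where s = \<Omega>])
    let ?B = "K * (K * (K * M))"
    \<comment> \<open>Outside \<open>\<Omega>\<close> the quotient is replaced by the expected
      limit, so that the error bound holds for all \<open>\<beta> \<noteq> \<alpha>\<close>.\<close>
    define q where "q \<beta> = (if \<beta> \<in> \<Omega> then (?r \<beta> \<phi> x - ?r \<alpha> \<phi> x) / (\<beta> - \<alpha>) else ?r \<alpha> (?r \<alpha> \<phi>) x)" for \<beta>
    show "q \<midarrow>\<alpha>\<rightarrow> ?r \<alpha> (?r \<alpha> \<phi>) x"
    proof (rule Lim_null[THEN iffD2], rule Lim_null_comparison)
      have "cmod (q \<beta> - ?r \<alpha> (?r \<alpha> \<phi>) x) \<le> \<bar>?B\<bar> * cmod (\<beta> - \<alpha>)" if ne: "\<beta> \<noteq> \<alpha>" for \<beta>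
      proof (cases "\<beta> \<in> \<Omega>")
        case False then show ?thesis by (simp add: q_def)
      next
        case b: True
        note ba = bd_res[OF s[OF a] phi] and bb = bd_res[OF s[OF b] phi]
        have Ob: "Op g D \<theta> W \<alpha> (?r \<beta> \<phi>) y = \<phi> y + (\<beta> - \<alpha>) * ?r \<beta> \<phi> y" for y
          using Op_res[OF s[OF b] phi, of y] Op_shift[of g D \<theta> W \<alpha> "\<beta> - \<alpha>" "?r \<beta> \<phi>" y] by simp
        have df: "cmod (?r \<beta> \<phi> y - ?r \<alpha> \<phi> y) \<le> K * (cmod (\<beta> - \<alpha>) * (K * M))" for y
          by (rule LBD[OF K[OF a] bd_diff[OF bb ba]])
             (simp add: Op_diff Ob Op_res[OF s[OF a] phi] norm_mult mult_left_mono res_bound[OF K[OF b] s[OF b] M])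
        let ?d = "\<lambda>y. 1 / (\<beta> - \<alpha>) * (?r \<beta> \<phi> y - ?r \<alpha> \<phi> y) - ?r \<alpha> (?r \<alpha> \<phi>) y"
        have "cmod (?d x) \<le> K * (K * (cmod (\<beta> - \<alpha>) * (K * M)))"
        proof (rule LBD[OF K[OF a]])
          show "bd ?d" by (intro bd_diff bd_cmult ba bb bd_res[OF s[OF a]])
          show "cmod (Op g D \<theta> W \<alpha> ?d y) \<le> K * (cmod (\<beta> - \<alpha>) * (K * M))" for y
          proof -
            have "Op g D \<theta> W \<alpha> ?d y = 1 / (\<beta> - \<alpha>) * ((\<phi> y + (\<beta> - \<alpha>) * ?r \<beta> \<phi> y) - \<phi> y) - ?r \<alpha> \<phi> y"
              by (simp only: Op_diff Op_cmult Ob Op_res[OF s[OF a]] phi ba)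
            also have "\<dots> = ?r \<beta> \<phi> y - ?r \<alpha> \<phi> y" using ne by simp
            finally show ?thesis using df[of y] by simp
          qed
        qed
        also have "K * (K * (cmod (\<beta> - \<alpha>) * (K * M))) = ?B * cmod (\<beta> - \<alpha>)" by simp
        also have "\<dots> \<le> \<bar>?B\<bar> * cmod (\<beta> - \<alpha>)" by (intro mult_right_mono) auto
        finally show ?thesis using b by (simp add: q_def)
      qed
      thus "\<forall>\<^sub>F \<beta> in at \<alpha>. cmod (q \<beta> - ?r \<alpha> (?r \<alpha> \<phi>) x) \<le> \<bar>?B\<bar> * cmod (\<beta> - \<alpha>)"
        by (auto simp: eventually_at_filter)
      show "(\<lambda>\<beta>. \<bar>?B\<bar> * cmod (\<beta> - \<alpha>)) \<midarrow>\<alpha>\<rightarrow> 0"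
        by (rule tendsto_eq_intros refl | simp)+
    qed
    show "q \<beta> = (?r \<beta> \<phi> x - ?r \<alpha> \<phi> x) / (\<beta> - \<alpha>)" if "\<beta> \<in> \<Omega>" for \<beta> using that by (simp add: q_def)
  qed (use op a in auto)
  thus ?thesis using holomorphic_on_open[OF op] by blast
qed

section \<open>A Liouville argument for two-cluster operators\<close>

text \<open>A compactness proof, so that \<open>\<delta>\<close> is uniform in \<open>f\<close> and
  \<open>g\<close>. If no \<open>\<delta>\<close> works, Montel's theorem gives limits on the two
  sheets that agree on the overlap. They glue to a bounded entire function, which is constant, and
  the decay \<open>1 / y\<close> makes it 0, against \<open>e < cmod (f \<alpha>0)\<close> along the
  sequence.\<close>

lemma two_sheet_Liouville:
  fixes K K1 e :: real
  assumes op: "open \<Omega>1" "open \<Omega>2" and cov: "\<Omega>1 \<union> \<Omega>2 = UNIV" and a0: "\<alpha>0 \<in> \<Omega>1" and e: "e > 0"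
  obtains \<delta> where "\<delta> > 0"
    "\<And>f g. f holomorphic_on \<Omega>1 \<Longrightarrow> g holomorphic_on \<Omega>2 \<Longrightarrow>
       (\<And>z. z \<in> \<Omega>1 \<Longrightarrow> cmod (f z) \<le> K) \<Longrightarrow> (\<And>z. z \<in> \<Omega>2 \<Longrightarrow> cmod (g z) \<le> K) \<Longrightarrow>
       (\<And>z y. z \<in> \<Omega>1 \<Longrightarrow> y > 0 \<Longrightarrow> \<bar>Im z\<bar> \<ge> K1 + y \<Longrightarrow> cmod (f z) \<le> 1 / y) \<Longrightarrow>
       (\<And>z y. z \<in> \<Omega>2 \<Longrightarrow> y > 0 \<Longrightarrow> \<bar>Im z\<bar> \<ge> K1 + y \<Longrightarrow> cmod (g z) \<le> 1 / y) \<Longrightarrow>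
       (\<And>z. z \<in> \<Omega>1 \<Longrightarrow> z \<in> \<Omega>2 \<Longrightarrow> cmod (f z - g z) \<le> \<delta>) \<Longrightarrow> cmod (f \<alpha>0) \<le> e"
proof -
  define H where "H \<Omega> = {f. f holomorphic_on \<Omega> \<and> (\<forall>z\<in>\<Omega>. cmod (f z) \<le> K) \<and>
      (\<forall>z y. z \<in> \<Omega> \<longrightarrow> y > 0 \<longrightarrow> \<bar>Im z\<bar> \<ge> K1 + y \<longrightarrow> cmod (f z) \<le> 1 / y)}" for \<Omega>
  have "\<exists>\<delta>>0. \<forall>f\<in>H \<Omega>1. \<forall>g\<in>H \<Omega>2. (\<forall>z\<in>\<Omega>1 \<inter> \<Omega>2. cmod (f z - g z) \<le> \<delta>) \<longrightarrow> cmod (f \<alpha>0) \<le> e"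
  proof (rule ccontr)
    assume neg: "\<not> ?thesis"
    define Q where "Q n f g \<longleftrightarrow> f \<in> H \<Omega>1 \<and> g \<in> H \<Omega>2 \<and> (\<forall>z\<in>\<Omega>1 \<inter> \<Omega>2. cmod (f z - g z) \<le> 1 / real (Suc n)) \<and> e < cmod (f \<alpha>0)"
      for n f g
    have "\<exists>f g. Q n f g" for n
    proof (rule ccontr)
      assume nQ: "\<not> ?thesis"
      have "\<forall>f\<in>H \<Omega>1. \<forall>g\<in>H \<Omega>2. (\<forall>z\<in>\<Omega>1 \<inter> \<Omega>2. cmod (f z - g z) \<le> 1 / real (Suc n)) \<longrightarrow> cmod (f \<alpha>0) \<le> e"
      proof (intro ballI impI, rule ccontr)
        fix f g assume "f \<in> H \<Omega>1" "g \<in> H \<Omega>2" "\<forall>z\<in>\<Omega>1 \<inter> \<Omega>2. cmod (f z - g z) \<le> 1 / real (Suc n)" "\<not> cmod (f \<alpha>0) \<le> e"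
        hence "Q n f g" by (simp add: Q_def not_le)
        thus False using nQ by blast
      qed
      moreover have "1 / real (Suc n) > 0" by simp
      ultimately show False using neg by blast
    qed
    then obtain F G where Q: "\<And>n. Q n (F n) (G n)" by metis
    have F: "F n \<in> H \<Omega>1" and G: "G n \<in> H \<Omega>2" and F0: "e < cmod (F n \<alpha>0)" for n using Q[of n] unfolding Q_def by blast+
    have FG: "cmod (F n z - G n z) \<le> 1 / real (Suc n)" if "z \<in> \<Omega>1" "z \<in> \<Omega>2" for n z
      using Q[of n] that unfolding Q_def by blast
    have bdH: "\<exists>B. \<forall>h\<in>H \<Omega>. \<forall>z\<in>K'. cmod (h z) \<le> B" if "K' \<subseteq> \<Omega>" for K' \<Omega>
      using that by (intro exI[of _ K]) (auto simp: H_def)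
    have holH: "f \<in> H \<Omega> \<Longrightarrow> f holomorphic_on \<Omega>" for f \<Omega> by (simp add: H_def)
    obtain f r where f: "f holomorphic_on \<Omega>1" "strict_mono r" "\<And>x. x \<in> \<Omega>1 \<Longrightarrow> (\<lambda>n. F (r n) x) \<longlonglongrightarrow> f x"
      by (rule Montel[where \<F> = F and \<H> = "H \<Omega>1", OF op(1) holH bdH]) (use F in blast)+
    obtain g s where g: "g holomorphic_on \<Omega>2" "strict_mono s" "\<And>x. x \<in> \<Omega>2 \<Longrightarrow> (\<lambda>n. G (r (s n)) x) \<longlonglongrightarrow> g x"
      by (rule Montel[where \<F> = "\<lambda>n. G (r n)" and \<H> = "H \<Omega>2", OF op(2) holH bdH]) (use G in blast)+
    have f3: "(\<lambda>n. F (r (s n)) x) \<longlonglongrightarrow> f x" if "x \<in> \<Omega>1" for x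
      using LIMSEQ_subseq_LIMSEQ[OF f(3)[OF that] g(2)] by (simp add: o_def)
    have rs: "strict_mono (r \<circ> s)" using f(2) g(2) by (rule strict_mono_o)
    have eq: "f x = g x" if "x \<in> \<Omega>1" "x \<in> \<Omega>2" for x
    proof -
      have "(\<lambda>n. 1 / real (Suc (r (s n)))) \<longlonglongrightarrow> 0"
        using LIMSEQ_subseq_LIMSEQ[OF LIMSEQ_Suc[OF lim_1_over_n] rs] by (simp add: o_def)
      hence "(\<lambda>n. F (r (s n)) x - G (r (s n)) x) \<longlonglongrightarrow> 0"
        by (rule Lim_null_comparison[rotated]) (use FG that in auto)
      moreover have "(\<lambda>n. F (r (s n)) x - G (r (s n)) x) \<longlonglongrightarrow> f x - g x"
        by (intro tendsto_diff f3 g(3) that)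
      ultimately show ?thesis using LIMSEQ_unique by fastforce
    qed
    define k where "k z = (if z \<in> \<Omega>1 then f z else g z)" for z
    have kf: "k z = f z" if "z \<in> \<Omega>1" for z using that by (simp add: k_def)
    have kg: "k z = g z" if "z \<in> \<Omega>2" for z using that eq by (simp add: k_def)
    have "k holomorphic_on \<Omega>1 \<union> \<Omega>2"
      using f(1) g(1) kf kg by (intro holomorphic_on_Un op) (auto elim!: holomorphic_transform)
    hence hol: "k holomorphic_on UNIV" using cov by simp
    have inH: "cmod (k z) \<le> B" if "\<And>n. z \<in> \<Omega>1 \<Longrightarrow> cmod (F n z) \<le> B" "\<And>n. z \<in> \<Omega>2 \<Longrightarrow> cmod (G n z) \<le> B" for z B
    proof (cases "z \<in> \<Omega>1")
      case True
      show ?thesis unfolding kf[OF True]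
        by (rule Lim_bounded[OF tendsto_norm[OF f3[OF True]], of 0]) (use that True in auto)
    next
      case False
      hence z: "z \<in> \<Omega>2" using cov by auto
      show ?thesis unfolding kg[OF z]
        by (rule Lim_bounded[OF tendsto_norm[OF g(3)[OF z]], of 0]) (use that z in auto)
    qed
    have "cmod (k z) \<le> K" for z by (rule inH) (use F G in \<open>unfold H_def, blast+\<close>)
    hence "bounded (range k)" by (auto simp: bounded_iff)
    from Liouville_theorem[OF hol this] obtain c where c: "\<And>z. k z = c"
      unfolding constant_on_def by blast
    have decF: "cmod (F n z) \<le> 1 / y" if "z \<in> \<Omega>1" "y > 0" "\<bar>Im z\<bar> \<ge> K1 + y" for n z y
      using F[of n] that unfolding H_def by blast
    have decG: "cmod (G n z) \<le> 1 / y" if "z \<in> \<Omega>2" "y > 0" "\<bar>Im z\<bar> \<ge> K1 + y" for n z y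
      using G[of n] that unfolding H_def by blast
    \<comment> \<open>Evaluation high up on the imaginary axis, where the decay bound holds on
      either sheet.\<close>
    have "cmod c \<le> 1 / real (Suc n)" for n
    proof -
      have "cmod (k (Complex 0 (\<bar>K1\<bar> + real (Suc n)))) \<le> 1 / real (Suc n)"
        by (rule inH; (rule decF | rule decG)) simp_all
      thus ?thesis using c by simp
    qed
    moreover have "(\<lambda>n. 1 / real (Suc n)) \<longlonglongrightarrow> 0" using LIMSEQ_Suc[OF lim_1_over_n] .
    ultimately have "cmod c \<le> 0" by (intro LIMSEQ_le_const) auto
    hence "f \<alpha>0 = 0" using c[of \<alpha>0] kf[OF a0] by simp
    hence "(\<lambda>n. cmod (F (r (s n)) \<alpha>0)) \<longlonglongrightarrow> 0" using tendsto_norm[OF f3[OF a0]] by simp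
    hence "e \<le> 0" by (rule LIMSEQ_le_const) (use F0 less_imp_le in blast)
    thus False using e by simp
  qed
  then obtain \<delta> where d: "\<delta> > 0" "\<And>f g. f \<in> H \<Omega>1 \<Longrightarrow> g \<in> H \<Omega>2 \<Longrightarrow> (\<forall>z\<in>\<Omega>1 \<inter> \<Omega>2. cmod (f z - g z) \<le> \<delta>) \<Longrightarrow> cmod (f \<alpha>0) \<le> e"
    by blast
  show ?thesis
  proof (rule that[OF d(1)], goal_cases)
    case (1 f g)
    have "f \<in> H \<Omega>1" unfolding H_def using 1(1,3,5) by blast
    moreover have "g \<in> H \<Omega>2" unfolding H_def using 1(2,4,6) by blast
    ultimately show ?case using d(2) 1(7) by blast
  qed
qed

section \<open>Boundedly supported functions and commuting cluster operators\<close>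

definition bsupp :: "nat set \<Rightarrow> int \<Rightarrow> (conf \<Rightarrow> complex) \<Rightarrow> bool" where
  "bsupp D L \<phi> \<longleftrightarrow> (\<forall>x. \<phi> x \<noteq> 0 \<longrightarrow> (\<forall>k\<in>D. \<bar>x k\<bar> \<le> L))"

lemma double_sum_bound:
  fixes f :: "nat \<Rightarrow> nat \<Rightarrow> real"
  assumes fin: "finite A" "finite A'" and f: "\<And>i j. i \<in> A' \<Longrightarrow> j \<in> A \<Longrightarrow> \<bar>f i j\<bar> \<le> \<epsilon>" and e: "\<epsilon> \<ge> 0"
  shows "\<bar>\<Sum>j\<in>A. \<Sum>i\<in>{i\<in>A'. i < j}. f i j\<bar> \<le> real (card A) * (real (card A') * \<epsilon>)"
proof -
  have "\<bar>\<Sum>i\<in>{i\<in>A'. i < j}. f i j\<bar> \<le> real (card A') * \<epsilon>" if "j \<in> A" for j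
  proof -
    have "\<bar>\<Sum>i\<in>{i\<in>A'. i < j}. f i j\<bar> \<le> (\<Sum>i\<in>{i\<in>A'. i < j}. \<bar>f i j\<bar>)" by (rule sum_abs)
    also have "\<dots> \<le> (\<Sum>i\<in>{i\<in>A'. i < j}. \<epsilon>)" using f that by (intro sum_mono) auto
    also have "\<dots> = real (card {i\<in>A'. i < j}) * \<epsilon>" by simp
    also have "\<dots> \<le> real (card A') * \<epsilon>"
      using e fin by (intro mult_right_mono of_nat_mono card_mono) auto
    finally show ?thesis .
  qed
  hence "(\<Sum>j\<in>A. \<bar>\<Sum>i\<in>{i\<in>A'. i < j}. f i j\<bar>) \<le> (\<Sum>j\<in>A. real (card A') * \<epsilon>)" by (rule sum_mono)
  also have "\<dots> = real (card A) * (real (card A') * \<epsilon>)" by simp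
  finally show ?thesis by (rule order_trans[OF sum_abs])
qed

lemma pot_bound:
  assumes fin: "finite D" and v: "\<And>n. \<bar>v n\<bar> \<le> B"
  shows "\<bar>pot v D x\<bar> \<le> real (card D) * (real (card D) * B)"
  unfolding pot_def using order_trans[OF abs_ge_zero v[of 0]] by (intro double_sum_bound fin v)

definition Ubox :: "real \<Rightarrow> nat set \<Rightarrow> real \<Rightarrow> int \<Rightarrow> real" where
  "Ubox h D B L = real (card D) * (real (card D) * B) + 2 * \<bar>h\<bar> * (real (card D) * of_int L)"

lemma U_bound:
  assumes fin: "finite D" and v: "\<And>n. \<bar>v n\<bar> \<le> B" and L: "\<And>k. k \<in> D \<Longrightarrow> \<bar>x k\<bar> \<le> L"
  shows "\<bar>U h v D x\<bar> \<le> Ubox h D B L"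
proof -
  have "real_of_int \<bar>tot D x\<bar> \<le> (\<Sum>k\<in>D. \<bar>of_int (x k)\<bar>)"
    unfolding tot_def of_int_abs of_int_sum by (rule sum_abs)
  also have "\<dots> \<le> (\<Sum>k\<in>D. of_int L)"
    using L by (intro sum_mono) (simp flip: of_int_abs)
  finally have "real_of_int \<bar>tot D x\<bar> \<le> real (card D) * of_int L" by simp
  hence "\<bar>2 * h * of_int (tot D x)\<bar> \<le> 2 * \<bar>h\<bar> * (real (card D) * of_int L)"
    by (simp add: abs_mult mult_left_mono)
  thus ?thesis using pot_bound[of D v B x, OF fin v] unfolding U_def Ubox_def by linarith
qed

text \<open>The field term is unbounded, so a bounded image needs a box for the coordinates in
  \<open>D\<close>. The inert coordinates may range freely, because \<open>U\<close> does not see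
  them.\<close>

lemma bd_Op_bsupp:
  assumes fin: "finite D" and v: "\<And>n. \<bar>v n\<bar> \<le> B" and b: "bd \<phi>" and s: "bsupp D L \<phi>"
  shows "bd (Op g D \<theta> (U h v D) \<alpha> \<phi>)"
proof -
  obtain M where M: "\<And>x. cmod (\<phi> x) \<le> M" using b by (auto simp: bd_def)
  have M0: "M \<ge> 0" using M norm_ge_zero order_trans by blast
  have "cmod (Op g D \<theta> (U h v D) \<alpha> \<phi> x) \<le> hopn g D \<theta> * M + (\<bar>Ubox h D B L\<bar> + cmod \<alpha>) * M" for x
  proof -
    have "cmod ((of_real (U h v D x) - \<alpha>) * \<phi> x) \<le> (\<bar>Ubox h D B L\<bar> + cmod \<alpha>) * M"
    proof (cases "\<phi> x = 0")
      case True then show ?thesis using M0 by simp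
    next
      case False
      hence "\<bar>U h v D x\<bar> \<le> Ubox h D B L" using s by (intro U_bound fin v) (auto simp: bsupp_def)
      hence "cmod (of_real (U h v D x) - \<alpha>) \<le> \<bar>Ubox h D B L\<bar> + cmod \<alpha>"
        using norm_triangle_ineq4[of "of_real (U h v D x)" \<alpha>] by (smt (verit) norm_of_real)
      thus ?thesis using M M0 by (simp add: norm_mult mult_mono)
    qed
    moreover have "cmod (\<Sum>p\<in>steps D. of_real (hopc g \<theta> p) * \<phi> (move x p)) \<le> hopn g D \<theta> * M"
      by (rule hop_bound[OF fin]) (rule M)
    ultimately show ?thesis unfolding Op_def by (rule norm_triangle_mono[rotated])
  qed
  thus ?thesis by (rule bdI)
qed

lemma move_commute: "fst p \<noteq> fst q \<Longrightarrow> move (move x p) q = move (move x q) p"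
  by (rule ext) (simp add: move_def)

lemma move_other: "k \<noteq> fst p \<Longrightarrow> move x p k = x k"
  by (simp add: move_def)

lemma U_cong:
  assumes "\<And>k. k \<in> D \<Longrightarrow> x k = y k"
  shows "U h v D x = U h v D y"
proof -
  have "pot v D x = pot v D y" unfolding pot_def by (intro sum.cong refl) (simp add: assms)
  moreover have "tot D x = tot D y" unfolding tot_def by (intro sum.cong refl) (simp add: assms)
  ultimately show ?thesis by (simp add: U_def)
qed

lemma U_move: "D \<inter> D' = {} \<Longrightarrow> p \<in> steps D' \<Longrightarrow> U h v D (move x p) = U h v D x"
  by (rule U_cong, rule move_other) (auto simp: steps_def)

lemma Op_commute:
  assumes "finite D" "finite D'" and dis: "D \<inter> D' = {}"
  shows "Op g D \<theta> (U h v D) \<alpha> (Op g D' \<theta> (U h v D') \<beta> \<phi>) x = Op g D' \<theta> (U h v D') \<beta> (Op g D \<theta> (U h v D) \<alpha> \<phi>) x"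
proof -
  have dis': "D' \<inter> D = {}" using dis by blast
  let ?c = "\<lambda>p. complex_of_real (hopc g \<theta> p)"
  have mm: "move (move x p) q = move (move x q) p" if "p \<in> steps D" "q \<in> steps D'" for p q
    using that dis by (intro move_commute) (auto simp: steps_def)
  have "(\<Sum>p\<in>steps D. ?c p * (\<Sum>q\<in>steps D'. ?c q * \<phi> (move (move x p) q))) = (\<Sum>p\<in>steps D. \<Sum>q\<in>steps D'. ?c p * (?c q * \<phi> (move (move x q) p)))"
    unfolding sum_distrib_left
  proof (intro sum.cong refl)
    fix p q assume "p \<in> steps D" "q \<in> steps D'"
    thus "?c p * (?c q * \<phi> (move (move x p) q)) = ?c p * (?c q * \<phi> (move (move x q) p))" using mm[of p q] by simp
  qed
  also have "\<dots> = (\<Sum>q\<in>steps D'. ?c q * (\<Sum>p\<in>steps D. ?c p * \<phi> (move (move x q) p)))"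
    unfolding sum_distrib_left
  proof (subst sum.swap, intro sum.cong refl)
    fix p q show "?c p * (?c q * \<phi> (move (move x q) p)) = ?c q * (?c p * \<phi> (move (move x q) p))" by simp
  qed
  finally have sw: "(\<Sum>p\<in>steps D. ?c p * (\<Sum>q\<in>steps D'. ?c q * \<phi> (move (move x p) q))) = (\<Sum>q\<in>steps D'. ?c q * (\<Sum>p\<in>steps D. ?c p * \<phi> (move (move x q) p)))" .
  have d: "(\<Sum>p\<in>steps D. ?c p * ((of_real (U h v D' (move x p)) - \<beta>) * \<phi> (move x p))) = (of_real (U h v D' x) - \<beta>) * (\<Sum>p\<in>steps D. ?c p * \<phi> (move x p))"
    unfolding sum_distrib_left by (intro sum.cong refl) (simp add: U_move[OF dis'])
  have d': "(\<Sum>p\<in>steps D'. ?c p * ((of_real (U h v D (move x p)) - \<alpha>) * \<phi> (move x p))) = (of_real (U h v D x) - \<alpha>) * (\<Sum>p\<in>steps D'. ?c p * \<phi> (move x p))"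
    unfolding sum_distrib_left by (intro sum.cong refl) (simp add: U_move[OF dis])
  show ?thesis
    unfolding Op_def distrib_left sum.distrib d d' sw by (simp only: mult.left_commute ac_simps)
qed

lemma Op_split:
  assumes "finite D" "finite D'" "D \<inter> D' = {}"
  shows "Op g (D \<union> D') \<theta> (\<lambda>x. U h v D x + U h v D' x) E \<phi> x
       = Op g D \<theta> (U h v D) \<alpha> \<phi> x + Op g D' \<theta> (U h v D') (E - \<alpha>) \<phi> x"
proof -
  have "steps (D \<union> D') = steps D \<union> steps D'" "steps D \<inter> steps D' = {}" using assms by (auto simp: steps_def)
  thus ?thesis using assms by (simp add: Op_def sum.union_disjoint algebra_simps)
qed

text \<open>The issue is whether the unbounded operator of \<open>D\<close> maps \<open>u\<close> to
  a bounded function. The operator of \<open>D'\<close> never moves coordinates in \<open>D\<close>,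
  so cutting \<open>u\<close> off to the box in these coordinates gives another solution. By
  uniqueness \<open>u\<close> inherits the box of \<open>\<phi>\<close>, and a second appeal to
  uniqueness gives commutation.\<close>

lemma res_commute:
  assumes fin: "finite D" "finite D'" and dis: "D \<inter> D' = {}" and v: "\<And>n. \<bar>v n\<bar> \<le> B"
    and lb: "LB g D' \<theta> (U h v D') \<beta> C" and s: "solv g D' \<theta> (U h v D') \<beta>"
    and b: "bd \<phi>" and su: "bsupp D L \<phi>"
  defines "u \<equiv> res g D' \<theta> (U h v D') \<beta> \<phi>"
  shows "bd (Op g D \<theta> (U h v D) \<alpha> u)" "Op g D \<theta> (U h v D) \<alpha> u = res g D' \<theta> (U h v D') \<beta> (Op g D \<theta> (U h v D) \<alpha> \<phi>)"
proof -
  have bu: "bd u" unfolding u_def by (rule bd_res[OF s b])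
  have Ou: "Op g D' \<theta> (U h v D') \<beta> u x = \<phi> x" for x unfolding u_def by (rule Op_res[OF s b])
  define w where "w x = (if \<forall>k\<in>D. \<bar>x k\<bar> \<le> L then u x else 0)" for x
  have "w = u"
  proof (rule LB_unique[OF lb])
    obtain M where M: "\<And>x. cmod (u x) \<le> M" using bu by (auto simp: bd_def)
    have "cmod (w x) \<le> M" for x using M[of x] norm_ge_zero[of "u x"] by (simp add: w_def del: norm_ge_zero)
    thus "bd w" by (rule bdI)
    fix x
    have *: "(\<forall>k\<in>D. \<bar>move x p k\<bar> \<le> L) \<longleftrightarrow> (\<forall>k\<in>D. \<bar>x k\<bar> \<le> L)" if "p \<in> steps D'" for p
    proof (intro ball_cong refl)
      fix k assume "k \<in> D"
      hence "k \<noteq> fst p" using that dis by (auto simp: steps_def)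
      thus "\<bar>move x p k\<bar> \<le> L \<longleftrightarrow> \<bar>x k\<bar> \<le> L" by (simp add: move_other)
    qed
    hence wm: "w (move x p) = (if \<forall>k\<in>D. \<bar>x k\<bar> \<le> L then u (move x p) else 0)" if "p \<in> steps D'" for p
      unfolding w_def by (subst *[OF that]) (rule refl)
    have "Op g D' \<theta> (U h v D') \<beta> w x = (if \<forall>k\<in>D. \<bar>x k\<bar> \<le> L then Op g D' \<theta> (U h v D') \<beta> u x else 0)"
    proof (cases "\<forall>k\<in>D. \<bar>x k\<bar> \<le> L")
      case True
      have "w (move x p) = u (move x p)" if "p \<in> steps D'" for p unfolding wm[OF that] if_P[OF True] ..
      moreover have "w x = u x" unfolding w_def if_P[OF True] ..
      ultimately show ?thesis unfolding if_P[OF True] by (simp add: Op_def)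
    next
      case False
      have "w (move x p) = 0" if "p \<in> steps D'" for p unfolding wm[OF that] if_not_P[OF False] ..
      moreover have "w x = 0" unfolding w_def if_not_P[OF False] ..
      ultimately show ?thesis unfolding if_not_P[OF False] by (simp add: Op_def)
    qed
    thus "Op g D' \<theta> (U h v D') \<beta> w x = Op g D' \<theta> (U h v D') \<beta> u x"
      using su unfolding Ou bsupp_def by (cases "\<forall>k\<in>D. \<bar>x k\<bar> \<le> L") auto
  qed (rule bu)
  hence "bsupp D L u" by (auto simp: bsupp_def w_def fun_eq_iff split: if_splits)
  from bd_Op_bsupp[OF fin(1) v bu this] show b1: "bd (Op g D \<theta> (U h v D) \<alpha> u)" .
  have b2: "bd (Op g D \<theta> (U h v D) \<alpha> \<phi>)" by (rule bd_Op_bsupp[OF fin(1) v b su])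
  have Ou': "Op g D' \<theta> (U h v D') \<beta> u = \<phi>" using Ou by auto
  show "Op g D \<theta> (U h v D) \<alpha> u = res g D' \<theta> (U h v D') \<beta> (Op g D \<theta> (U h v D) \<alpha> \<phi>)"
  proof (rule LB_unique[OF lb b1 bd_res[OF s b2]])
    fix x
    show "Op g D' \<theta> (U h v D') \<beta> (Op g D \<theta> (U h v D) \<alpha> u) x = Op g D' \<theta> (U h v D') \<beta> (res g D' \<theta> (U h v D') \<beta> (Op g D \<theta> (U h v D) \<alpha> \<phi>)) x"
      by (simp only: Op_commute[OF fin dis, symmetric] Ou' Op_res[OF s b2])
  qed
qed

section \<open>Uniform constants from compactness and periodicity\<close>

lemma compact_uniform_const:
  fixes P :: "real \<Rightarrow> 'a::metric_space \<Rightarrow> bool"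
  assumes Q: "compact Q" and loc: "\<And>\<alpha>. \<alpha> \<in> Q \<Longrightarrow> \<exists>C r. r > 0 \<and> (\<forall>\<beta>\<in>ball \<alpha> r. P C \<beta>)"
    and mono: "\<And>C C' \<alpha>. P C \<alpha> \<Longrightarrow> C \<le> C' \<Longrightarrow> P C' \<alpha>"
  shows "\<exists>K. \<forall>\<alpha>\<in>Q. P K \<alpha>"
proof -
  define G where "G p \<alpha> \<longleftrightarrow> snd p > 0 \<and> (\<forall>\<beta>\<in>ball \<alpha> (snd p). P (fst p) \<beta>)" for p \<alpha>
  have "\<forall>\<alpha>\<in>Q. \<exists>p. G p \<alpha>"
  proof
    fix \<alpha> assume "\<alpha> \<in> Q"
    then obtain C r where "r > 0 \<and> (\<forall>\<beta>\<in>ball \<alpha> r. P C \<beta>)" using loc by blast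
    hence "G (C, r) \<alpha>" unfolding G_def fst_conv snd_conv .
    thus "\<exists>p. G p \<alpha>" ..
  qed
  from bchoice[OF this] obtain f where f: "\<forall>\<alpha>\<in>Q. G (f \<alpha>) \<alpha>" by (rule exE)
  define C r where "C \<alpha> = fst (f \<alpha>)" and "r \<alpha> = snd (f \<alpha>)" for \<alpha>
  have Cr: "r \<alpha> > 0" "\<And>\<beta>. \<beta> \<in> ball \<alpha> (r \<alpha>) \<Longrightarrow> P (C \<alpha>) \<beta>" if "\<alpha> \<in> Q" for \<alpha>
    using bspec[OF f that] unfolding G_def C_def r_def by auto
  have "Q \<subseteq> (\<Union>\<alpha>\<in>Q. ball \<alpha> (r \<alpha>))"
  proof
    fix \<alpha> assume a: "\<alpha> \<in> Q"
    show "\<alpha> \<in> (\<Union>\<alpha>\<in>Q. ball \<alpha> (r \<alpha>))" by (rule UN_I[OF a]) (simp add: Cr(1)[OF a])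
  qed
  then obtain F where F: "F \<subseteq> Q" "finite F" "Q \<subseteq> (\<Union>\<alpha>\<in>F. ball \<alpha> (r \<alpha>))"
    by (rule compactE_image[OF Q open_ball])
  define K where "K = (\<Sum>\<alpha>\<in>F. \<bar>C \<alpha>\<bar>)"
  have "P K \<beta>" if "\<beta> \<in> Q" for \<beta>
  proof -
    from subsetD[OF F(3) that] obtain \<alpha> where a: "\<alpha> \<in> F" "\<beta> \<in> ball \<alpha> (r \<alpha>)" by (rule UN_E)
    have "\<alpha> \<in> Q" using F(1) a(1) by (rule subsetD)
    hence "P (C \<alpha>) \<beta>" using a(2) by (rule Cr(2))
    moreover have "C \<alpha> \<le> K"
      unfolding K_def using member_le_sum[of \<alpha> F "\<lambda>\<alpha>. \<bar>C \<alpha>\<bar>"] a(1) F(2) by simp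
    ultimately show ?thesis by (rule mono)
  qed
  thus ?thesis by blast
qed

lemma LB_local:
  assumes "LB g D \<theta> W \<alpha> C"
  shows "\<exists>C r. r > 0 \<and> (\<forall>\<beta>\<in>ball \<alpha> r. LB g D \<theta> W \<beta> C)"
proof -
  define K where "K = max C 1"
  have K: "K > 0" and lb: "LB g D \<theta> W \<alpha> K"
    using assms LB_mono[of g D \<theta> W \<alpha> C K] by (simp_all add: K_def)
  have "LB g D \<theta> W (\<alpha> + \<delta>) (4 * K)" if "cmod \<delta> < 1 / (4 * K)" for \<delta>
  proof (rule LB_pert[OF lb K])
    have "cmod \<delta> * K \<le> 1 / (4 * K) * K" using that K by (intro mult_right_mono) auto
    thus "cmod \<delta> * K \<le> 1 / 4" using K by simp
  qed
  hence "LB g D \<theta> W \<beta> (4 * K)" if "\<beta> \<in> ball \<alpha> (1 / (4 * K))" for \<beta>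
    using that by (metis add_diff_cancel_left' diff_add_cancel add.commute dist_commute dist_norm mem_ball)
  moreover have "1 / (4 * K) > 0" using K by simp
  ultimately show ?thesis by (intro exI[of _ "4 * K"] exI[of _ "1 / (4 * K)"] conjI ballI)
qed

text \<open>Both families of bounds share a period in \<open>\<alpha>\<close>, and large imaginary
  parts are covered by \<open>LB_large_Im\<close>. What remains is a compact rectangle, on which the
  locally uniform bounds have a common constant.\<close>

lemma uniform_LB:
  assumes fin: "finite D1" "finite D2" and ne: "D1 \<noteq> {}" "D2 \<noteq> {}" and h: "h \<noteq> 0"
    and cov: "\<And>\<alpha>. (\<exists>C. LB g D1 \<theta> (U h v D1) \<alpha> C) \<or> (\<exists>C. LB g D2 \<theta> (U h v D2) (E - \<alpha>) C)"
  shows "\<exists>K. \<forall>\<alpha>. LB g D1 \<theta> (U h v D1) \<alpha> K \<or> LB g D2 \<theta> (U h v D2) (E - \<alpha>) K"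
proof -
  let ?P = "\<lambda>C \<alpha>. LB g D1 \<theta> (U h v D1) \<alpha> C \<or> LB g D2 \<theta> (U h v D2) (E - \<alpha>) C"
  \<comment> \<open>Common period: moving the first cluster by \<open>card D2\<close> sites, or the
    second by \<open>card D1\<close> sites, changes the energy by
    \<open>2 * h * card D1 * card D2\<close> up to sign.\<close>
  define p where "p = 2 * \<bar>h\<bar> * (real (card D1) * real (card D2))"
  have p: "p > 0" using fin ne h by (simp add: p_def card_gt_0_iff)
  define Y where "Y = hopn g D1 \<theta> + 1"
  let ?Q = "cbox (Complex 0 (-Y)) (Complex p Y)"
  have "\<exists>K. \<forall>\<alpha>\<in>?Q. ?P K \<alpha>"
  proof (rule compact_uniform_const)
    fix \<alpha>
    from cov[of \<alpha>] show "\<exists>C r. r > 0 \<and> (\<forall>\<beta>\<in>ball \<alpha> r. ?P C \<beta>)"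
    proof (elim disjE exE)
      fix C assume "LB g D1 \<theta> (U h v D1) \<alpha> C"
      from LB_local[OF this] show ?thesis by blast
    next
      fix C assume "LB g D2 \<theta> (U h v D2) (E - \<alpha>) C"
      from LB_local[OF this] obtain C r where "r > 0" and C: "\<forall>\<beta>\<in>ball (E - \<alpha>) r. LB g D2 \<theta> (U h v D2) \<beta> C" by blast
      moreover have "LB g D2 \<theta> (U h v D2) (E - \<beta>) C" if "\<beta> \<in> ball \<alpha> r" for \<beta>
        using bspec[OF C, of "E - \<beta>"] that by (simp add: dist_norm norm_minus_commute)
      ultimately show ?thesis by blast
    qed
  next
    fix C C' \<alpha> assume "?P C \<alpha>" "C \<le> C'"
    thus "?P C' \<alpha>" using LB_mono[of g D1 \<theta> "U h v D1" \<alpha> C C'] LB_mono[of g D2 \<theta> "U h v D2" "E - \<alpha>" C C'] by blast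
  qed (rule compact_cbox)
  then obtain K0 where K0: "\<And>\<alpha>. \<alpha> \<in> ?Q \<Longrightarrow> ?P K0 \<alpha>" by blast
  define K where "K = max K0 1"
  have "?P K \<alpha>" for \<alpha>
  proof (cases "\<bar>Im \<alpha>\<bar> \<ge> Y")
    case True
    hence "LB g D1 \<theta> (U h v D1) \<alpha> (1 / 1)" by (intro LB_large_Im fin) (auto simp: Y_def)
    hence "LB g D1 \<theta> (U h v D1) \<alpha> K" by (rule LB_mono) (simp add: K_def)
    thus ?thesis ..
  next
    case False
    define n where "n = \<lfloor>Re \<alpha> / p\<rfloor>"
    \<comment> \<open>The period \<open>p\<close> is built from \<open>\<bar>h\<bar>\<close>, so the
      sign of \<open>h\<close> goes into the number of sites.\<close>
    define m where "m = n * (if h > 0 then 1 else -1)"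
    define \<alpha>' where "\<alpha>' = \<alpha> - of_real (p * of_int n)"
    have "of_int n * p \<le> Re \<alpha>" unfolding n_def using p by (rule floor_divide_lower)
    moreover have "Re \<alpha> \<le> (of_int n + 1) * p" unfolding n_def
      using floor_divide_upper[OF p, of "Re \<alpha>"] by simp
    moreover have "- Y \<le> Im \<alpha>" "Im \<alpha> \<le> Y" using False by linarith+
    ultimately have "\<alpha>' \<in> ?Q" by (simp add: in_cbox_complex_iff \<alpha>'_def algebra_simps abs_le_iff)
    hence "?P K0 \<alpha>'" by (rule K0)
    moreover have "K0 \<le> K" by (simp add: K_def)
    ultimately have PK: "?P K \<alpha>'"
      using LB_mono[of g D1 \<theta> "U h v D1" \<alpha>' K0 K] LB_mono[of g D2 \<theta> "U h v D2" "E - \<alpha>'" K0 K] by blast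
    have hm: "p * of_int n = 2 * h * real (card D1) * real (card D2) * of_int m"
      by (auto simp: p_def m_def)
    have 1: "\<alpha>' = \<alpha> + of_real (2 * h * real (card D1) * of_int (- (int (card D2) * m)))"
      unfolding \<alpha>'_def hm by simp
    have 2: "E - \<alpha>' = E - \<alpha> + of_real (2 * h * real (card D2) * of_int (int (card D1) * m))"
      unfolding \<alpha>'_def hm by (simp add: algebra_simps)
    show ?thesis
    proof (rule disjE[OF PK])
      assume "LB g D1 \<theta> (U h v D1) \<alpha>' K"
      thus ?thesis unfolding 1 using LB_translate[OF fin(1)] by blast
    next
      assume "LB g D2 \<theta> (U h v D2) (E - \<alpha>') K"
      thus ?thesis unfolding 2 using LB_translate[OF fin(2)] by blast
    qed
  qed
  thus ?thesis by blast
qed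

text \<open>Let \<open>A\<close>, \<open>B\<close> be the cluster operators and
  \<open>\<eta> = (A + B - E) \<phi>\<close>. As
  \<open>(A - \<alpha>) + (B - (E - \<alpha>)) = A + B - E\<close>, the sum of both resolvents of
  \<open>\<phi>\<close> is the product of the resolvents applied to \<open>\<eta>\<close>, hence
  small. Liouville makes the first summand small at one parameter, and applying
  \<open>A - \<alpha>\<close> there recovers \<open>\<phi>\<close>. Bounded support keeps all images
  bounded.\<close>

lemma two_cluster_core:
  fixes g h :: real and E :: complex
  assumes fin: "finite D1" "finite D2" and ne: "D1 \<noteq> {}" "D2 \<noteq> {}" and dis: "D1 \<inter> D2 = {}" and h: "h \<noteq> 0"
    and v: "\<And>n. \<bar>v n\<bar> \<le> B"
    and nr1: "\<And>\<beta>. Im \<beta> \<noteq> 0 \<Longrightarrow> \<exists>C. LB g D1 \<theta> (U h v D1) \<beta> C"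
    and nr2: "\<And>\<beta>. Im \<beta> \<noteq> 0 \<Longrightarrow> \<exists>C. LB g D2 \<theta> (U h v D2) \<beta> C"
    and cov: "\<And>\<alpha>. (\<exists>C. LB g D1 \<theta> (U h v D1) \<alpha> C) \<or> (\<exists>C. LB g D2 \<theta> (U h v D2) (E - \<alpha>) C)"
  shows "\<exists>\<delta>>0. \<forall>\<phi> L x0. bsupp (D1 \<union> D2) L \<phi> \<longrightarrow> (\<forall>x. cmod (\<phi> x) \<le> 1) \<longrightarrow>
     (\<forall>x. cmod (Op g (D1 \<union> D2) \<theta> (\<lambda>x. U h v D1 x + U h v D2 x) E \<phi> x) \<le> \<delta>) \<longrightarrow> cmod (\<phi> x0) < 1/2"
proof -
  let ?W1 = "U h v D1" and ?W2 = "U h v D2"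
  from uniform_LB[OF fin ne h cov] obtain K00 where
    K00: "\<And>\<alpha>. LB g D1 \<theta> ?W1 \<alpha> K00 \<or> LB g D2 \<theta> ?W2 (E - \<alpha>) K00" by blast
  define K0 where "K0 = max K00 1"
  have "K00 \<le> K0" by (simp add: K0_def)
  hence K0: "K0 \<ge> 1" "\<And>\<alpha>. LB g D1 \<theta> ?W1 \<alpha> K0 \<or> LB g D2 \<theta> ?W2 (E - \<alpha>) K0"
    using K00 LB_mono[of g D1 \<theta> ?W1 _ K00 K0] LB_mono[of g D2 \<theta> ?W2 _ K00 K0] by (simp add: K0_def, blast)
  define K where "K = 4 * K0"
  have K: "K > 0" using K0 by (simp add: K_def)
  define r where "r = 1 / (4 * K0)"
  have r: "r > 0" "r * K0 = 1/4" using K0(1) by (auto simp: r_def)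
  \<comment> \<open>Thickening makes the sheets open: within distance \<open>r\<close> of a point
    with constant \<open>K0\<close> the bound persists with \<open>K = 4 * K0\<close>.\<close>
  define \<Omega>1 where "\<Omega>1 = (\<Union>\<beta>\<in>{\<beta>. LB g D1 \<theta> ?W1 \<beta> K0}. ball \<beta> r)"
  define \<Omega>2 where "\<Omega>2 = (\<Union>\<beta>\<in>{\<beta>. LB g D2 \<theta> ?W2 (E - \<beta>) K0}. ball \<beta> r)"
  have op: "open \<Omega>1" "open \<Omega>2" by (auto simp: \<Omega>1_def \<Omega>2_def)
  have cv: "\<Omega>1 \<union> \<Omega>2 = UNIV"
  proof -
    have "\<alpha> \<in> \<Omega>1 \<union> \<Omega>2" for \<alpha>
      using K0(2)[of \<alpha>] centre_in_ball[of \<alpha> r] r(1) unfolding \<Omega>1_def \<Omega>2_def by blast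
    thus ?thesis by blast
  qed
  have L1: "LB g D1 \<theta> ?W1 \<alpha> K" if "\<alpha> \<in> \<Omega>1" for \<alpha>
  proof -
    from that obtain \<beta> where b: "LB g D1 \<theta> ?W1 \<beta> K0" "cmod (\<alpha> - \<beta>) < r"
      by (auto simp: \<Omega>1_def dist_norm norm_minus_commute)
    have "cmod (\<alpha> - \<beta>) * K0 \<le> r * K0" using b(2) K0(1) by (intro mult_right_mono) auto
    with LB_pert[OF b(1), of "\<alpha> - \<beta>"] K0 r show ?thesis by (simp add: K_def)
  qed
  have L2: "LB g D2 \<theta> ?W2 (E - \<alpha>) K" if "\<alpha> \<in> \<Omega>2" for \<alpha>
  proof -
    from that obtain \<beta> where b: "LB g D2 \<theta> ?W2 (E - \<beta>) K0" "cmod (\<beta> - \<alpha>) < r"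
      by (auto simp: \<Omega>2_def dist_norm)
    have "cmod (\<beta> - \<alpha>) * K0 \<le> r * K0" using b(2) K0(1) by (intro mult_right_mono) auto
    with LB_pert[OF b(1), of "\<beta> - \<alpha>"] K0 r show ?thesis by (simp add: K_def)
  qed
  have S1: "solv g D1 \<theta> ?W1 \<alpha>" if "\<alpha> \<in> \<Omega>1" for \<alpha>
    by (rule solv_of_LB[OF fin(1) nr1 L1[OF that]])
  have S2: "solv g D2 \<theta> ?W2 (E - \<alpha>)" if "\<alpha> \<in> \<Omega>2" for \<alpha>
    by (rule solv_of_LB[OF fin(2) nr2 L2[OF that]])
  define P where "P = int (card D1) * int (card D2)"
  have P: "P > 0" using fin ne by (simp add: P_def card_gt_0_iff)
  define tr where "tr m \<alpha> = \<alpha> - of_real (2 * h * of_int P * of_int m)" for m :: int and \<alpha> :: complex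
  have tr1: "tr m \<alpha> \<in> \<Omega>1" if "\<alpha> \<in> \<Omega>1" for m \<alpha>
  proof -
    from that obtain \<beta> where b: "LB g D1 \<theta> ?W1 \<beta> K0" "dist \<beta> \<alpha> < r" by (auto simp: \<Omega>1_def)
    have "\<beta> = tr m \<beta> + of_real (2 * h * real (card D1) * of_int (int (card D2) * m))"
      by (simp add: tr_def P_def)
    with b(1) LB_translate[OF fin(1)] have "LB g D1 \<theta> ?W1 (tr m \<beta>) K0" by metis
    moreover have "dist (tr m \<beta>) (tr m \<alpha>) < r" using b(2) by (simp add: tr_def dist_norm)
    ultimately show ?thesis by (auto simp: \<Omega>1_def)
  qed
  have tr2: "tr m \<alpha> \<in> \<Omega>2" if "\<alpha> \<in> \<Omega>2" for m \<alpha>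
  proof -
    from that obtain \<beta> where b: "LB g D2 \<theta> ?W2 (E - \<beta>) K0" "dist \<beta> \<alpha> < r" by (auto simp: \<Omega>2_def)
    have "E - \<beta> = E - tr m \<beta> + of_real (2 * h * real (card D2) * of_int (- (int (card D1) * m)))"
      by (simp add: tr_def P_def algebra_simps)
    with b(1) LB_translate[OF fin(2)] have "LB g D2 \<theta> ?W2 (E - tr m \<beta>) K0" by metis
    moreover have "dist (tr m \<beta>) (tr m \<alpha>) < r" using b(2) by (simp add: tr_def dist_norm)
    ultimately show ?thesis by (auto simp: \<Omega>2_def)
  qed
  \<comment> \<open>At height \<open>K1 + y\<close> the imaginary parts of \<open>\<alpha>\<close>
    and of \<open>E - \<alpha>\<close> both exceed the respective hopping norm by at least
    \<open>y\<close>.\<close>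
  define K1 where "K1 = hopn g D1 \<theta> + hopn g D2 \<theta> + \<bar>Im E\<bar>"
  define \<alpha>0 where "\<alpha>0 = Complex 0 (K1 + 1)"
  have hbn: "hopn g D1 \<theta> \<ge> 0" "hopn g D2 \<theta> \<ge> 0" by (rule hopn_nonneg)+
  have "LB g D1 \<theta> ?W1 \<alpha>0 (1 / 1)"
    by (rule LB_large_Im[OF fin(1)]) (use hbn in \<open>auto simp: \<alpha>0_def K1_def\<close>)
  hence "LB g D1 \<theta> ?W1 \<alpha>0 K0" using K0(1) LB_mono by simp
  hence a0: "\<alpha>0 \<in> \<Omega>1" using r by (force simp: \<Omega>1_def)
  \<comment> \<open>\<open>Q\<close> bounds the diagonal entry at \<open>x0\<close> after a shift of
    \<open>\<alpha>0\<close> by periods, independently of \<open>x0\<close>. The choice of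
    \<open>e\<close> then makes the recovery of \<open>\<phi>\<close> cost at most
    \<open>(hopn + Q) * e \<le> 1/4\<close>.\<close>
  define Q where "Q = real (card D1) * (real (card D1) * B) + 2 * \<bar>h\<bar> * of_int P + cmod \<alpha>0"
  have B0: "B \<ge> 0" using v[of 0] by linarith
  have Q: "Q \<ge> 0" using B0 P by (simp add: Q_def)
  define e where "e = 1 / (4 * (hopn g D1 \<theta> + Q + 1))"
  have e: "e > 0" using hbn Q by (simp add: e_def)
  obtain \<delta> where d: "\<delta> > 0" and dd:
    "\<And>f k. f holomorphic_on \<Omega>1 \<Longrightarrow> k holomorphic_on \<Omega>2 \<Longrightarrow>
       (\<And>z. z \<in> \<Omega>1 \<Longrightarrow> cmod (f z) \<le> K) \<Longrightarrow> (\<And>z. z \<in> \<Omega>2 \<Longrightarrow> cmod (k z) \<le> K) \<Longrightarrow>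
       (\<And>z y. z \<in> \<Omega>1 \<Longrightarrow> y > 0 \<Longrightarrow> \<bar>Im z\<bar> \<ge> K1 + y \<Longrightarrow> cmod (f z) \<le> 1 / y) \<Longrightarrow>
       (\<And>z y. z \<in> \<Omega>2 \<Longrightarrow> y > 0 \<Longrightarrow> \<bar>Im z\<bar> \<ge> K1 + y \<Longrightarrow> cmod (k z) \<le> 1 / y) \<Longrightarrow>
       (\<And>z. z \<in> \<Omega>1 \<Longrightarrow> z \<in> \<Omega>2 \<Longrightarrow> cmod (f z - k z) \<le> \<delta>) \<Longrightarrow> cmod (f \<alpha>0) \<le> e"
    by (rule two_sheet_Liouville[OF op cv a0 e, of K K1]) blast
  show ?thesis
  proof (intro exI[of _ "\<delta> / (K * K)"] conjI allI impI)
    show "\<delta> / (K * K) > 0" using d K by simp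
    fix \<phi> L x0
    assume su: "bsupp (D1 \<union> D2) L \<phi>" and le1: "\<forall>x. cmod (\<phi> x) \<le> 1"
      and eta: "\<forall>x. cmod (Op g (D1 \<union> D2) \<theta> (\<lambda>x. ?W1 x + ?W2 x) E \<phi> x) \<le> \<delta> / (K * K)"
    have su1: "bsupp D1 L \<phi>" and su2: "bsupp D2 L \<phi>" using su by (auto simp: bsupp_def)
    have b: "bd \<phi>" using le1 by (auto intro: bdI)
    define \<eta> where "\<eta> = Op g (D1 \<union> D2) \<theta> (\<lambda>x. ?W1 x + ?W2 x) E \<phi>"
    have be: "bd \<eta>" using eta by (auto simp: \<eta>_def intro: bdI)
    define u where "u \<alpha> = res g D1 \<theta> ?W1 \<alpha> \<phi>" for \<alpha>
    define w where "w \<alpha> = res g D2 \<theta> ?W2 (E - \<alpha>) \<phi>" for \<alpha>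
    have bu: "bd (u \<alpha>)" if "\<alpha> \<in> \<Omega>1" for \<alpha> unfolding u_def by (rule bd_res[OF S1[OF that] b])
    have bw: "bd (w \<alpha>)" if "\<alpha> \<in> \<Omega>2" for \<alpha> unfolding w_def by (rule bd_res[OF S2[OF that] b])
    have diff: "cmod (u \<alpha> y + w \<alpha> y) \<le> \<delta>" if a: "\<alpha> \<in> \<Omega>1" "\<alpha> \<in> \<Omega>2" for \<alpha> y
    proof -
      let ?r2 = "res g D2 \<theta> ?W2 (E - \<alpha>)"
      note s2 = S2[OF a(2)] and l2 = L2[OF a(2)]
      have bO: "bd (Op g D1 \<theta> ?W1 \<alpha> \<phi>)" by (rule bd_Op_bsupp[OF fin(1) v b su1])
      have 1: "Op g D1 \<theta> ?W1 \<alpha> (w \<alpha>) = ?r2 (Op g D1 \<theta> ?W1 \<alpha> \<phi>)"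
        unfolding w_def by (rule res_commute(2)[OF fin dis v l2 s2 b su1])
      \<comment> \<open>By \<open>Op_split\<close> the first operator applied to
        \<open>\<phi>\<close> is \<open>\<eta>\<close> minus the second one applied to
        \<open>\<phi>\<close>, and the resolvent of the second undoes the latter.\<close>
      have 2: "?r2 (Op g D1 \<theta> ?W1 \<alpha> \<phi>) = (\<lambda>x. ?r2 \<eta> x - \<phi> x)"
      proof (rule LB_unique[OF l2])
        show "bd (?r2 (Op g D1 \<theta> ?W1 \<alpha> \<phi>))" by (rule bd_res[OF s2 bO])
        show "bd (\<lambda>x. ?r2 \<eta> x - \<phi> x)" by (intro bd_diff bd_res[OF s2] be b)
        fix x
        show "Op g D2 \<theta> ?W2 (E - \<alpha>) (?r2 (Op g D1 \<theta> ?W1 \<alpha> \<phi>)) x = Op g D2 \<theta> ?W2 (E - \<alpha>) (\<lambda>x. ?r2 \<eta> x - \<phi> x) x"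
          unfolding Op_diff Op_res[OF s2 be] Op_res[OF s2 bO] unfolding \<eta>_def Op_split[OF fin dis, where \<alpha> = \<alpha>] by simp
      qed
      have r2: "cmod (?r2 \<eta> x) \<le> K * (\<delta> / (K * K))" for x
        using res_bound[OF l2 s2, of \<eta>] eta unfolding \<eta>_def by blast
      have "cmod (u \<alpha> y + w \<alpha> y) \<le> K * (K * (\<delta> / (K * K)))"
      proof (rule LBD[OF L1[OF a(1)]])
        show "bd (\<lambda>y. u \<alpha> y + w \<alpha> y)" by (intro bd_add bu bw a)
        fix x
        have "Op g D1 \<theta> ?W1 \<alpha> (\<lambda>y. u \<alpha> y + w \<alpha> y) x = ?r2 \<eta> x"
          unfolding Op_add 1 2 by (simp add: u_def Op_res[OF S1[OF a(1)] b])
        thus "cmod (Op g D1 \<theta> ?W1 \<alpha> (\<lambda>y. u \<alpha> y + w \<alpha> y) x) \<le> K * (\<delta> / (K * K))" using r2 by simp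
      qed
      thus ?thesis using K by simp
    qed
    \<comment> \<open>Shifting \<open>\<alpha>\<close> by a common period of both families of bounds makes the diagonal entry at \<open>x0\<close> bounded.\<close>
    define m where "m = tot D1 x0 div P"
    \<comment> \<open>\<open>tr m\<close> maps each sheet into itself and preserves imaginary parts,
      so the translated functions meet the hypotheses of the Liouville argument with the same
      \<open>\<delta>\<close>.\<close>
    have ue: "cmod (u (tr m \<alpha>0) y) \<le> e" for y
    proof (rule dd[of "\<lambda>\<alpha>. u (tr m \<alpha>) y" "\<lambda>\<alpha>. - w (tr m \<alpha>) y"])
      have trh: "tr m holomorphic_on S" for S unfolding tr_def by (intro holomorphic_intros)
      have "((\<lambda>\<alpha>. u \<alpha> y) \<circ> tr m) holomorphic_on \<Omega>1"
        unfolding u_def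
        by (rule holomorphic_on_compose_gen[OF trh res_holomorphic[OF op(1) L1 S1 b]]) (use tr1 in auto)
      thus "(\<lambda>\<alpha>. u (tr m \<alpha>) y) holomorphic_on \<Omega>1" by (simp add: o_def)
      define \<Omega>' where "\<Omega>' = (\<lambda>\<alpha>. E - \<alpha>) ` \<Omega>2"
      have o': "open \<Omega>'"
      proof -
        have "\<Omega>' = (\<lambda>\<alpha>. E - \<alpha>) -` \<Omega>2" by (force simp: \<Omega>'_def image_iff)
        thus ?thesis using op(2) by (auto intro!: open_vimage continuous_intros)
      qed
      have hr: "(\<lambda>\<beta>. res g D2 \<theta> ?W2 \<beta> \<phi> y) holomorphic_on \<Omega>'"
        by (rule res_holomorphic[OF o' _ _ b, where K = K]) (auto simp: \<Omega>'_def L2 S2)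
      have "(\<lambda>\<alpha>. E - tr m \<alpha>) holomorphic_on \<Omega>2" by (intro holomorphic_intros trh)
      hence "((\<lambda>\<beta>. res g D2 \<theta> ?W2 \<beta> \<phi> y) \<circ> (\<lambda>\<alpha>. E - tr m \<alpha>)) holomorphic_on \<Omega>2"
        by (rule holomorphic_on_compose_gen[OF _ hr]) (use tr2 in \<open>auto simp: \<Omega>'_def\<close>)
      thus "(\<lambda>\<alpha>. - w (tr m \<alpha>) y) holomorphic_on \<Omega>2"
        by (intro holomorphic_on_minus) (simp add: o_def w_def)
      fix z
      have imt: "Im (tr m z) = Im z" by (simp add: tr_def)
      show "cmod (u (tr m z) y) \<le> K" if "z \<in> \<Omega>1"
        using res_bound[OF L1[OF tr1[OF that]] S1[OF tr1[OF that]], of \<phi> 1] le1 by (simp add: u_def)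
      show "cmod (- w (tr m z) y) \<le> K" if "z \<in> \<Omega>2"
        using res_bound[OF L2[OF tr2[OF that]] S2[OF tr2[OF that]], of \<phi> 1] le1 by (simp add: w_def)
      show "cmod (u (tr m z) y - - w (tr m z) y) \<le> \<delta>" if "z \<in> \<Omega>1" "z \<in> \<Omega>2"
        using diff[OF tr1[OF that(1)] tr2[OF that(2)]] by simp
      fix t :: real
      show "cmod (u (tr m z) y) \<le> 1 / t" if "z \<in> \<Omega>1" "t > 0" "\<bar>Im z\<bar> \<ge> K1 + t"
      proof -
        have "LB g D1 \<theta> ?W1 (tr m z) (1 / t)"
          by (rule LB_large_Im[OF fin(1) that(2)]) (use that hbn in \<open>auto simp: K1_def imt\<close>)
        from res_bound[OF this S1[OF tr1[OF that(1)]], of \<phi> 1] le1 show ?thesis by (simp add: u_def)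
      qed
      show "cmod (- w (tr m z) y) \<le> 1 / t" if "z \<in> \<Omega>2" "t > 0" "\<bar>Im z\<bar> \<ge> K1 + t"
      proof -
        have "LB g D2 \<theta> ?W2 (E - tr m z) (1 / t)"
          by (rule LB_large_Im[OF fin(2) that(2)]) (use that hbn in \<open>auto simp: K1_def imt\<close>)
        from res_bound[OF this S2[OF tr2[OF that(1)]], of \<phi> 1] le1 show ?thesis by (simp add: w_def)
      qed
    qed
    let ?a = "tr m \<alpha>0"
    have coef: "cmod (of_real (?W1 x0) - ?a) \<le> Q"
    proof -
      have "tot D1 x0 = P * m + tot D1 x0 mod P" by (simp add: m_def)
      hence "of_int (tot D1 x0) = (of_int P * of_int m + of_int (tot D1 x0 mod P) :: real)" by (metis of_int_add of_int_mult)
      hence "of_real (?W1 x0) - ?a = of_real (pot v D1 x0) - of_real (2 * h * of_int (tot D1 x0 mod P)) - \<alpha>0"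
        by (simp add: U_def tr_def algebra_simps)
      also have "cmod \<dots> \<le> \<bar>pot v D1 x0\<bar> + \<bar>2 * h * of_int (tot D1 x0 mod P)\<bar> + cmod \<alpha>0"
        using norm_triangle_ineq4[of "of_real (pot v D1 x0) - of_real (2 * h * of_int (tot D1 x0 mod P))" \<alpha>0]
          norm_triangle_ineq4[of "complex_of_real (pot v D1 x0)" "of_real (2 * h * of_int (tot D1 x0 mod P))"]
        unfolding norm_of_real by linarith
      also have "\<bar>2 * h * of_int (tot D1 x0 mod P)\<bar> \<le> 2 * \<bar>h\<bar> * of_int P"
      proof -
        have "0 \<le> tot D1 x0 mod P" "tot D1 x0 mod P \<le> P" using pos_mod_sign[OF P] pos_mod_bound[OF P, of "tot D1 x0"] by auto
        thus ?thesis by (simp add: abs_mult mult_left_mono)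
      qed
      finally show ?thesis using pot_bound[of D1 v B x0, OF fin(1) v] unfolding Q_def by linarith
    qed
    have "\<phi> x0 = Op g D1 \<theta> ?W1 ?a (u ?a) x0"
      unfolding u_def by (rule Op_res[OF S1[OF tr1[OF a0]] b, symmetric])
    also have "cmod \<dots> \<le> hopn g D1 \<theta> * e + Q * e"
      unfolding Op_def
    proof (rule norm_triangle_mono)
      show "cmod (\<Sum>p\<in>steps D1. of_real (hopc g \<theta> p) * u ?a (move x0 p)) \<le> hopn g D1 \<theta> * e"
        by (rule hop_bound[OF fin(1)]) (rule ue)
      show "cmod ((of_real (?W1 x0) - ?a) * u ?a x0) \<le> Q * e"
        unfolding norm_mult using coef ue Q by (intro mult_mono) auto
    qed
    also have "\<dots> = (hopn g D1 \<theta> + Q) * e" by (simp add: algebra_simps)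
    also have "\<dots> \<le> 1 / 4" using hbn Q by (simp add: e_def divide_simps)
    finally show "cmod (\<phi> x0) < 1/2" by simp
  qed
qed

lemma bsupp_tent:
  assumes "finite D" "R > 0"
  shows "\<exists>L. bsupp D L (\<lambda>x. of_real (tent D x0 R x) * \<phi> x)"
proof -
  define L where "L = \<lceil>R\<rceil> + (\<Sum>k\<in>D. \<bar>x0 k\<bar>)"
  have "\<bar>x k\<bar> \<le> L" if "tent D x0 R x \<noteq> 0" "k \<in> D" for x k
  proof -
    have "\<bar>of_int (x k - x0 k)\<bar> < R" using tent_supp assms that by blast
    hence "\<bar>x k - x0 k\<bar> \<le> \<lceil>R\<rceil>" by linarith
    moreover have "\<bar>x0 k\<bar> \<le> (\<Sum>k\<in>D. \<bar>x0 k\<bar>)" using that assms by (intro member_le_sum) auto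
    ultimately show ?thesis unfolding L_def by linarith
  qed
  thus ?thesis unfolding bsupp_def by (intro exI[of _ L]) auto
qed

text \<open>Bounded support is obtained by a tent at a near-maximum \<open>x0\<close>. There
  \<open>\<phi>\<close> divided by \<open>M\<close> keeps modulus at least 1/2, exactly what
  \<open>two_cluster_core\<close> forbids.\<close>

lemma two_cluster_LB:
  fixes g h :: real and E :: complex
  assumes fin: "finite D1" "finite D2" and ne: "D1 \<noteq> {}" "D2 \<noteq> {}" and dis: "D1 \<inter> D2 = {}" and h: "h \<noteq> 0"
    and v: "\<And>n. \<bar>v n\<bar> \<le> B"
    and nr1: "\<And>\<beta>. Im \<beta> \<noteq> 0 \<Longrightarrow> \<exists>C. LB g D1 \<theta> (U h v D1) \<beta> C"
    and nr2: "\<And>\<beta>. Im \<beta> \<noteq> 0 \<Longrightarrow> \<exists>C. LB g D2 \<theta> (U h v D2) \<beta> C"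
    and cov: "\<And>\<alpha>. (\<exists>C. LB g D1 \<theta> (U h v D1) \<alpha> C) \<or> (\<exists>C. LB g D2 \<theta> (U h v D2) (E - \<alpha>) C)"
  shows "\<exists>C. LB g (D1 \<union> D2) \<theta> (\<lambda>x. U h v D1 x + U h v D2 x) E C"
proof -
  let ?D = "D1 \<union> D2" and ?W = "\<lambda>x. U h v D1 x + U h v D2 x"
  have finD: "finite ?D" using fin by simp
  from two_cluster_core[OF fin ne dis h v nr1 nr2 cov] obtain \<delta> where d: "\<delta> > 0"
    and core: "\<And>\<phi> L x0. bsupp ?D L \<phi> \<Longrightarrow> (\<forall>x. cmod (\<phi> x) \<le> 1) \<Longrightarrow> (\<forall>x. cmod (Op g ?D \<theta> ?W E \<phi> x) \<le> \<delta>) \<Longrightarrow> cmod (\<phi> x0) < 1/2"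
    by blast
  \<comment> \<open>Wide enough that the commutator with the tent uses up at most half of
    \<open>\<delta>\<close>; the other half is left for \<open>e / M\<close>.\<close>
  define R where "R = 2 * (hopn g ?D \<theta> + 1) / \<delta>"
  have hb0: "hopn g ?D \<theta> \<ge> 0" by (rule hopn_nonneg)
  have R: "R > 0" using d hb0 by (simp add: R_def)
  have hR: "hopn g ?D \<theta> / R \<le> \<delta> / 2" using d hb0 by (simp add: R_def divide_simps)
  have "LB g ?D \<theta> ?W E (2 / \<delta>)"
  proof (rule LBI)
    fix \<phi> :: "conf \<Rightarrow> complex" and e M x0
    assume M: "M > 0" "\<And>x. cmod (\<phi> x) \<le> M" "M / 2 \<le> cmod (\<phi> x0)" and e: "\<And>x. cmod (Op g ?D \<theta> ?W E \<phi> x) \<le> e"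
    show "M \<le> 2 / \<delta> * e"
    proof (rule ccontr)
      assume "\<not> ?thesis"
      hence eM: "e / M \<le> \<delta> / 2" using d M(1) by (simp add: field_simps)
      define \<psi> where "\<psi> x = of_real (1 / M) * (of_real (tent ?D x0 R x) * \<phi> x)" for x
      obtain L where "bsupp ?D L (\<lambda>x. of_real (tent ?D x0 R x) * \<phi> x)" using bsupp_tent[OF finD R] by blast
      hence 1: "bsupp ?D L \<psi>" unfolding \<psi>_def bsupp_def by simp
      have 2: "cmod (\<psi> x) \<le> 1" for x
      proof -
        have "tent ?D x0 R x * cmod (\<phi> x) \<le> 1 * M" using tent_le_1[OF R] tent_nonneg M by (intro mult_mono) auto
        thus ?thesis using M(1) tent_nonneg[of ?D x0 R x] by (simp add: \<psi>_def norm_mult norm_divide divide_simps)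
      qed
      have 3: "cmod (Op g ?D \<theta> ?W E \<psi> x) \<le> \<delta>" for x
      proof -
        let ?O = "Op g ?D \<theta> ?W E"
        have "cmod (?O (\<lambda>x. of_real (tent ?D x0 R x) * \<phi> x) x) \<le> cmod (of_real (tent ?D x0 R x) * ?O \<phi> x) + hopn g ?D \<theta> * (M / R)"
          using Op_tent[where \<phi> = \<phi> and g = g and \<theta> = \<theta> and W = ?W and \<alpha> = E and ?x0.0 = x0 and x = x, OF finD R M(2)]
              norm_triangle_sub[of "?O (\<lambda>x. of_real (tent ?D x0 R x) * \<phi> x) x" "of_real (tent ?D x0 R x) * ?O \<phi> x"] by linarith
        moreover have "cmod (of_real (tent ?D x0 R x) * ?O \<phi> x) \<le> 1 * e"
          unfolding norm_mult using tent_le_1[OF R, of ?D x0 x] tent_nonneg[of ?D x0 R x] e[of x] by (intro mult_mono) auto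
        ultimately have "cmod (?O (\<lambda>x. of_real (tent ?D x0 R x) * \<phi> x) x) \<le> e + hopn g ?D \<theta> * (M / R)" by linarith
        hence "1 / M * cmod (?O (\<lambda>x. of_real (tent ?D x0 R x) * \<phi> x) x) \<le> 1 / M * (e + hopn g ?D \<theta> * (M / R))"
          using M(1) by (intro mult_left_mono) auto
        also have "\<dots> = e / M + hopn g ?D \<theta> / R" using M(1) by (simp add: field_simps)
        also have "\<dots> \<le> \<delta>" using eM hR by linarith
        finally show ?thesis unfolding \<psi>_def Op_cmult using M(1) by (simp add: norm_mult norm_divide)
      qed
      have "cmod (\<psi> x0) < 1/2" using core[OF 1] 2 3 by blast
      moreover have "cmod (\<psi> x0) = cmod (\<phi> x0) / M" using M(1) by (simp add: \<psi>_def norm_divide)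
      ultimately show False using M(1,3) by (simp add: field_simps)
    qed
  qed (use d in simp)
  thus ?thesis by blast
qed

section \<open>The HVZ step\<close>

text \<open>Induction on the number of particles, with the gap doubled for the smaller set. If that
  set splits with gap \<open>2 * G\<close> and the new particle is closer than \<open>G\<close> to a
  member of one part, it joins this part and stays at least \<open>G\<close> away from the other. If
  the smaller set is packed, the new particle is either far from all of it or packed with
  it.\<close>

lemma gap_or_spread:
  assumes "finite D" "D \<noteq> {}"
  shows "\<exists>S. \<forall>x :: conf. (\<forall>i\<in>D. \<forall>j\<in>D. \<bar>x i - x j\<bar> \<le> S) \<or>
     (\<exists>D1 D2. D1 \<noteq> {} \<and> D2 \<noteq> {} \<and> D1 \<inter> D2 = {} \<and> D1 \<union> D2 = D \<and> (\<forall>i\<in>D1. \<forall>j\<in>D2. \<bar>x i - x j\<bar> \<ge> G))"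
  using assms
proof (induction D arbitrary: G rule: finite_ne_induct)
  case (singleton a)
  show ?case by (intro exI[of _ 0]) simp
next
  case (insert a F)
  from insert.IH[of "2 * G"] obtain S where S: "\<forall>x :: conf. (\<forall>i\<in>F. \<forall>j\<in>F. \<bar>x i - x j\<bar> \<le> S) \<or>
     (\<exists>D1 D2. D1 \<noteq> {} \<and> D2 \<noteq> {} \<and> D1 \<inter> D2 = {} \<and> D1 \<union> D2 = F \<and> (\<forall>i\<in>D1. \<forall>j\<in>D2. \<bar>x i - x j\<bar> \<ge> 2 * G))"
    by (rule exE)
  show ?case
  proof (intro exI[of _ "\<bar>S\<bar> + \<bar>G\<bar>"] allI)
    fix x :: conf
    let ?spread = "\<forall>i\<in>insert a F. \<forall>j\<in>insert a F. \<bar>x i - x j\<bar> \<le> \<bar>S\<bar> + \<bar>G\<bar>"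
    let ?gap = "\<lambda>D1 D2. D1 \<noteq> {} \<and> D2 \<noteq> {} \<and> D1 \<inter> D2 = {} \<and> D1 \<union> D2 = insert a F \<and> (\<forall>i\<in>D1. \<forall>j\<in>D2. \<bar>x i - x j\<bar> \<ge> G)"
    from spec[OF S, of x] show "?spread \<or> (\<exists>D1 D2. ?gap D1 D2)"
    proof (elim disjE exE conjE)
      assume sp: "\<forall>i\<in>F. \<forall>j\<in>F. \<bar>x i - x j\<bar> \<le> S"
      show ?thesis
      proof (cases "\<forall>i\<in>F. \<bar>x a - x i\<bar> \<ge> G")
        case True
        hence "?gap {a} F" using insert.hyps by auto
        thus ?thesis by (intro disjI2 exI)
      next
        case False
        then obtain i0 where i0: "i0 \<in> F" "\<bar>x a - x i0\<bar> < G" by (auto simp: not_le)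
        have "\<bar>x a - x i\<bar> \<le> \<bar>S\<bar> + \<bar>G\<bar>" if "i \<in> F" for i
          using bspec[OF bspec[OF sp i0(1)] that] i0(2) by linarith
        moreover have "\<bar>x i - x a\<bar> \<le> \<bar>S\<bar> + \<bar>G\<bar>" if "i \<in> F" for i
          using bspec[OF bspec[OF sp i0(1)] that] i0(2) by linarith
        moreover have "\<bar>x i - x j\<bar> \<le> \<bar>S\<bar> + \<bar>G\<bar>" if "i \<in> F" "j \<in> F" for i j
          using bspec[OF bspec[OF sp that(1)] that(2)] by linarith
        ultimately have ?spread by auto
        thus ?thesis by (rule disjI1)
      qed
    next
      fix D1 D2 assume D: "D1 \<noteq> {}" "D2 \<noteq> {}" "D1 \<inter> D2 = {}" "D1 \<union> D2 = F" "\<forall>i\<in>D1. \<forall>j\<in>D2. \<bar>x i - x j\<bar> \<ge> 2 * G"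
      have aD: "a \<notin> D1" "a \<notin> D2" using insert.hyps D(4) by auto
      show ?thesis
      proof (cases "\<forall>i\<in>D1. \<bar>x i - x a\<bar> \<ge> G")
        case True
        have "?gap D1 (insert a D2)"
        proof (intro conjI ballI)
          fix i j assume "i \<in> D1" "j \<in> insert a D2"
          hence "j = a \<or> \<bar>x i - x j\<bar> \<ge> 2 * G" using D(5) by blast
          moreover have "\<bar>x i - x a\<bar> \<ge> G" using True \<open>i \<in> D1\<close> by blast
          ultimately show "\<bar>x i - x j\<bar> \<ge> G" by (elim disjE) (simp, linarith)
        qed (use D aD in auto)
        thus ?thesis by (intro disjI2 exI)
      next
        case False
        then obtain i0 where i0: "i0 \<in> D1" "\<bar>x i0 - x a\<bar> < G" by (auto simp: not_le)
        have "?gap (insert a D1) D2"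
        proof (intro conjI ballI)
          fix i j assume "i \<in> insert a D1" "j \<in> D2"
          hence "i = a \<or> \<bar>x i - x j\<bar> \<ge> 2 * G" "\<bar>x i0 - x j\<bar> \<ge> 2 * G" using D(5) i0(1) by blast+
          thus "\<bar>x i - x j\<bar> \<ge> G" using i0(2) by (elim disjE) (simp, linarith+)
        qed (use D aD in auto)
        thus ?thesis by (intro disjI2 exI)
      qed
    qed
  qed
qed

text \<open>Only pairs with one particle in each cluster contribute. The order \<open>i < j\<close>
  of labels distributes them over two sums, and since \<open>v\<close> is not assumed even, both
  differences have to be controlled.\<close>

lemma U_intercluster:
  assumes fin: "finite D1" "finite D2" and dis: "D1 \<inter> D2 = {}"
    and e: "\<epsilon> \<ge> 0" and v: "\<And>i j. i \<in> D1 \<Longrightarrow> j \<in> D2 \<Longrightarrow> \<bar>v (x i - x j)\<bar> \<le> \<epsilon> \<and> \<bar>v (x j - x i)\<bar> \<le> \<epsilon>"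
  shows "\<bar>U h v (D1 \<union> D2) x - (U h v D1 x + U h v D2 x)\<bar> \<le> 2 * (real (card D1) * (real (card D2) * \<epsilon>))"
proof -
  have split: "(\<Sum>i\<in>{i\<in>D1 \<union> D2. i < j}. v (x i - x j)) = (\<Sum>i\<in>{i\<in>D1. i < j}. v (x i - x j)) + (\<Sum>i\<in>{i\<in>D2. i < j}. v (x i - x j))" for j
  proof -
    have "{i\<in>D1 \<union> D2. i < j} = {i\<in>D1. i < j} \<union> {i\<in>D2. i < j}" by auto
    thus ?thesis using fin dis by (simp, subst sum.union_disjoint) auto
  qed
  have "tot (D1 \<union> D2) x = tot D1 x + tot D2 x" unfolding tot_def using fin dis by (simp add: sum.union_disjoint)
  moreover have "pot v (D1 \<union> D2) x = pot v D1 x + pot v D2 x + (\<Sum>j\<in>D1. \<Sum>i\<in>{i\<in>D2. i < j}. v (x i - x j)) + (\<Sum>j\<in>D2. \<Sum>i\<in>{i\<in>D1. i < j}. v (x i - x j))"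
    unfolding pot_def split using fin dis by (simp add: sum.union_disjoint sum.distrib)
  ultimately have "U h v (D1 \<union> D2) x - (U h v D1 x + U h v D2 x) = (\<Sum>j\<in>D1. \<Sum>i\<in>{i\<in>D2. i < j}. v (x i - x j)) + (\<Sum>j\<in>D2. \<Sum>i\<in>{i\<in>D1. i < j}. v (x i - x j))"
    by (simp add: U_def algebra_simps)
  moreover have "\<bar>\<Sum>j\<in>D1. \<Sum>i\<in>{i\<in>D2. i < j}. v (x i - x j)\<bar> \<le> real (card D1) * (real (card D2) * \<epsilon>)"
    by (rule double_sum_bound[OF fin]) (use v e in auto)
  moreover have "\<bar>\<Sum>j\<in>D2. \<Sum>i\<in>{i\<in>D1. i < j}. v (x i - x j)\<bar> \<le> real (card D2) * (real (card D1) * \<epsilon>)"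
    by (rule double_sum_bound[OF fin(2,1)]) (use v e in auto)
  moreover have "real (card D2) * (real (card D1) * \<epsilon>) = real (card D1) * (real (card D2) * \<epsilon>)" by simp
  ultimately show ?thesis by linarith
qed

lemma potential_decay:
  fixes v :: "int \<Rightarrow> real"
  assumes "(v \<longlongrightarrow> 0) at_top" "(v \<longlongrightarrow> 0) at_bot" "\<epsilon> > 0"
  obtains n0 where "\<And>n. \<bar>n\<bar> \<ge> n0 \<Longrightarrow> \<bar>v n\<bar> \<le> \<epsilon>"
proof -
  from tendstoD[OF assms(1,3)] obtain a where a: "\<And>n. n \<ge> a \<Longrightarrow> \<bar>v n\<bar> < \<epsilon>"
    by (auto simp: eventually_at_top_linorder)
  from tendstoD[OF assms(2,3)] obtain b where b: "\<And>n. n \<le> b \<Longrightarrow> \<bar>v n\<bar> < \<epsilon>"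
    by (auto simp: eventually_at_bot_linorder)
  have "\<bar>v n\<bar> \<le> \<epsilon>" if "\<bar>n\<bar> \<ge> max \<bar>a\<bar> \<bar>b\<bar>" for n
  proof (cases "n \<ge> 0")
    case True
    hence "n \<ge> a" using that by linarith
    thus ?thesis using a by (simp add: less_imp_le)
  next
    case False
    hence "n \<le> b" using that by linarith
    thus ?thesis using b by (simp add: less_imp_le)
  qed
  thus ?thesis by (rule that)
qed

text \<open>In the spirit of Persson's description of the essential spectrum: the estimate is asked
  only away from a box, so it can hold even where \<open>\<alpha>\<close> is an eigenvalue.\<close>

definition OLB :: "real \<Rightarrow> nat set \<Rightarrow> (nat \<Rightarrow> real) \<Rightarrow> (conf \<Rightarrow> real) \<Rightarrow> complex \<Rightarrow> real \<Rightarrow> int \<Rightarrow> bool" where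
  "OLB g D \<theta> W \<alpha> C L \<longleftrightarrow> (\<forall>\<phi> e. bd \<phi> \<longrightarrow> (\<forall>x. (\<forall>k\<in>D. \<bar>x k\<bar> \<le> L) \<longrightarrow> \<phi> x = 0) \<longrightarrow>
     (\<forall>x. cmod (Op g D \<theta> W \<alpha> \<phi> x) \<le> e) \<longrightarrow> (\<forall>x. cmod (\<phi> x) \<le> C * e))"

lemma OLBD: "OLB g D \<theta> W \<alpha> C L \<Longrightarrow> bd \<phi> \<Longrightarrow> (\<And>x. (\<forall>k\<in>D. \<bar>x k\<bar> \<le> L) \<Longrightarrow> \<phi> x = 0) \<Longrightarrow>
   (\<And>x. cmod (Op g D \<theta> W \<alpha> \<phi> x) \<le> e) \<Longrightarrow> cmod (\<phi> x) \<le> C * e"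
  unfolding OLB_def by blast

text \<open>The gap at \<open>x0\<close> is \<open>n0\<close> plus twice the rounded radius of the
  tent, so the clusters are still \<open>n0\<close> apart on the whole support of the tent, where
  their interaction is therefore small. Cutoff and decoupling errors are both proportional to
  \<open>M\<close>.\<close>

lemma gapped_estimate:
  assumes fin: "finite D1" "finite D2" and dis: "D1 \<inter> D2 = {}" and D: "D = D1 \<union> D2"
    and lb: "LB g D \<theta> (\<lambda>x. U h v D1 x + U h v D2 x) E C0" and C0: "C0 \<ge> 0"
    and R: "R > 0" and \<epsilon>: "\<epsilon> \<ge> 0" and n0: "\<And>n. \<bar>n\<bar> \<ge> n0 \<Longrightarrow> \<bar>v n\<bar> \<le> \<epsilon>"
    and gap: "\<And>i j. i \<in> D1 \<Longrightarrow> j \<in> D2 \<Longrightarrow> \<bar>x0 i - x0 j\<bar> \<ge> n0 + 2 * \<lceil>R\<rceil>"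
    and M: "\<And>x. cmod (\<phi> x) \<le> M" and e: "\<And>x. cmod (Op g D \<theta> (U h v D) E \<phi> x) \<le> e"
  shows "cmod (\<phi> x0) \<le> C0 * (e + hopn g D \<theta> * (M / R) + 2 * (real (card D1) * (real (card D2) * \<epsilon>)) * M)"
proof -
  have finD: "finite D" using fin D by simp
  let ?J = "tent D x0 R" and ?I = "\<lambda>x. U h v D x - (U h v D1 x + U h v D2 x)"
  let ?\<psi> = "\<lambda>x. of_real (?J x) * \<phi> x"
  let ?\<beta> = "2 * (real (card D1) * (real (card D2) * \<epsilon>))"
  have M0: "M \<ge> 0" using M norm_ge_zero order_trans by blast
  have \<psi>M: "cmod (?\<psi> x) \<le> M" for x
  proof -
    have "\<bar>?J x\<bar> * cmod (\<phi> x) \<le> 1 * M"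
      using tent_le_1[OF R, of D x0 x] tent_nonneg[of D x0 R x] M by (intro mult_mono) auto
    thus ?thesis by (simp add: norm_mult)
  qed
  have I: "cmod (of_real (?I x) * ?\<psi> x) \<le> ?\<beta> * M" for x
  proof (cases "?J x = 0")
    case True thus ?thesis using M0 \<epsilon> by simp
  next
    case False
    have far: "\<bar>x i - x j\<bar> \<ge> n0" if "i \<in> D1" "j \<in> D2" for i j
    proof -
      have "\<bar>of_int (x i - x0 i)\<bar> < R" "\<bar>of_int (x j - x0 j)\<bar> < R"
        using tent_supp[OF finD R False] that D by auto
      hence "\<bar>x i - x0 i\<bar> \<le> \<lceil>R\<rceil>" "\<bar>x j - x0 j\<bar> \<le> \<lceil>R\<rceil>" by linarith+
      with gap[OF that] show ?thesis by linarith
    qed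
    have "\<bar>v (x i - x j)\<bar> \<le> \<epsilon> \<and> \<bar>v (x j - x i)\<bar> \<le> \<epsilon>" if "i \<in> D1" "j \<in> D2" for i j
      using n0[of "x i - x j"] n0[of "x j - x i"] far[OF that] by (simp add: abs_minus_commute)
    hence "\<bar>?I x\<bar> \<le> ?\<beta>" unfolding D by (intro U_intercluster[OF fin dis \<epsilon>])
    thus ?thesis unfolding norm_mult norm_of_real using \<psi>M[of x] M0
      by (intro mult_mono) (auto simp: norm_mult)
  qed
  have "cmod (?\<psi> x0) \<le> C0 * (e + hopn g D \<theta> * (M / R) + ?\<beta> * M)"
  proof (rule LBD[OF lb, where \<phi> = ?\<psi> and x = x0])
    show "bd ?\<psi>" using \<psi>M by (rule bdI)
    fix x
    have "Op g D \<theta> (\<lambda>x. U h v D1 x + U h v D2 x) E ?\<psi> x = Op g D \<theta> (U h v D) E ?\<psi> x - of_real (?I x) * ?\<psi> x"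
      by (simp add: Op_def algebra_simps)
    also have "\<dots> = of_real (?J x) * Op g D \<theta> (U h v D) E \<phi> x + (Op g D \<theta> (U h v D) E ?\<psi> x - of_real (?J x) * Op g D \<theta> (U h v D) E \<phi> x) - of_real (?I x) * ?\<psi> x"
      by simp
    also have "cmod \<dots> \<le> e + hopn g D \<theta> * (M / R) + ?\<beta> * M"
    proof (rule norm_triangle_le_diff, rule add_mono, rule norm_triangle_mono)
      have "\<bar>?J x\<bar> * cmod (Op g D \<theta> (U h v D) E \<phi> x) \<le> 1 * e"
        using tent_le_1[OF R, of D x0 x] tent_nonneg[of D x0 R x] e by (intro mult_mono) auto
      thus "cmod (of_real (?J x) * Op g D \<theta> (U h v D) E \<phi> x) \<le> e" by (simp add: norm_mult)
      show "cmod (Op g D \<theta> (U h v D) E ?\<psi> x - of_real (?J x) * Op g D \<theta> (U h v D) E \<phi> x) \<le> hopn g D \<theta> * (M / R)"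
        by (rule Op_tent[where \<phi> = \<phi>, OF finD R M])
    qed (rule I)
    finally show "cmod (Op g D \<theta> (\<lambda>x. U h v D1 x + U h v D2 x) E ?\<psi> x) \<le> e + hopn g D \<theta> * (M / R) + ?\<beta> * M" .
  qed
  thus ?thesis by simp
qed

text \<open>All coordinates lie within \<open>S\<close> of one that is beyond
  \<open>L \<ge> S\<close> in modulus, so none has the opposite sign and nothing cancels in the
  sum.\<close>

lemma tot_large:
  assumes fin: "finite D" and k: "k \<in> D" and sp: "\<And>j. j \<in> D \<Longrightarrow> \<bar>x k - x j\<bar> \<le> S" and L: "\<bar>x k\<bar> > L" "L \<ge> S"
  shows "\<bar>tot D x\<bar> \<ge> L - S"
proof -
  have c: "int (card D) \<ge> 1" using fin k by (metis One_nat_def Suc_leI card_gt_0_iff empty_iff of_nat_1 of_nat_mono)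
  have T: "L - S \<le> int (card D) * (L - S)" using c L(2) mult_right_mono[of 1 "int (card D)" "L - S"] by simp
  show ?thesis
  proof (cases "x k \<ge> 0")
    case True
    have "(\<Sum>j\<in>D. L - S) \<le> tot D x" unfolding tot_def
    proof (rule sum_mono)
      fix j assume "j \<in> D" thus "L - S \<le> x j" using sp[of j] L True by linarith
    qed
    thus ?thesis using T by simp
  next
    case False
    have "(\<Sum>j\<in>D. L - S) \<le> (\<Sum>j\<in>D. - x j)"
    proof (rule sum_mono)
      fix j assume "j \<in> D" thus "L - S \<le> - x j" using sp[of j] L False by linarith
    qed
    hence "int (card D) * (L - S) \<le> - tot D x" by (simp add: tot_def sum_negf)
    thus ?thesis using T by linarith
  qed
qed

text \<open>The box is what makes the packed case work: a nonzero value at a packed near-maximum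
  forces it outside the box, and then \<open>tot\<close> is large. By \<open>gap_or_spread\<close>
  every other near-maximum is gapped.\<close>

lemma HVZ:
  assumes fin: "finite D" and ne: "D \<noteq> {}" and h: "h \<noteq> 0" and v: "\<And>n. \<bar>v n\<bar> \<le> B"
    and v0: "(v \<longlongrightarrow> 0) at_top" "(v \<longlongrightarrow> 0) at_bot"
    and cl: "\<And>D1 D2. D1 \<noteq> {} \<Longrightarrow> D2 \<noteq> {} \<Longrightarrow> D1 \<inter> D2 = {} \<Longrightarrow> D1 \<union> D2 = D \<Longrightarrow>
       \<exists>C. LB g D \<theta> (\<lambda>x. U h v D1 x + U h v D2 x) E C"
  shows "\<exists>C L. OLB g D \<theta> (U h v D) E C L"
proof -
  define A where "A = {(D1, D2). D1 \<noteq> {} \<and> D2 \<noteq> {} \<and> D1 \<inter> D2 = {} \<and> D1 \<union> D2 = D}"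
  have finA: "finite A" by (rule finite_subset[of _ "Pow D \<times> Pow D"]) (use fin in \<open>auto simp: A_def\<close>)
  have "\<forall>p\<in>A. \<exists>C. LB g D \<theta> (\<lambda>x. U h v (fst p) x + U h v (snd p) x) E C"
    using cl by (auto simp: A_def)
  from bchoice[OF this] obtain c where c: "\<forall>p\<in>A. LB g D \<theta> (\<lambda>x. U h v (fst p) x + U h v (snd p) x) E (c p)" by blast
  define C0 where "C0 = (\<Sum>p\<in>A. \<bar>c p\<bar>) + 1"
  have C0: "C0 > 0" by (simp add: C0_def add_nonneg_pos sum_nonneg)
  have lb: "LB g D \<theta> (\<lambda>x. U h v D1 x + U h v D2 x) E C0" if "(D1, D2) \<in> A" for D1 D2
  proof -
    have "LB g D \<theta> (\<lambda>x. U h v D1 x + U h v D2 x) E (c (D1, D2))" using bspec[OF c that] by simp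
    moreover have "c (D1, D2) \<le> C0"
      unfolding C0_def using member_le_sum[of "(D1, D2)" A "\<lambda>p. \<bar>c p\<bar>"] that finA by simp
    ultimately show ?thesis by (rule LB_mono)
  qed
  let ?n = "real (card D)" and ?hopn = "hopn g D \<theta>"
  have hb0: "?hopn \<ge> 0" by (rule hopn_nonneg)
  \<comment> \<open>Tuned so that the cutoff error and the decoupling error are at most
    \<open>M / 8\<close> each, leaving \<open>M / 4\<close> of the half maximum to be bounded by
    \<open>C0 * e\<close>.\<close>
  define R where "R = 8 * C0 * (?hopn + 1)"
  define \<epsilon> where "\<epsilon> = 1 / (16 * C0 * (?n * ?n + 1))"
  have R: "R > 0" using C0 hb0 by (simp add: R_def)
  have \<epsilon>: "\<epsilon> > 0" using C0 by (simp add: \<epsilon>_def add_nonneg_pos)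
  obtain n0 where n0: "\<And>n. \<bar>n\<bar> \<ge> n0 \<Longrightarrow> \<bar>v n\<bar> \<le> \<epsilon>"
    by (rule potential_decay[OF v0 \<epsilon>]) blast
  from gap_or_spread[OF fin ne, of "n0 + 2 * \<lceil>R\<rceil>"] obtain S where S: "\<forall>x :: conf. (\<forall>i\<in>D. \<forall>j\<in>D. \<bar>x i - x j\<bar> \<le> S) \<or>
     (\<exists>D1 D2. D1 \<noteq> {} \<and> D2 \<noteq> {} \<and> D1 \<inter> D2 = {} \<and> D1 \<union> D2 = D \<and> (\<forall>i\<in>D1. \<forall>j\<in>D2. \<bar>x i - x j\<bar> \<ge> n0 + 2 * \<lceil>R\<rceil>))"
    by (rule exE)
  \<comment> \<open>A diagonal entry of modulus \<open>2 * hopn + 2\<close> acting on a value of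
    size \<open>M / 2\<close> gives \<open>hopn * M + M\<close>, which beats the hopping by
    \<open>M\<close>. The other summands of \<open>Z\<close> pay for the interaction and for
    \<open>E\<close>.\<close>
  define Z where "Z = 2 * ?hopn + 2 + ?n * (?n * B) + cmod E"
  have B0: "B \<ge> 0" using v[of 0] by linarith
  have Z0: "Z \<ge> 0" using hb0 B0 by (simp add: Z_def)
  define L where "L = S + \<lceil>Z / (2 * \<bar>h\<bar>)\<rceil>"
  have "OLB g D \<theta> (U h v D) E (4 * C0 + 1) L"
    unfolding OLB_def
  proof (intro allI impI)
    fix \<phi> :: "conf \<Rightarrow> complex" and e z
    assume b: "bd \<phi>" and out: "\<forall>x. (\<forall>k\<in>D. \<bar>x k\<bar> \<le> L) \<longrightarrow> \<phi> x = 0" and e: "\<forall>x. cmod (Op g D \<theta> (U h v D) E \<phi> x) \<le> e"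
    have e0: "e \<ge> 0" using e norm_ge_zero order_trans by blast
    show "cmod (\<phi> z) \<le> (4 * C0 + 1) * e"
    proof (cases "\<phi> z = 0")
      case True thus ?thesis using C0 e0 by simp
    next
      case False
      from bd_near_sup[of \<phi> z, OF b False] obtain M x0 where M: "M > 0" "\<And>x. cmod (\<phi> x) \<le> M" "M / 2 \<le> cmod (\<phi> x0)" by metis
      have "M \<le> (4 * C0 + 1) * e"
        using spec[OF S, of x0]
      proof (elim disjE exE conjE)
        fix D1 D2 assume D: "D1 \<noteq> {}" "D2 \<noteq> {}" "D1 \<inter> D2 = {}" "D1 \<union> D2 = D"
          "\<forall>i\<in>D1. \<forall>j\<in>D2. \<bar>x0 i - x0 j\<bar> \<ge> n0 + 2 * \<lceil>R\<rceil>"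
        have f: "finite D1" "finite D2" using D(4) fin by auto
        have "(D1, D2) \<in> A" using D by (simp add: A_def)
        have "cmod (\<phi> x0) \<le> C0 * (e + ?hopn * (M / R) + 2 * (real (card D1) * (real (card D2) * \<epsilon>)) * M)"
          using D(5) e by (intro gapped_estimate[where \<phi> = \<phi>, OF f D(3) D(4)[symmetric] lb[OF \<open>(D1, D2) \<in> A\<close>] less_imp_le[OF C0] R less_imp_le[OF \<epsilon>] n0 _ M(2)]) blast+
        moreover have "C0 * (?hopn * (M / R)) \<le> M / 8"
          using C0 hb0 M(1) by (simp add: R_def divide_simps)
        moreover have "C0 * (2 * (real (card D1) * (real (card D2) * \<epsilon>)) * M) \<le> M / 8"
        proof -
          have "real (card D1) * real (card D2) \<le> ?n * ?n"
            using D(4) fin by (intro mult_mono of_nat_mono card_mono) auto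
          hence "(2 * C0 * \<epsilon> * M) * (real (card D1) * real (card D2)) \<le> (2 * C0 * \<epsilon> * M) * (?n * ?n)"
            using C0 \<epsilon> M(1) by (intro mult_left_mono) auto
          also have "\<dots> \<le> M / 8"
            using C0 M(1) by (simp add: \<epsilon>_def divide_simps add_nonneg_pos)
          finally show ?thesis by (simp add: ac_simps)
        qed
        ultimately have "M / 2 \<le> C0 * e + M / 8 + M / 8" using M(3) unfolding distrib_left by linarith
        thus ?thesis using e0 by (simp add: algebra_simps)
      next
        assume sp: "\<forall>i\<in>D. \<forall>j\<in>D. \<bar>x0 i - x0 j\<bar> \<le> S"
        have "\<phi> x0 \<noteq> 0" using M by auto
        then obtain k where k: "k \<in> D" "\<bar>x0 k\<bar> > L" using out by (metis not_le)
        have "0 \<le> Z / (2 * \<bar>h\<bar>)" using Z0 by simp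
        hence LS: "L \<ge> S" unfolding L_def by linarith
        have "\<bar>tot D x0\<bar> \<ge> L - S" by (rule tot_large[where x = x0, OF fin k(1) bspec[OF bspec[OF sp k(1)]] k(2) LS])
        hence "real_of_int (L - S) \<le> real_of_int \<bar>tot D x0\<bar>" by (simp only: of_int_le_iff)
        moreover have "Z / (2 * \<bar>h\<bar>) \<le> of_int (L - S)" by (simp add: L_def)
        ultimately have "Z / (2 * \<bar>h\<bar>) \<le> \<bar>of_int (tot D x0)\<bar>" by simp
        hence "Z \<le> \<bar>2 * h * of_int (tot D x0)\<bar>" using h by (simp add: pos_divide_le_eq abs_mult ac_simps)
        hence "Z - ?n * (?n * B) \<le> \<bar>U h v D x0\<bar>" using pot_bound[of D v B x0, OF fin v] unfolding U_def by linarith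
        also have "\<bar>U h v D x0\<bar> \<le> cmod (of_real (U h v D x0) - E) + cmod E"
          using norm_triangle_sub[of "complex_of_real (U h v D x0)" E] by simp
        finally have big: "2 * ?hopn + 2 \<le> cmod (of_real (U h v D x0) - E)" by (simp add: Z_def)
        have "(of_real (U h v D x0) - E) * \<phi> x0 = Op g D \<theta> (U h v D) E \<phi> x0 - (\<Sum>p\<in>steps D. of_real (hopc g \<theta> p) * \<phi> (move x0 p))"
          by (simp add: Op_def)
        also have "cmod \<dots> \<le> e + ?hopn * M"
          using e hop_bound[OF fin, of "\<lambda>p. \<phi> (move x0 p)" M g \<theta>] M(2) by (intro norm_triangle_le_diff add_mono) auto
        finally have "cmod (of_real (U h v D x0) - E) * cmod (\<phi> x0) \<le> e + ?hopn * M" by (simp add: norm_mult)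
        moreover have "(2 * ?hopn + 2) * (M / 2) \<le> cmod (of_real (U h v D x0) - E) * cmod (\<phi> x0)"
          using big M(1,3) hb0 by (intro mult_mono) auto
        ultimately have "M \<le> e" by (simp add: algebra_simps)
        also have "e \<le> (4 * C0 + 1) * e" using C0 e0 by (simp add: algebra_simps)
        finally show ?thesis .
      qed
      thus ?thesis using M(2)[of z] by linarith
    qed
  qed
  thus ?thesis by blast
qed

section \<open>Propagation of exponential decay\<close>

definition lin :: "nat set \<Rightarrow> (nat \<Rightarrow> real) \<Rightarrow> conf \<Rightarrow> real" where
  "lin D s x = (\<Sum>k\<in>D. s k * of_int (x k))"

lemma lin_move:
  assumes "finite D" "p \<in> steps D"
  shows "lin D s (move x p) = lin D s x + of_int (snd p) * s (fst p)"
proof -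
  obtain k t where p: "p = (k, t)" "k \<in> D" using assms(2) by (auto simp: steps_def)
  have "(\<Sum>j\<in>D - {k}. s j * of_int (move x p j)) = (\<Sum>j\<in>D - {k}. s j * of_int (x j))"
    by (intro sum.cong) (auto simp: move_def p)
  moreover have "lin D s y = s k * of_int (y k) + (\<Sum>j\<in>D - {k}. s j * of_int (y j))" for y
    unfolding lin_def using assms(1) p(2) by (rule sum.remove)
  ultimately show ?thesis by (simp add: p move_def algebra_simps)
qed

lemma lin_bound:
  assumes "\<And>k. k \<in> D \<Longrightarrow> \<bar>x k\<bar> \<le> L"
  shows "\<bar>lin D s x\<bar> \<le> (\<Sum>k\<in>D. \<bar>s k\<bar>) * of_int L"
proof -
  have "\<bar>lin D s x\<bar> \<le> (\<Sum>k\<in>D. \<bar>s k * of_int (x k)\<bar>)" unfolding lin_def by (rule sum_abs)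
  also have "\<dots> \<le> (\<Sum>k\<in>D. \<bar>s k\<bar> * of_int L)"
  proof (rule sum_mono)
    fix k assume "k \<in> D"
    hence "real_of_int \<bar>x k\<bar> \<le> of_int L" using assms by (simp only: of_int_le_iff)
    thus "\<bar>s k * of_int (x k)\<bar> \<le> \<bar>s k\<bar> * of_int L" by (simp add: abs_mult mult_left_mono)
  qed
  finally show ?thesis by (simp add: sum_distrib_right)
qed

lemma lin_diff: "lin D (\<lambda>k. s k - t k) x = lin D s x - lin D t x"
  by (simp add: lin_def algebra_simps sum_subtractf)

lemma exp_diff_bound:
  fixes a b \<epsilon> :: real
  assumes "\<bar>a - b\<bar> \<le> \<epsilon>" "\<epsilon> \<le> 1"
  shows "\<bar>exp a - exp b\<bar> \<le> 2 * \<epsilon> * exp b"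
proof -
  have t: "\<bar>exp t - 1\<bar> \<le> 2 * \<epsilon>" if "\<bar>t\<bar> \<le> \<epsilon>" for t :: real
  proof (cases "t \<ge> 0")
    case True
    have "exp t \<le> 1 + t + t\<^sup>2" using that assms(2) True by (intro exp_bound) auto
    moreover have "t\<^sup>2 \<le> t" using that assms(2) True mult_left_le_one_le[of t t] by (simp add: power2_eq_square)
    moreover have "exp t \<ge> 1" using True by simp
    ultimately show ?thesis using that True by linarith
  next
    case False
    have "1 + t \<le> exp t" by (rule exp_ge_add_one_self)
    moreover have "exp t \<le> 1" using False by simp
    ultimately show ?thesis using that False by linarith
  qed
  have "exp a - exp b = exp b * (exp (a - b) - 1)" by (simp add: exp_diff algebra_simps)
  hence "\<bar>exp a - exp b\<bar> = exp b * \<bar>exp (a - b) - 1\<bar>" by (simp add: abs_mult)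
  also have "\<dots> \<le> exp b * (2 * \<epsilon>)" using t[OF assms(1)] by (intro mult_left_mono) auto
  finally show ?thesis by (simp add: mult.commute)
qed

text \<open>Conjugation by any weight \<open>exp f\<close> whose increments follow those of the tilt
  \<open>\<theta>\<close> up to \<open>\<epsilon>\<close> is a small perturbation of the
  \<open>\<theta>\<close>-tilted operator. This freedom admits truncated weights.\<close>

lemma Op_weight:
  fixes f :: "conf \<Rightarrow> real"
  assumes fin: "finite D" and \<epsilon>: "\<epsilon> \<le> 1"
    and f: "\<And>x p. p \<in> steps D \<Longrightarrow> \<bar>f x - f (move x p) + of_int (snd p) * \<theta> (fst p)\<bar> \<le> \<epsilon>"
    and N: "\<And>x. cmod (of_real (exp (f x)) * \<psi> x) \<le> N"
  shows "cmod (Op g D \<theta> W \<alpha> (\<lambda>x. of_real (exp (f x)) * \<psi> x) x - of_real (exp (f x)) * Op g D (\<lambda>_. 0) W \<alpha> \<psi> x)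
      \<le> 2 * \<epsilon> * hopn g D \<theta> * N"
proof -
  let ?\<phi> = "\<lambda>x. of_real (exp (f x)) * \<psi> x"
  define c where "c p = hopc g \<theta> p - hopc g (\<lambda>_. 0) p * exp (f x - f (move x p))" for p
  have N0: "N \<ge> 0" using N norm_ge_zero order_trans by blast
  have "Op g D \<theta> W \<alpha> ?\<phi> x - of_real (exp (f x)) * Op g D (\<lambda>_. 0) W \<alpha> \<psi> x = (\<Sum>p\<in>steps D. of_real (c p) * ?\<phi> (move x p))"
  proof -
    have "of_real (c p) * ?\<phi> (move x p) = of_real (hopc g \<theta> p) * ?\<phi> (move x p) - of_real (exp (f x)) * (of_real (hopc g (\<lambda>_. 0) p) * \<psi> (move x p))" for p
    proof -
      have "exp (f x - f (move x p)) * exp (f (move x p)) = exp (f x)" by (simp add: exp_diff)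
      hence "complex_of_real (exp (f x - f (move x p))) * of_real (exp (f (move x p))) = of_real (exp (f x))"
        by (metis of_real_mult)
      thus ?thesis by (simp add: c_def left_diff_distrib)
    qed
    thus ?thesis by (simp add: Op_def sum_subtractf sum_distrib_left distrib_left mult.left_commute)
  qed
  also have "cmod \<dots> \<le> (\<Sum>p\<in>steps D. 2 * \<epsilon> * \<bar>hopc g \<theta> p\<bar> * N)"
  proof (rule sum_norm_le)
    fix p assume p: "p \<in> steps D"
    have "\<bar>exp (f x - f (move x p)) - exp (- (of_int (snd p) * \<theta> (fst p)))\<bar> \<le> 2 * \<epsilon> * exp (- (of_int (snd p) * \<theta> (fst p)))"
      using f[OF p, of x] by (intro exp_diff_bound \<epsilon>) simp
    hence "\<bar>g\<bar> * \<bar>exp (f x - f (move x p)) - exp (- (of_int (snd p) * \<theta> (fst p)))\<bar> \<le> \<bar>g\<bar> * (2 * \<epsilon> * exp (- (of_int (snd p) * \<theta> (fst p))))"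
      by (rule mult_left_mono) simp
    moreover have "\<bar>c p\<bar> = \<bar>g\<bar> * \<bar>exp (f x - f (move x p)) - exp (- (of_int (snd p) * \<theta> (fst p)))\<bar>"
    proof -
      have "c p = g * (exp (f x - f (move x p)) - exp (- (of_int (snd p) * \<theta> (fst p))))"
        by (simp add: c_def hopc_def algebra_simps)
      thus ?thesis by (simp add: abs_mult)
    qed
    moreover have "\<bar>hopc g \<theta> p\<bar> = \<bar>g\<bar> * exp (- (of_int (snd p) * \<theta> (fst p)))" by (simp add: hopc_def abs_mult)
    ultimately have "\<bar>c p\<bar> \<le> 2 * \<epsilon> * \<bar>hopc g \<theta> p\<bar>" by (simp only: mult.left_commute)
    hence "\<bar>c p\<bar> * cmod (?\<phi> (move x p)) \<le> 2 * \<epsilon> * \<bar>hopc g \<theta> p\<bar> * N"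
      using N[of "move x p"] by (intro mult_mono) auto
    thus "cmod (of_real (c p) * ?\<phi> (move x p)) \<le> 2 * \<epsilon> * \<bar>hopc g \<theta> p\<bar> * N" by (simp only: norm_mult norm_of_real)
  qed
  also have "\<dots> = 2 * \<epsilon> * hopn g D \<theta> * N" by (simp add: hopn_def sum_distrib_left sum_distrib_right)
  finally show ?thesis .
qed

lemma Op_box_bound:
  assumes fin: "finite D" and v: "\<And>n. \<bar>v n\<bar> \<le> B"
    and m: "\<And>x. (\<forall>k\<in>D. \<bar>x k\<bar> \<le> L) \<Longrightarrow> cmod (\<psi> x) \<le> m" and m0: "m \<ge> 0"
  shows "cmod (Op g D \<theta> (U h v D) E (\<lambda>x. if \<forall>k\<in>D. \<bar>x k\<bar> \<le> L then \<psi> x else 0) x)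
     \<le> (hopn g D \<theta> + (\<bar>Ubox h D B L\<bar> + cmod E)) * m"
proof -
  let ?W = "U h v D" and ?\<psi> = "\<lambda>x. if \<forall>k\<in>D. \<bar>x k\<bar> \<le> L then \<psi> x else 0"
  have i: "cmod (?\<psi> x) \<le> m" for x using m[of x] m0 by simp
  have "cmod ((of_real (?W x) - E) * ?\<psi> x) \<le> (\<bar>Ubox h D B L\<bar> + cmod E) * m"
  proof (cases "\<forall>k\<in>D. \<bar>x k\<bar> \<le> L")
    case True
    have "\<bar>?W x\<bar> \<le> Ubox h D B L" by (rule U_bound[OF fin v]) (use True in simp)
    hence "cmod (of_real (?W x) - E) \<le> \<bar>Ubox h D B L\<bar> + cmod E"
      using norm_triangle_ineq4[of "complex_of_real (?W x)" E] unfolding norm_of_real by linarith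
    thus ?thesis unfolding norm_mult using i[of x] m0 by (intro mult_mono) auto
  next
    case False thus ?thesis using m0 by auto
  qed
  hence "cmod (Op g D \<theta> ?W E ?\<psi> x) \<le> hopn g D \<theta> * m + (\<bar>Ubox h D B L\<bar> + cmod E) * m"
    unfolding Op_def by (intro norm_triangle_mono hop_bound[OF fin] i)
  thus ?thesis by (simp add: algebra_simps)
qed

text \<open>A Combes-Thomas type estimate around the tilt \<open>\<theta>\<close>. \<open>K\<close>
  does not involve \<open>Bd\<close>: the given decay only ensures that the weighted function is
  bounded, after which the outer bound controls it through the values in the box alone.\<close>

lemma decay_transfer:
  fixes g h :: real and E :: complex
  assumes fin: "finite D" and v: "\<And>n. \<bar>v n\<bar> \<le> B" and L: "L \<ge> 0"
    and olb: "OLB g D \<theta> (U h v D) E C L" and C: "C \<ge> 0" and \<epsilon>: "\<epsilon> \<le> 1" "C * (2 * \<epsilon> * hopn g D \<theta>) \<le> 1 / 2"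
    and s: "\<And>k. k \<in> D \<Longrightarrow> \<bar>s k - \<theta> k\<bar> \<le> \<epsilon>" and s': "\<And>k. k \<in> D \<Longrightarrow> \<bar>s' k - \<theta> k\<bar> \<le> \<epsilon>"
  shows "\<exists>K. \<forall>\<psi> Bd m. (\<forall>x. Op g D (\<lambda>_. 0) (U h v D) E \<psi> x = 0) \<longrightarrow>
    (\<forall>x. exp (lin D s x) * cmod (\<psi> x) \<le> Bd) \<longrightarrow> (\<forall>x. (\<forall>k\<in>D. \<bar>x k\<bar> \<le> L) \<longrightarrow> cmod (\<psi> x) \<le> m) \<longrightarrow>
    (\<forall>x. exp (lin D s' x) * cmod (\<psi> x) \<le> K * m)"
proof -
  let ?W = "U h v D"
  define d where "d k = s' k - s k" for k
  \<comment> \<open>\<open>L + 1\<close>, because one hop can carry the inner part one site out of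
    the box.\<close>
  define F where "F = ((\<Sum>k\<in>D. \<bar>s k\<bar>) + (\<Sum>k\<in>D. \<bar>d k\<bar>)) * of_int (L + 1)"
  define Q where "Q = hopn g D (\<lambda>_. 0) + (\<bar>Ubox h D B L\<bar> + cmod E)"
  have Q0: "Q \<ge> 0" by (simp add: Q_def hopn_nonneg)
  define K where "K = 2 * C * exp F * Q + exp F"
  have "exp (lin D s' y) * cmod (\<psi> y) \<le> K * m"
    if ev: "\<And>x. Op g D (\<lambda>_. 0) ?W E \<psi> x = 0" and Bd: "\<And>x. exp (lin D s x) * cmod (\<psi> x) \<le> Bd"
      and m: "\<And>x. (\<forall>k\<in>D. \<bar>x k\<bar> \<le> L) \<Longrightarrow> cmod (\<psi> x) \<le> m" for \<psi> :: "conf \<Rightarrow> complex" and Bd m y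
  proof -
    \<comment> \<open>Truncation height: large enough that \<open>f\<close> agrees with
      \<open>lin D s'\<close> at \<open>y\<close>, yet finite, so that decay at tilt
      \<open>s\<close> bounds \<open>exp f * \<psi>\<close>. Each step changes \<open>f\<close> by
      an amount between the increments of \<open>lin D s\<close> and \<open>lin D s'\<close>, hence
      within \<open>\<epsilon>\<close> of that of \<open>\<theta>\<close>.\<close>
    define T where "T = \<bar>lin D d y\<bar>"
    define f where "f x = lin D s x + min (lin D d x) T" for x
    have m0: "m \<ge> 0" using order_trans[OF norm_ge_zero m[of "\<lambda>_. 0"]] L by simp
    have Bd0: "Bd \<ge> 0" using Bd[of y] by (smt (verit) exp_ge_zero mult_nonneg_nonneg norm_ge_zero)
    have fy: "f y = lin D s' y" unfolding f_def T_def d_def lin_diff by simp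
    define ins where "ins x \<longleftrightarrow> (\<forall>k\<in>D. \<bar>x k\<bar> \<le> L)" for x :: conf
    define \<psi>i where "\<psi>i x = (if ins x then \<psi> x else 0)" for x
    define \<psi>o where "\<psi>o x = (if ins x then 0 else \<psi> x)" for x
    define \<phi> where "\<phi> x = of_real (exp (f x)) * \<psi>o x" for x
    have "cmod (\<phi> x) \<le> exp T * Bd" for x
    proof -
      have "exp (f x) \<le> exp (lin D s x) * exp T" by (simp add: f_def exp_add[symmetric])
      hence "exp (f x) * cmod (\<psi>o x) \<le> exp (lin D s x) * exp T * cmod (\<psi> x)"
        by (intro mult_mono) (auto simp: \<psi>o_def)
      also have "\<dots> = exp T * (exp (lin D s x) * cmod (\<psi> x))" by simp
      also have "\<dots> \<le> exp T * Bd" using Bd by (intro mult_left_mono) auto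
      finally show ?thesis by (simp add: \<phi>_def norm_mult)
    qed
    hence b: "bd \<phi>" by (rule bdI)
    let ?S = "range (\<lambda>x. cmod (\<phi> x))"
    have bdd: "bdd_above ?S" using b by (auto simp: bd_def bdd_above_def)
    define N where "N = Sup ?S"
    have N: "cmod (\<phi> x) \<le> N" for x
      unfolding N_def by (rule cSup_upper[OF _ bdd]) simp
    have fF: "f x \<le> F" if "\<And>k. k \<in> D \<Longrightarrow> \<bar>x k\<bar> \<le> L + 1" for x
    proof -
      have "\<bar>lin D s x\<bar> \<le> (\<Sum>k\<in>D. \<bar>s k\<bar>) * of_int (L + 1)" "\<bar>lin D d x\<bar> \<le> (\<Sum>k\<in>D. \<bar>d k\<bar>) * of_int (L + 1)"
        by (intro lin_bound that; assumption)+
      thus ?thesis unfolding f_def F_def distrib_right by linarith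
    qed
    have f_step: "\<bar>f x - f (move x p) + of_int (snd p) * \<theta> (fst p)\<bar> \<le> \<epsilon>" if p: "p \<in> steps D" for x p
    proof -
      obtain k t where k: "p = (k, t)" "k \<in> D" "t = 1 \<or> t = -1" using p by (auto simp: steps_def)
      have "\<bar>s k - \<theta> k\<bar> \<le> \<epsilon>" "\<bar>s k + d k - \<theta> k\<bar> \<le> \<epsilon>" using s s' k(2) by (auto simp: d_def)
      moreover have "f (move x p) = lin D s x + of_int t * s k + min (lin D d x + of_int t * d k) T"
        by (simp add: f_def lin_move[OF fin p]) (simp add: k(1))
      ultimately show ?thesis using k(3) unfolding f_def k(1) by (auto simp: min_def abs_le_iff)
    qed
    have inner: "exp (f x) * cmod (Op g D (\<lambda>_. 0) ?W E \<psi>i x) \<le> exp F * (Q * m)" for x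
    proof (cases "\<forall>k\<in>D. \<bar>x k\<bar> \<le> L + 1")
      case True
      have "cmod (Op g D (\<lambda>_. 0) ?W E \<psi>i x) \<le> Q * m"
        unfolding \<psi>i_def ins_def Q_def by (rule Op_box_bound[OF fin v m m0])
      thus ?thesis using fF[of x] True by (intro mult_mono) auto
    next
      case False
      then obtain k where k: "k \<in> D" "\<bar>x k\<bar> > L + 1" by (auto simp: not_le)
      have "\<psi>i x = 0" using k by (auto simp: \<psi>i_def ins_def)
      moreover have "\<psi>i (move x p) = 0" if "p \<in> steps D" for p
      proof -
        have "\<bar>move x p k\<bar> > L" using that k(2) by (auto simp: steps_def move_def)
        thus ?thesis using k(1) by (auto simp: \<psi>i_def ins_def)
      qed
      ultimately have "Op g D (\<lambda>_. 0) ?W E \<psi>i x = 0" by (simp add: Op_def)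
      thus ?thesis using Q0 m0 by simp
    qed
    \<comment> \<open>As \<open>\<psi>\<close> solves the equation, the image of the outer part is
      minus that of the inner part, which vanishes off the box of size \<open>L + 1\<close>.\<close>
    have e: "cmod (Op g D \<theta> ?W E \<phi> x) \<le> exp F * (Q * m) + 2 * \<epsilon> * hopn g D \<theta> * N" for x
    proof -
      have "(\<lambda>x. \<psi>i x + \<psi>o x) = \<psi>" by (auto simp: \<psi>i_def \<psi>o_def)
      hence "Op g D (\<lambda>_. 0) ?W E \<psi>i x + Op g D (\<lambda>_. 0) ?W E \<psi>o x = 0" using ev Op_add[of g D "\<lambda>_. 0" ?W E \<psi>i \<psi>o x] by simp
      hence "Op g D (\<lambda>_. 0) ?W E \<psi>o x = - Op g D (\<lambda>_. 0) ?W E \<psi>i x" by (simp add: add_eq_0_iff)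
      hence "cmod (of_real (exp (f x)) * Op g D (\<lambda>_. 0) ?W E \<psi>o x) \<le> exp F * (Q * m)"
        using inner[of x] by (simp add: norm_mult)
      moreover have "cmod (Op g D \<theta> ?W E \<phi> x - of_real (exp (f x)) * Op g D (\<lambda>_. 0) ?W E \<psi>o x) \<le> 2 * \<epsilon> * hopn g D \<theta> * N"
        unfolding \<phi>_def by (rule Op_weight[OF fin \<epsilon>(1) f_step]) (use N in \<open>simp_all add: \<phi>_def\<close>)
      ultimately show ?thesis
        using norm_triangle_sub[of "Op g D \<theta> ?W E \<phi> x" "of_real (exp (f x)) * Op g D (\<lambda>_. 0) ?W E \<psi>o x"] by linarith
    qed
    have le: "cmod (\<phi> x) \<le> C * (exp F * (Q * m) + 2 * \<epsilon> * hopn g D \<theta> * N)" for x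
      by (rule OLBD[OF olb b _ e]) (simp add: \<phi>_def \<psi>o_def ins_def)
    \<comment> \<open>\<open>N\<close> is finite thanks to the truncation, so the multiple of at
      most half of it on the right can be absorbed.\<close>
    have "N \<le> C * (exp F * (Q * m) + 2 * \<epsilon> * hopn g D \<theta> * N)"
      unfolding N_def using le[unfolded N_def] by (intro cSup_least) auto
    also have "\<dots> = C * exp F * Q * m + C * (2 * \<epsilon> * hopn g D \<theta>) * N" by (simp add: algebra_simps)
    also have "\<dots> \<le> C * exp F * Q * m + 1 / 2 * N"
      using \<epsilon>(2) N[of y] norm_ge_zero[of "\<phi> y"] by (intro add_left_mono mult_right_mono) linarith+
    finally have N2: "N \<le> 2 * C * exp F * Q * m" by linarith
    show ?thesis
    proof (cases "ins y")
      case True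
      have "f y \<le> F" by (rule fF) (use True in \<open>fastforce simp: ins_def\<close>)
      hence "exp (lin D s' y) * cmod (\<psi> y) \<le> exp F * m"
        using m[of y] True unfolding fy[symmetric] by (intro mult_mono) (auto simp: ins_def)
      also have "\<dots> \<le> K * m" unfolding K_def using C Q0 m0 by (simp add: algebra_simps)
      finally show ?thesis .
    next
      case False
      hence "exp (lin D s' y) * cmod (\<psi> y) = cmod (\<phi> y)" by (simp add: \<phi>_def \<psi>o_def norm_mult fy)
      also have "\<dots> \<le> 2 * C * exp F * Q * m" using N[of y] N2 by linarith
      also have "\<dots> \<le> K * m" unfolding K_def using m0 by (simp add: algebra_simps)
      finally show ?thesis .
    qed
  qed
  thus ?thesis by (intro exI[of _ K]) blast
qed

lemma OLB_mono: "OLB g D \<theta> W \<alpha> C L \<Longrightarrow> C \<le> C' \<Longrightarrow> L \<le> L' \<Longrightarrow> OLB g D \<theta> W \<alpha> C' L'"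
  unfolding OLB_def
proof (intro allI impI)
  fix \<phi> :: "conf \<Rightarrow> complex" and e x
  assume *: "\<forall>\<phi> e. bd \<phi> \<longrightarrow> (\<forall>x. (\<forall>k\<in>D. \<bar>x k\<bar> \<le> L) \<longrightarrow> \<phi> x = 0) \<longrightarrow> (\<forall>x. cmod (Op g D \<theta> W \<alpha> \<phi> x) \<le> e) \<longrightarrow> (\<forall>x. cmod (\<phi> x) \<le> C * e)"
    "C \<le> C'" "L \<le> L'" "bd \<phi>" "\<forall>x. (\<forall>k\<in>D. \<bar>x k\<bar> \<le> L') \<longrightarrow> \<phi> x = 0" "\<forall>x. cmod (Op g D \<theta> W \<alpha> \<phi> x) \<le> e"
  have "\<forall>x. (\<forall>k\<in>D. \<bar>x k\<bar> \<le> L) \<longrightarrow> \<phi> x = 0" using *(3,5) by (meson order_trans)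
  hence "cmod (\<phi> x) \<le> C * e" using *(1,4,6) by blast
  moreover have "e \<ge> 0" using *(6) norm_ge_zero order_trans by blast
  ultimately show "cmod (\<phi> x) \<le> C' * e" using mult_right_mono[OF *(2), of e] by linarith
qed

text \<open>Chaining \<open>decay_transfer\<close> along the segment from \<open>\<theta>0\<close>
  to \<open>\<theta>\<close> gives mere boundedness with the weight of \<open>\<theta>\<close>, with
  constants depending on the path. A last transfer from \<open>\<theta>\<close> to itself replaces
  them by a \<open>K\<close> independent of \<open>\<theta>0\<close>, \<open>Bd\<close> and
  \<open>\<psi>\<close>.\<close>

lemma superexponential_decay:
  fixes g h :: real and E :: complex
  assumes fin: "finite D" and v: "\<And>n. \<bar>v n\<bar> \<le> B"
    and olb: "\<And>\<theta>. \<exists>C L. OLB g D \<theta> (U h v D) E C L"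
  shows "\<exists>K L. \<forall>\<psi> \<theta>0 Bd m. (\<forall>x. Op g D (\<lambda>_. 0) (U h v D) E \<psi> x = 0) \<longrightarrow>
    (\<forall>x. exp (lin D \<theta>0 x) * cmod (\<psi> x) \<le> Bd) \<longrightarrow> (\<forall>x. (\<forall>k\<in>D. \<bar>x k\<bar> \<le> L) \<longrightarrow> cmod (\<psi> x) \<le> m) \<longrightarrow>
    (\<forall>x. exp (lin D \<theta> x) * cmod (\<psi> x) \<le> K * m)"
proof -
  have "\<exists>C L. C > 0 \<and> L \<ge> 0 \<and> OLB g D \<theta> (U h v D) E C L" for \<theta>
  proof -
    obtain C L where "OLB g D \<theta> (U h v D) E C L" using olb by blast
    hence "OLB g D \<theta> (U h v D) E (max C 1) (max L 0)" by (rule OLB_mono) auto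
    moreover have "max C 1 > 0" "max L 0 \<ge> 0" by auto
    ultimately show ?thesis by blast
  qed
  then obtain C L where CL: "\<And>\<theta>. C \<theta> > 0 \<and> L \<theta> \<ge> 0 \<and> OLB g D \<theta> (U h v D) E (C \<theta>) (L \<theta>)" by metis
  have eps: "\<exists>\<epsilon>. \<epsilon> > 0 \<and> \<epsilon> \<le> 1 \<and> C \<theta> * (2 * \<epsilon> * hopn g D \<theta>) \<le> 1 / 2" for \<theta>
  proof -
    let ?c = "4 * C \<theta> * hopn g D \<theta> + 1"
    have c: "C \<theta> * hopn g D \<theta> \<ge> 0" using CL[of \<theta>] hopn_nonneg[of g D \<theta>] by simp
    have "C \<theta> * (2 * (1 / ?c) * hopn g D \<theta>) \<le> 1 / 2" using c by (simp add: divide_simps)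
    moreover have "1 / ?c > 0" "1 / ?c \<le> 1" using c by auto
    ultimately show ?thesis by blast
  qed
  define ev where "ev \<psi> \<longleftrightarrow> (\<forall>x. Op g D (\<lambda>_. 0) (U h v D) E \<psi> x = 0)" for \<psi>
  define wb where "wb \<theta> \<psi> \<longleftrightarrow> (\<exists>Bd. \<forall>x. exp (lin D \<theta> x) * cmod (\<psi> x) \<le> Bd)" for \<theta> and \<psi> :: "conf \<Rightarrow> complex"
  have step: "wb s' \<psi>" if st: "ev \<psi>" "wb s \<psi>" "\<epsilon> \<le> 1" "C \<theta> * (2 * \<epsilon> * hopn g D \<theta>) \<le> 1 / 2"
    "\<And>k. k \<in> D \<Longrightarrow> \<bar>s k - \<theta> k\<bar> \<le> \<epsilon>" "\<And>k. k \<in> D \<Longrightarrow> \<bar>s' k - \<theta> k\<bar> \<le> \<epsilon>" for \<psi> \<theta> s s' \<epsilon>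
  proof -
    have C: "C \<theta> \<ge> 0" "L \<theta> \<ge> 0" "OLB g D \<theta> (U h v D) E (C \<theta>) (L \<theta>)" using CL[of \<theta>] by auto
    obtain K where K: "\<forall>\<psi> Bd m. (\<forall>x. Op g D (\<lambda>_. 0) (U h v D) E \<psi> x = 0) \<longrightarrow>
       (\<forall>x. exp (lin D s x) * cmod (\<psi> x) \<le> Bd) \<longrightarrow> (\<forall>x. (\<forall>k\<in>D. \<bar>x k\<bar> \<le> L \<theta>) \<longrightarrow> cmod (\<psi> x) \<le> m) \<longrightarrow>
       (\<forall>x. exp (lin D s' x) * cmod (\<psi> x) \<le> K * m)"
      using decay_transfer[OF fin v C(2,3,1) st(3-6)] by blast
    obtain Bd where Bd: "\<forall>x. exp (lin D s x) * cmod (\<psi> x) \<le> Bd" using st(2) unfolding wb_def by blast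
    define F where "F = (\<Sum>k\<in>D. \<bar>s k\<bar>) * of_int (L \<theta>)"
    have "cmod (\<psi> x) \<le> exp F * Bd" if "\<forall>k\<in>D. \<bar>x k\<bar> \<le> L \<theta>" for x
    proof -
      have "\<bar>lin D s x\<bar> \<le> F" unfolding F_def by (rule lin_bound) (use that in blast)
      hence "exp (- F) \<le> exp (lin D s x)" by simp
      hence "exp (- F) * cmod (\<psi> x) \<le> Bd" using Bd mult_right_mono[of "exp (- F)" "exp (lin D s x)" "cmod (\<psi> x)"] by (smt (verit) norm_ge_zero)
      hence "exp F * (exp (- F) * cmod (\<psi> x)) \<le> exp F * Bd" by (intro mult_left_mono) auto
      moreover have "exp F * (exp (- F) * cmod (\<psi> x)) = cmod (\<psi> x)"
        by (simp add: exp_minus)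
      ultimately show ?thesis by simp
    qed
    thus ?thesis using K st(1) Bd unfolding wb_def ev_def by blast
  qed
  have all: "wb \<theta>1 \<psi>" if e: "ev \<psi>" and w: "wb \<theta>0 \<psi>" for \<psi> \<theta>0 \<theta>1
  proof -
    define p where "p t k = \<theta>0 k + t * (\<theta>1 k - \<theta>0 k)" for t :: real and k
    define Z where "Z = (\<Sum>k\<in>D. \<bar>\<theta>1 k - \<theta>0 k\<bar>)"
    have Z: "Z \<ge> 0" "\<And>k. k \<in> D \<Longrightarrow> \<bar>\<theta>1 k - \<theta>0 k\<bar> \<le> Z"
      unfolding Z_def using fin by (auto intro: sum_nonneg member_le_sum)
    have p01: "p 0 = \<theta>0" "p 1 = \<theta>1" by (auto simp: p_def)
    \<comment> \<open>Near each \<open>t\<close> boundedness passes between any two tilts of the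
      segment. Connectedness of the interval carries it from end to end and spares a uniform choice
      of \<open>\<epsilon>\<close>.\<close>
    have "wb (p 1) \<psi>"
    proof (rule connected_induction_simple[of "{0..1}" 0 1 "\<lambda>t. wb (p t) \<psi>"])
      show "wb (p 0) \<psi>" using w by (simp add: p01)
      fix t :: real assume t: "t \<in> {0..1}"
      obtain \<epsilon> where \<epsilon>: "\<epsilon> > 0" "\<epsilon> \<le> 1" "C (p t) * (2 * \<epsilon> * hopn g D (p t)) \<le> 1 / 2" using eps[of "p t"] by blast
      define r where "r = \<epsilon> / (Z + 1)"
      have r: "r > 0" using \<epsilon> Z by (simp add: r_def)
      have near: "\<bar>p a k - p t k\<bar> \<le> \<epsilon>" if "a \<in> ball t r" "k \<in> D" for a k
      proof -
        have "p a k - p t k = (a - t) * (\<theta>1 k - \<theta>0 k)" by (simp add: p_def algebra_simps)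
        hence "\<bar>p a k - p t k\<bar> = \<bar>a - t\<bar> * \<bar>\<theta>1 k - \<theta>0 k\<bar>" by (simp add: abs_mult)
        also have "\<dots> \<le> r * (Z + 1)"
          using that Z(2)[of k] r by (intro mult_mono) (auto simp: dist_real_def)
        also have "\<dots> = \<epsilon>" using Z by (simp add: r_def)
        finally show ?thesis .
      qed
      have "wb (p b) \<psi>" if "a \<in> ball t r" "b \<in> ball t r" "wb (p a) \<psi>" for a b
        by (rule step[OF e that(3) \<epsilon>(2,3) near near]) (use that in auto)
      hence "\<forall>a\<in>{0..1} \<inter> ball t r. \<forall>b\<in>{0..1} \<inter> ball t r. wb (p a) \<psi> \<longrightarrow> wb (p b) \<psi>"
        by blast
      moreover have "openin (top_of_set {0..1}) ({0..1} \<inter> ball t r)" "t \<in> {0..1} \<inter> ball t r"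
        using t r by (auto intro: openin_open_Int)
      ultimately show "\<exists>T. openin (top_of_set {0..1}) T \<and> t \<in> T \<and> (\<forall>x\<in>T. \<forall>y\<in>T. wb (p x) \<psi> \<longrightarrow> wb (p y) \<psi>)"
        by blast
    qed auto
    thus ?thesis by (simp add: p01)
  qed
  obtain \<epsilon> where \<epsilon>: "\<epsilon> > 0" "\<epsilon> \<le> 1" "C \<theta> * (2 * \<epsilon> * hopn g D \<theta>) \<le> 1 / 2" using eps[of \<theta>] by blast
  have C: "C \<theta> \<ge> 0" "L \<theta> \<ge> 0" "OLB g D \<theta> (U h v D) E (C \<theta>) (L \<theta>)" using CL[of \<theta>] by auto
  obtain K where K: "\<forall>\<psi> Bd m. (\<forall>x. Op g D (\<lambda>_. 0) (U h v D) E \<psi> x = 0) \<longrightarrow>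
       (\<forall>x. exp (lin D \<theta> x) * cmod (\<psi> x) \<le> Bd) \<longrightarrow> (\<forall>x. (\<forall>k\<in>D. \<bar>x k\<bar> \<le> L \<theta>) \<longrightarrow> cmod (\<psi> x) \<le> m) \<longrightarrow>
       (\<forall>x. exp (lin D \<theta> x) * cmod (\<psi> x) \<le> K * m)"
    using decay_transfer[OF fin v C(2,3,1) \<epsilon>(2,3), of \<theta> \<theta>] \<epsilon>(1) by auto
  show ?thesis
  proof (intro exI[of _ K] exI[of _ "L \<theta>"] allI impI)
    fix \<psi> :: "conf \<Rightarrow> complex" and \<theta>0 Bd m x
    assume "\<forall>x. Op g D (\<lambda>_. 0) (U h v D) E \<psi> x = 0" "\<forall>x. exp (lin D \<theta>0 x) * cmod (\<psi> x) \<le> Bd"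
      and m: "\<forall>x. (\<forall>k\<in>D. \<bar>x k\<bar> \<le> L \<theta>) \<longrightarrow> cmod (\<psi> x) \<le> m"
    hence "ev \<psi>" "wb \<theta>0 \<psi>" unfolding ev_def wb_def by blast+
    moreover from all[OF this] have "wb \<theta> \<psi>" .
    ultimately show "exp (lin D \<theta> x) * cmod (\<psi> x) \<le> K * m" using K m unfolding ev_def wb_def by blast
  qed
qed

section \<open>Kernels and square summability\<close>

lemma finite_box:
  fixes L :: int
  assumes "finite D"
  shows "finite {x :: conf. (\<forall>k. k \<notin> D \<longrightarrow> x k = 0) \<and> (\<forall>k\<in>D. \<bar>x k\<bar> \<le> L)}"
proof -
  have "finite {x :: conf. \<forall>k. (k \<in> D \<longrightarrow> x k \<in> {-L..L}) \<and> (k \<notin> D \<longrightarrow> x k = 0)}"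
    by (rule finite_set_of_finite_funs) (use assms in auto)
  thus ?thesis by (rule rev_finite_subset) (auto simp: abs_le_iff)
qed

lemma countable_conf:
  assumes "finite D"
  shows "countable {x :: conf. \<forall>k. k \<notin> D \<longrightarrow> x k = 0}"
proof -
  have "{x :: conf. \<forall>k. k \<notin> D \<longrightarrow> x k = 0} \<subseteq> (\<Union>n::nat. {x. (\<forall>k. k \<notin> D \<longrightarrow> x k = 0) \<and> (\<forall>k\<in>D. \<bar>x k\<bar> \<le> int n)})"
  proof
    fix x :: conf assume x: "x \<in> {x. \<forall>k. k \<notin> D \<longrightarrow> x k = 0}"
    have "\<bar>x k\<bar> \<le> int (nat (\<Sum>k\<in>D. \<bar>x k\<bar>))" if "k \<in> D" for k
    proof -
      have "\<bar>x k\<bar> \<le> (\<Sum>k\<in>D. \<bar>x k\<bar>)" using that assms by (intro member_le_sum) auto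
      moreover have "int (nat (\<Sum>k\<in>D. \<bar>x k\<bar>)) = (\<Sum>k\<in>D. \<bar>x k\<bar>)" by (intro nat_0_le sum_nonneg) simp
      ultimately show ?thesis by simp
    qed
    thus "x \<in> (\<Union>n::nat. {x. (\<forall>k. k \<notin> D \<longrightarrow> x k = 0) \<and> (\<forall>k\<in>D. \<bar>x k\<bar> \<le> int n)})"
      using x by (intro UN_I[of "nat (\<Sum>k\<in>D. \<bar>x k\<bar>)"]) auto
  qed
  moreover have "countable (\<Union>n::nat. {x :: conf. (\<forall>k. k \<notin> D \<longrightarrow> x k = 0) \<and> (\<forall>k\<in>D. \<bar>x k\<bar> \<le> int n)})"
    by (rule countable_UN) (simp_all only: countableI_type countable_finite[OF finite_box[OF assms]])
  ultimately show ?thesis by (rule countable_subset)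
qed

text \<open>Freezing the coordinates outside \<open>D\<close> at those of a near-maximum keeps the
  normalisation and leaves a function of countably many cluster configurations, as a diagonal
  subsequence requires.\<close>

lemma approximate_kernel:
  assumes nlb: "\<not> LB g D \<theta> (U h v D) E (real (Suc n))"
  shows "\<exists>\<psi>. (\<forall>x. cmod (\<psi> x) \<le> 1) \<and> (\<forall>x. cmod (Op g D \<theta> (U h v D) E \<psi> x) \<le> 1 / real (Suc n)) \<and>
     (\<forall>x y. (\<forall>k\<in>D. x k = y k) \<longrightarrow> \<psi> x = \<psi> y) \<and> (\<exists>x. 1/2 \<le> cmod (\<psi> x))"
proof -
  obtain \<phi> e z where b: "bd \<phi>" and e: "\<And>x. cmod (Op g D \<theta> (U h v D) E \<phi> x) \<le> e" and z: "\<not> cmod (\<phi> z) \<le> real (Suc n) * e"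
    using nlb unfolding LB_def by blast
  have e0: "e \<ge> 0" using order_trans[OF norm_ge_zero e] .
  have "\<phi> z \<noteq> 0" using z e0 by auto
  from bd_near_sup[of \<phi> z, OF b this] obtain M x0 where M: "M > 0" "\<And>x. cmod (\<phi> x) \<le> M" "M / 2 \<le> cmod (\<phi> x0)" by metis
  have eM: "real (Suc n) * e \<le> M" using z M(2)[of z] by linarith
  define ov where "ov y k = (if k \<in> D then y k else x0 k)" for y :: conf and k
  define \<psi> where "\<psi> y = of_real (1 / M) * \<phi> (ov y)" for y
  have ov_move: "ov (move x p) = move (ov x) p" if "p \<in> steps D" for x p
    using that by (auto simp: ov_def move_def steps_def)
  have ovU: "U h v D (ov x) = U h v D x" for x by (rule U_cong) (simp add: ov_def)
  have "Op g D \<theta> (U h v D) E \<psi> x = of_real (1 / M) * Op g D \<theta> (U h v D) E \<phi> (ov x)" for x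
    by (simp add: Op_def \<psi>_def ov_move ovU algebra_simps sum_distrib_left)
  hence "cmod (Op g D \<theta> (U h v D) E \<psi> x) = cmod (Op g D \<theta> (U h v D) E \<phi> (ov x)) / M" for x
    using M(1) by (simp add: norm_mult norm_divide)
  moreover have "cmod (Op g D \<theta> (U h v D) E \<phi> (ov x)) / M \<le> 1 / real (Suc n)" for x
  proof -
    have "cmod (Op g D \<theta> (U h v D) E \<phi> (ov x)) / M \<le> e / M" using e M(1) by (intro divide_right_mono) auto
    also have "\<dots> \<le> 1 / real (Suc n)" using eM M(1) by (simp add: divide_simps mult.commute)
    finally show ?thesis .
  qed
  moreover have "cmod (\<psi> x) \<le> 1" for x using M by (simp add: \<psi>_def norm_divide)
  moreover have "\<psi> x = \<psi> y" if "\<forall>k\<in>D. x k = y k" for x y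
  proof -
    have "ov x = ov y" using that by (auto simp: ov_def)
    thus ?thesis by (simp add: \<psi>_def)
  qed
  moreover have "1 / 2 \<le> cmod (\<psi> x0)"
  proof -
    have "ov x0 = x0" by (auto simp: ov_def)
    thus ?thesis using M(1,3) by (simp add: \<psi>_def norm_divide divide_simps)
  qed
  ultimately show ?thesis by (intro exI[of _ \<psi>] conjI allI impI) auto
qed

text \<open>Each value of \<open>Op\<close> involves finitely many sites, so the equation survives
  pointwise limits. The outer bound prevents escape to infinity: were the limit 0, the vectors would
  become small on the finite box, their outer parts would have small image, and no value 1/2 could
  remain.\<close>

lemma kernel_of_no_LB:
  fixes g h :: real and E :: complex
  assumes fin: "finite D" and v: "\<And>n. \<bar>v n\<bar> \<le> B"
    and olb: "OLB g D \<theta> (U h v D) E C0 L" and nlb: "\<nexists>C. LB g D \<theta> (U h v D) E C"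
  shows "\<exists>\<phi>. (\<forall>x. Op g D \<theta> (U h v D) E \<phi> x = 0) \<and> (\<forall>x. cmod (\<phi> x) \<le> 1) \<and> (\<exists>x. \<phi> x \<noteq> 0) \<and>
    (\<forall>x y. (\<forall>k\<in>D. x k = y k) \<longrightarrow> \<phi> x = \<phi> y)"
proof -
  let ?O = "Op g D \<theta> (U h v D) E"
  define Q where "Q n \<psi> \<longleftrightarrow> (\<forall>x. cmod (\<psi> x) \<le> 1) \<and> (\<forall>x. cmod (?O \<psi> x) \<le> 1 / real (Suc n)) \<and>
     (\<forall>x y. (\<forall>k\<in>D. x k = y k) \<longrightarrow> \<psi> x = \<psi> y) \<and> (\<exists>x. 1/2 \<le> cmod (\<psi> x))" for n \<psi>
  have "\<exists>\<psi>. Q n \<psi>" for n using approximate_kernel[of g D \<theta> h v E n] nlb unfolding Q_def by blast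
  then obtain \<psi> where Q: "\<And>n. Q n (\<psi> n)" by metis
  have le1: "cmod (\<psi> n x) \<le> 1" and small: "cmod (?O (\<psi> n) x) \<le> 1 / real (Suc n)" for n x using Q[of n] unfolding Q_def by blast+
  have dep: "\<psi> n x = \<psi> n y" if "\<forall>k\<in>D. x k = y k" for n x y using Q[of n] that unfolding Q_def by blast
  have half: "\<exists>x. 1/2 \<le> cmod (\<psi> n x)" for n using Q[of n] unfolding Q_def by blast
  define S where "S = {x :: conf. \<forall>k. k \<notin> D \<longrightarrow> x k = 0}"
  define rs where "rs x k = (if k \<in> D then x k else 0)" for x :: conf and k
  have rsS: "rs x \<in> S" for x by (simp add: rs_def S_def)
  have rs: "\<psi> n (rs x) = \<psi> n x" for n x by (rule dep) (simp add: rs_def)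
  obtain r where r: "strict_mono (r :: nat \<Rightarrow> nat)" and conv: "\<And>x. x \<in> S \<Longrightarrow> \<exists>l. (\<lambda>n. \<psi> (r n) x) \<longlonglongrightarrow> l"
    using function_convergent_subsequence[of S \<psi> 1] countable_conf[OF fin] le1 unfolding S_def by blast
  define \<phi> where "\<phi> x = lim (\<lambda>n. \<psi> (r n) x)" for x
  have lim: "(\<lambda>n. \<psi> (r n) x) \<longlonglongrightarrow> \<phi> x" for x
  proof -
    from conv[OF rsS[of x]] obtain l where "(\<lambda>n. \<psi> (r n) x) \<longlonglongrightarrow> l" unfolding rs by blast
    thus ?thesis unfolding \<phi>_def by (simp add: limI)
  qed
  have inv0: "(\<lambda>n. 1 / real (Suc (r n))) \<longlonglongrightarrow> 0"
    using LIMSEQ_subseq_LIMSEQ[OF LIMSEQ_Suc[OF lim_1_over_n] r] by (simp add: o_def)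
  have "?O \<phi> x = 0" for x
  proof -
    have "(\<lambda>n. ?O (\<psi> (r n)) x) \<longlonglongrightarrow> ?O \<phi> x" unfolding Op_def by (intro tendsto_intros lim)
    moreover have "(\<lambda>n. ?O (\<psi> (r n)) x) \<longlonglongrightarrow> 0"
      by (rule Lim_null_comparison[OF _ inv0]) (simp add: small del: of_nat_Suc)
    ultimately show ?thesis by (rule LIMSEQ_unique)
  qed
  moreover have "cmod (\<phi> x) \<le> 1" for x
    by (rule Lim_bounded[OF tendsto_norm[OF lim], of 0]) (use le1 in auto)
  moreover have "\<phi> x = \<phi> y" if "\<forall>k\<in>D. x k = y k" for x y
    unfolding \<phi>_def using dep[OF that] by simp
  moreover have "\<exists>x. \<phi> x \<noteq> 0"
  proof (rule ccontr)
    assume "\<nexists>x. \<phi> x \<noteq> 0"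
    hence lim0: "(\<lambda>n. \<psi> (r n) x) \<longlonglongrightarrow> 0" for x using lim[of x] by simp
    define C where "C = max C0 1"
    have C: "C > 0" "OLB g D \<theta> (U h v D) E C L" using OLB_mono[OF olb, of C L] by (auto simp: C_def)
    define Z where "Z = hopn g D \<theta> + (\<bar>Ubox h D B L\<bar> + cmod E)"
    have Z: "Z \<ge> 0" by (simp add: Z_def hopn_nonneg)
    \<comment> \<open>With image error \<open>1 / (8 * C)\<close> and box values below
      \<open>\<eta>\<close>, the outer part is at most \<open>1/8 + 1/8 = 1/4\<close>.\<close>
    define \<eta> where "\<eta> = 1 / (8 * (C * Z + 1))"
    have CZ: "C * Z \<ge> 0" using C Z by simp
    have \<eta>: "\<eta> > 0" "\<eta> < 1/2" "C * (Z * \<eta>) \<le> 1/8" using CZ by (auto simp: \<eta>_def divide_simps)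
    let ?F = "{x :: conf. (\<forall>k. k \<notin> D \<longrightarrow> x k = 0) \<and> (\<forall>k\<in>D. \<bar>x k\<bar> \<le> L)}"
    have "\<forall>\<^sub>F n in sequentially. \<forall>x\<in>?F. cmod (\<psi> (r n) x) < \<eta>"
    proof (rule eventually_ball_finite[OF finite_box[OF fin]], intro ballI)
      fix x show "\<forall>\<^sub>F n in sequentially. cmod (\<psi> (r n) x) < \<eta>"
        using tendstoD[OF lim0[of x] \<eta>(1)] by simp
    qed
    moreover have "\<forall>\<^sub>F n in sequentially. 1 / real (Suc (r n)) < 1 / (8 * C)"
      using order_tendstoD(2)[OF inv0, of "1 / (8 * C)"] C by simp
    ultimately have "\<forall>\<^sub>F n in sequentially. (\<forall>x\<in>?F. cmod (\<psi> (r n) x) < \<eta>) \<and> 1 / real (Suc (r n)) < 1 / (8 * C)"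
      by (rule eventually_conj)
    then obtain n where n: "\<forall>x\<in>?F. cmod (\<psi> (r n) x) < \<eta>" "1 / real (Suc (r n)) < 1 / (8 * C)"
      using eventually_happens'[OF sequentially_bot] by blast
    let ?\<psi> = "\<psi> (r n)"
    let ?i = "\<lambda>x. if \<forall>k\<in>D. \<bar>x k\<bar> \<le> L then ?\<psi> x else 0"
    let ?o = "\<lambda>x. if \<forall>k\<in>D. \<bar>x k\<bar> \<le> L then 0 else ?\<psi> x"
    have box: "cmod (?\<psi> x) \<le> \<eta>" if "\<forall>k\<in>D. \<bar>x k\<bar> \<le> L" for x
    proof -
      have "rs x \<in> ?F" using that by (simp add: rs_def)
      hence "cmod (?\<psi> (rs x)) < \<eta>" using n(1) by blast
      thus ?thesis by (simp add: rs)
    qed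
    have "cmod (?o x) \<le> C * (1 / (8 * C) + Z * \<eta>)" for x
    proof (rule OLBD[OF C(2), of ?o])
      show "bd ?o" by (rule bdI[of _ 1]) (simp add: le1)
      fix x
      have "(\<lambda>x. ?i x + ?o x) = ?\<psi>" by auto
      hence "?O ?o x = ?O ?\<psi> x - ?O ?i x" using Op_add[of g D \<theta> "U h v D" E ?i ?o x] by simp
      also have "cmod \<dots> \<le> 1 / (8 * C) + Z * \<eta>"
        using order_trans[OF small less_imp_le[OF n(2)]] Op_box_bound[OF fin v box less_imp_le[OF \<eta>(1)], where g = g and \<theta> = \<theta> and h = h and E = E and x = x]
        unfolding Z_def by (intro norm_triangle_le_diff add_mono)
      finally show "cmod (?O ?o x) \<le> 1 / (8 * C) + Z * \<eta>" .
    qed simp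
    moreover have "C * (1 / (8 * C) + Z * \<eta>) \<le> 1/4" using C(1) \<eta>(3) by (simp add: distrib_left)
    ultimately have o: "cmod (?o x) \<le> 1/4" for x using order_trans by blast
    obtain x where x: "1/2 \<le> cmod (?\<psi> x)" using half by blast
    show False
    proof (cases "\<forall>k\<in>D. \<bar>x k\<bar> \<le> L")
      case True thus ?thesis using box[OF True] \<eta>(2) x by linarith
    next
      case False
      hence "?o x = ?\<psi> x" by (rule if_not_P)
      thus ?thesis using o[of x] x by simp
    qed
  qed
  ultimately show ?thesis by blast
qed

lemma Op_weight_linear:
  assumes "finite D"
  shows "Op g D (\<lambda>_. 0) W \<alpha> (\<lambda>x. of_real (exp (- lin D \<theta> x)) * \<phi> x) x = of_real (exp (- lin D \<theta> x)) * Op g D \<theta> W \<alpha> \<phi> x"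
proof -
  have "hopc g (\<lambda>_. 0) p * exp (- lin D \<theta> (move x p)) = exp (- lin D \<theta> x) * hopc g \<theta> p" if "p \<in> steps D" for p
    by (simp add: lin_move[OF assms that] hopc_def exp_minus exp_add exp_diff field_simps)
  hence eq: "complex_of_real (hopc g (\<lambda>_. 0) p) * (of_real (exp (- lin D \<theta> (move x p))) * \<phi> (move x p)) = of_real (exp (- lin D \<theta> x)) * (of_real (hopc g \<theta> p) * \<phi> (move x p))"
    if "p \<in> steps D" for p
    using that by (simp flip: mult.assoc of_real_mult)
  have "(\<Sum>p\<in>steps D. complex_of_real (hopc g (\<lambda>_. 0) p) * (of_real (exp (- lin D \<theta> (move x p))) * \<phi> (move x p)))
      = of_real (exp (- lin D \<theta> x)) * (\<Sum>p\<in>steps D. of_real (hopc g \<theta> p) * \<phi> (move x p))"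
    unfolding sum_distrib_left by (intro sum.cong refl eq)
  thus ?thesis by (simp add: Op_def distrib_left mult.left_commute)
qed

section \<open>Exponentially decaying solutions and the spectrum\<close>

lemma summable_exp_abs_int: "(\<lambda>n :: int. exp (- real_of_int \<bar>n\<bar>)) summable_on UNIV"
proof -
  let ?f = "\<lambda>n :: int. exp (- real_of_int \<bar>n\<bar>)"
  have "summable (\<lambda>n. exp (-1 :: real) ^ n)" by (rule summable_geometric) simp
  hence s: "(\<lambda>n :: nat. exp (- real n)) summable_on UNIV"
    by (subst summable_on_UNIV_nonneg_real_iff) (simp_all flip: exp_of_nat_mult)
  have "?f summable_on range int"
    by (subst summable_on_reindex) (use s in \<open>simp_all add: o_def\<close>)
  moreover have "?f summable_on range (\<lambda>n. - int n)"
    by (subst summable_on_reindex) (use s in \<open>simp_all add: o_def inj_on_def\<close>)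
  ultimately have "?f summable_on (range int \<union> range (\<lambda>n. - int n))" by (rule summable_on_union)
  moreover have "range int \<union> range (\<lambda>n. - int n) = UNIV"
  proof -
    have "n \<in> range int \<union> range (\<lambda>n. - int n)" for n by (cases n rule: int_cases2) auto
    thus ?thesis by blast
  qed
  ultimately show ?thesis by simp
qed

lemma summable_on_product_nonneg:
  fixes f :: "'a \<Rightarrow> real" and g :: "'b \<Rightarrow> real"
  assumes f: "f summable_on A" "\<And>x. f x \<ge> 0" and g: "g summable_on B" "\<And>x. g x \<ge> 0"
  shows "(\<lambda>(x, y). f x * g y) summable_on A \<times> B"
proof (rule nonneg_bdd_above_summable_on)
  show "bdd_above (sum (\<lambda>(x, y). f x * g y) ` {F. F \<subseteq> A \<times> B \<and> finite F})"
  proof (rule bdd_aboveI2)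
    fix F assume "F \<in> {F. F \<subseteq> A \<times> B \<and> finite F}"
    hence F: "F \<subseteq> A \<times> B" "finite F" by auto
    have "(\<Sum>(x, y)\<in>F. f x * g y) \<le> (\<Sum>(x, y)\<in>fst ` F \<times> snd ` F. f x * g y)"
      by (rule sum_mono2) (use F f g in \<open>auto intro!: mult_nonneg_nonneg rev_image_eqI\<close>)
    also have "\<dots> = sum f (fst ` F) * sum g (snd ` F)"
      by (simp add: sum_product sum.cartesian_product)
    also have "\<dots> \<le> infsum f A * infsum g B"
      using F f g by (intro mult_mono finite_sum_le_infsum sum_nonneg infsum_nonneg) auto
    finally show "(\<Sum>(x, y)\<in>F. f x * g y) \<le> infsum f A * infsum g B" .
  qed
qed (use f g in auto)

text \<open>The product of one-particle weights, used as summable majorant for sums over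
  configurations.\<close>

definition expw :: "nat \<Rightarrow> int list \<Rightarrow> real" where
  "expw p xs = exp (- (\<Sum>i<p. real_of_int \<bar>xs ! i\<bar>))"

lemma expw_pos: "expw p xs > 0" and expw_le1: "expw p xs \<le> 1"
  by (simp_all add: expw_def sum_nonneg)

lemma summable_expw: "expw p summable_on {xs. length xs = p}"
proof (induction p)
  case 0
  have "{xs :: int list. length xs = 0} = {[]}" by auto
  thus ?case by simp
next
  case (Suc p)
  have bij: "bij_betw (\<lambda>(a, xs). a # xs) (UNIV \<times> {xs :: int list. length xs = p}) {xs. length xs = Suc p}"
    by (rule bij_betwI[where g = "\<lambda>xs. (hd xs, tl xs)"]) (auto simp: length_Suc_conv)
  have "(\<lambda>(a, xs). exp (- real_of_int \<bar>a\<bar>) * expw p xs) summable_on UNIV \<times> {xs. length xs = p}"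
    by (rule summable_on_product_nonneg[OF summable_exp_abs_int _ Suc]) (simp_all add: expw_def)
  also have "(\<lambda>(a, xs). exp (- real_of_int \<bar>a\<bar>) * expw p xs) = (\<lambda>q. expw (Suc p) ((\<lambda>(a, xs). a # xs) q))"
    by (rule ext) (auto simp: expw_def sum.lessThan_Suc_shift mult_exp_exp simp del: sum.lessThan_Suc)
  finally show ?case by (simp only: summable_on_reindex_bij_betw[OF bij])
qed

lemma has_sum_zero_sum:
  fixes f :: "'k \<Rightarrow> 'a \<Rightarrow> real"
  assumes "finite K" "\<And>k. k \<in> K \<Longrightarrow> (f k has_sum 0) S"
  shows "((\<lambda>x. \<Sum>k\<in>K. f k x) has_sum 0) S"
  using assms
proof (induction K rule: finite_induct)
  case empty show ?case by simp
next
  case (insert a K)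
  hence "((\<lambda>x. f a x + (\<Sum>k\<in>K. f k x)) has_sum (0 + 0)) S" by (intro has_sum_add) auto
  thus ?case using insert.hyps by simp
qed

lemma shift_bij:
  assumes "k < p"
  shows "bij_betw (\<lambda>xs :: int list. xs[k := xs ! k + 1]) {xs. length xs = p} {xs. length xs = p}"
  by (rule bij_betwI[where g = "\<lambda>xs. xs[k := xs ! k - 1]"]) (use assms in auto)

text \<open>\<open>E\<close> is complex, since nothing about tilted operators makes it real
  beforehand. Taking the imaginary part of \<open>cnj (\<Psi> xs) * Hop g h v p \<Psi> xs\<close>
  pointwise removes the real diagonal before summation, so the unbounded field is never summed. Left
  and right hops cancel after a shift, which forces \<open>Im E = 0\<close>.\<close>

lemma eigenvalue_in_spec:
  fixes E :: complex
  assumes supp: "\<And>xs. length xs \<noteq> p \<Longrightarrow> \<Psi> xs = 0"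
    and dec: "\<And>xs. length xs = p \<Longrightarrow> cmod (\<Psi> xs) \<le> K * expw p xs"
    and eq: "\<And>xs. length xs = p \<Longrightarrow> Hop g h v p \<Psi> xs = E * \<Psi> xs"
    and nz: "\<Psi> z \<noteq> 0"
  shows "E \<in> of_real ` spec g h v p"
proof -
  let ?S = "{xs :: int list. length xs = p}"
  have zS: "z \<in> ?S" using supp nz by auto
  have K: "K > 0"
  proof -
    have "0 < K * expw p z" using dec[of z] zS nz by (simp add: less_le_trans[of _ "cmod (\<Psi> z)"])
    thus ?thesis using expw_pos[of p z] by (simp add: zero_less_mult_iff)
  qed
  have le: "cmod (\<Psi> xs) \<le> K" for xs
  proof (cases "length xs = p")
    case True
    have "K * expw p xs \<le> K * 1" using K expw_le1 by (intro mult_left_mono) auto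
    thus ?thesis using dec[OF True] by simp
  next
    case False thus ?thesis using supp K by simp
  qed
  have prod: "cmod (\<Psi> xs) * cmod (\<Psi> ys) \<le> K * K * expw p xs" if "xs \<in> ?S" for xs ys
  proof -
    have "cmod (\<Psi> xs) * cmod (\<Psi> ys) \<le> (K * expw p xs) * K"
      using that dec le K expw_pos[of p xs] by (intro mult_mono) (auto intro: less_imp_le)
    thus ?thesis by (simp add: mult.commute mult.left_commute)
  qed
  have sKK: "(\<lambda>xs. K * K * expw p xs) summable_on ?S" by (intro summable_on_cmult_right summable_expw)
  have sq: "(\<lambda>xs. (cmod (\<Psi> xs))\<^sup>2) summable_on ?S"
    by (rule summable_on_comparison_test[OF sKK]) (use prod in \<open>auto simp: power2_eq_square\<close>)
  hence sqU: "(\<lambda>xs. (cmod (\<Psi> xs))\<^sup>2) summable_on UNIV"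
    by (subst summable_on_cong_neutral[where T = ?S and g = "\<lambda>xs. (cmod (\<Psi> xs))\<^sup>2"]) (auto simp: supp)
  have l2: "\<Psi> \<in> l2 p" using sqU supp by (simp add: l2_def)
  have HE: "Hop g h v p \<Psi> = (\<lambda>x. E * \<Psi> x)"
  proof
    fix x show "Hop g h v p \<Psi> x = E * \<Psi> x"
      using eq supp by (cases "length x = p") (auto simp: Hop_def)
  qed
  have "Im E = 0"
  proof -
    define A where "A k xs = Im (cnj (\<Psi> xs) * \<Psi> (xs[k := xs ! k + 1]))" for k xs
    define A' where "A' k xs = Im (cnj (\<Psi> xs) * \<Psi> (xs[k := xs ! k - 1]))" for k xs
    have bnd: "\<bar>Im (cnj (\<Psi> xs) * \<Psi> ys)\<bar> \<le> K * K * expw p xs" if "xs \<in> ?S" for xs ys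
      using prod[OF that, of ys] abs_Im_le_cmod[of "cnj (\<Psi> xs) * \<Psi> ys"] by (simp add: norm_mult)
    have sA: "A k summable_on ?S" and sA': "A' k summable_on ?S" for k
    proof -
      have "(\<lambda>xs. norm (A k xs)) summable_on ?S" "(\<lambda>xs. norm (A' k xs)) summable_on ?S"
        by (rule summable_on_comparison_test[OF sKK]; use bnd in \<open>simp add: A_def A'_def\<close>)+
      thus "A k summable_on ?S" "A' k summable_on ?S" by (auto intro: abs_summable_summable)
    qed
    \<comment> \<open>A shift by one site turns the left-hop product into the complex conjugate of
      the right-hop product, which reverses the imaginary part.\<close>
    have cancel: "((\<lambda>xs. - g * (A k xs + A' k xs)) has_sum 0) ?S" if "k < p" for k
    proof -
      have "infsum (A' k) ?S = infsum (\<lambda>xs. A' k (xs[k := xs ! k + 1])) ?S"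
        by (rule infsum_reindex_bij_betw[OF shift_bij[OF that], symmetric])
      also have "\<dots> = infsum (\<lambda>xs. - A k xs) ?S"
      proof (rule infsum_cong)
        fix xs :: "int list" assume "xs \<in> ?S"
        thus "A' k (xs[k := xs ! k + 1]) = - A k xs"
          using that by (simp add: A_def A'_def)
      qed
      also have "\<dots> = - infsum (A k) ?S" by (rule infsum_uminus)
      finally have "infsum (A k) ?S + infsum (A' k) ?S = 0" by simp
      moreover have "((\<lambda>xs. - g * (A k xs + A' k xs)) has_sum - g * (infsum (A k) ?S + infsum (A' k) ?S)) ?S"
        by (intro has_sum_cmult_right has_sum_add has_sum_infsum sA sA')
      ultimately show ?thesis by simp
    qed
    have imr: "Im (complex_of_real a * w) = a * Im w" for a w by simp
    have tot0: "((\<lambda>xs. \<Sum>k<p. - g * (A k xs + A' k xs)) has_sum 0) ?S"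
      by (rule has_sum_zero_sum) (use cancel in auto)
    have pointwise: "(\<Sum>k<p. - g * (A k xs + A' k xs)) = Im E * (cmod (\<Psi> xs))\<^sup>2" if "xs \<in> ?S" for xs
    proof -
      have l: "length xs = p" using that by simp
      define r where "r = (\<Sum>k<p. - (2 * h * of_int (xs!k))) + (\<Sum>j<p. \<Sum>i<j. v (xs!i - xs!j))"
      have "E * \<Psi> xs = (\<Sum>k<p. complex_of_real g * (- (\<Psi> (xs[k := xs!k - 1]) + \<Psi> (xs[k := xs!k + 1])))) + of_real r * \<Psi> xs"
      proof -
        define a where "a k = complex_of_real g * (- (\<Psi> (xs[k := xs!k - 1]) + \<Psi> (xs[k := xs!k + 1])))" for k
        define b where "b k = complex_of_real (2 * h * of_int (xs!k))" for k
        define c where "c j = (\<Sum>i<j. complex_of_real (v (xs!i - xs!j)))" for j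
        have "E * \<Psi> xs = (\<Sum>k<p. a k - b k * \<Psi> xs) + (\<Sum>j<p. c j * \<Psi> xs)"
          using eq[OF l] l unfolding Hop_def a_def b_def c_def sum_distrib_right by simp
        hence "E * \<Psi> xs = sum a {..<p} + (sum c {..<p} - sum b {..<p}) * \<Psi> xs"
          unfolding sum_subtractf sum_distrib_right[symmetric] by (simp add: algebra_simps)
        moreover have "of_real r = sum c {..<p} - sum b {..<p}"
          by (simp add: r_def b_def c_def sum_negf)
        ultimately show ?thesis unfolding a_def[symmetric] by simp
      qed
      hence "cnj (\<Psi> xs) * (E * \<Psi> xs) = cnj (\<Psi> xs) * ((\<Sum>k<p. complex_of_real g * (- (\<Psi> (xs[k := xs!k - 1]) + \<Psi> (xs[k := xs!k + 1])))) + of_real r * \<Psi> xs)"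
        by simp
      also have "\<dots> = (\<Sum>k<p. complex_of_real (- g) * (cnj (\<Psi> xs) * \<Psi> (xs[k := xs!k + 1]) + cnj (\<Psi> xs) * \<Psi> (xs[k := xs!k - 1]))) + of_real r * (\<Psi> xs * cnj (\<Psi> xs))"
        by (simp add: distrib_left sum_distrib_left algebra_simps)
      finally have "E * (\<Psi> xs * cnj (\<Psi> xs)) = \<dots>" by (simp add: ac_simps)
      hence "Im (E * (\<Psi> xs * cnj (\<Psi> xs))) = (\<Sum>k<p. - g * (A k xs + A' k xs)) + Im (of_real r * (\<Psi> xs * cnj (\<Psi> xs)))"
        by (simp only: plus_complex.sel Im_sum imr A_def A'_def)
      thus ?thesis unfolding complex_norm_square[symmetric] by (simp del: of_real_power)
    qed
    have "((\<lambda>xs. Im E * (cmod (\<Psi> xs))\<^sup>2) has_sum 0) ?S"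
      by (rule iffD1[OF has_sum_cong[OF pointwise] tot0])
    moreover have "((\<lambda>xs. Im E * (cmod (\<Psi> xs))\<^sup>2) has_sum Im E * infsum (\<lambda>xs. (cmod (\<Psi> xs))\<^sup>2) ?S) ?S"
      by (intro has_sum_cmult_right has_sum_infsum sq)
    ultimately have "Im E * infsum (\<lambda>xs. (cmod (\<Psi> xs))\<^sup>2) ?S = 0" using has_sum_unique by blast
    moreover have "infsum (\<lambda>xs. (cmod (\<Psi> xs))\<^sup>2) ?S \<ge> (cmod (\<Psi> z))\<^sup>2"
      using finite_sum_le_infsum[OF sq, of "{z}"] zS by simp
    ultimately show ?thesis using nz by auto
  qed
  hence Er: "E = of_real (Re E)" by (simp add: complex_eq_iff)
  have "Re E \<in> spec g h v p"
    unfolding spec_def mem_Collect_eq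
  proof
    assume "\<exists>R C. (\<forall>\<phi>\<in>l2 p. R \<phi> \<in> Hdom g h v p \<and> l2norm (R \<phi>) \<le> C * l2norm \<phi> \<and>
          (\<lambda>x. Hop g h v p (R \<phi>) x - complex_of_real (Re E) * R \<phi> x) = \<phi>) \<and>
      (\<forall>\<psi>\<in>Hdom g h v p. R (\<lambda>x. Hop g h v p \<psi> x - complex_of_real (Re E) * \<psi> x) = \<psi>)"
    then obtain R C where R1: "\<forall>\<phi>\<in>l2 p. l2norm (R \<phi>) \<le> C * l2norm \<phi>"
      and R2: "\<forall>\<psi>\<in>Hdom g h v p. R (\<lambda>x. Hop g h v p \<psi> x - complex_of_real (Re E) * \<psi> x) = \<psi>" by blast
    have "(\<lambda>x. E * \<Psi> x) \<in> l2 p"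
      using l2 by (simp add: l2_def norm_mult power_mult_distrib summable_on_cmult_right)
    hence dom: "\<Psi> \<in> Hdom g h v p" using l2 by (simp add: Hdom_def HE)
    \<comment> \<open>An inverse would have to map 0 to \<open>\<Psi>\<close>, against its norm
      bound.\<close>
    have "R (\<lambda>_. 0) = \<Psi>" using bspec[OF R2 dom] Er by (simp add: HE)
    moreover have "(\<lambda>_. 0) \<in> l2 p" by (simp add: l2_def)
    ultimately have "l2norm \<Psi> \<le> C * l2norm (\<lambda>_. 0)" using R1[rule_format, of "\<lambda>_. 0"] by simp
    hence "infsum (\<lambda>x. (cmod (\<Psi> x))\<^sup>2) UNIV \<le> 0" by (simp add: l2norm_def)
    from nonneg_infsum_le_0D[OF this sqU, of z] show False using nz by simp
  qed
  hence "complex_of_real (Re E) \<in> of_real ` spec g h v p" by (rule imageI)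
  thus ?thesis using Er by simp
qed

section \<open>Induction over clusters\<close>

text \<open>The enumeration of the cluster is increasing, so pairs \<open>i < j\<close> of labels
  match pairs \<open>i < j\<close> of list positions and \<open>v\<close> is evaluated at the same
  differences, which matters when \<open>v\<close> is not even.\<close>

lemma Op_eq_Hop:
  assumes en: "strict_mono_on {..<p} en" and D: "en ` {..<p} = D"
  defines "ls \<equiv> (\<lambda>x :: conf. map (\<lambda>i. x (en i)) [0..<p])"
  shows "Op g D (\<lambda>_. 0) (U h v D) E (\<lambda>x. \<Psi> (ls x)) x = Hop g h v p \<Psi> (ls x) - E * \<Psi> (ls x)"
proof -
  have inj: "inj_on en {..<p}" using en by (rule strict_mono_on_imp_inj_on)
  have bij: "bij_betw en {..<p} D" using inj D by (simp add: bij_betw_def)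
  have less: "en i < en j \<longleftrightarrow> i < j" if "i < p" "j < p" for i j
    using strict_mono_on_less[OF en] that by simp
  have nth: "ls x ! k = x (en k)" if "k < p" for k using that by (simp add: ls_def)
  have len: "length (ls x) = p" by (simp add: ls_def)
  have upd: "ls (move x (en k, s)) = (ls x)[k := ls x ! k + s]" if "k < p" for k s
  proof (rule nth_equalityI)
    fix i assume "i < length (ls (move x (en k, s)))"
    hence i: "i < p" by (simp add: ls_def)
    show "ls (move x (en k, s)) ! i = (ls x)[k := ls x ! k + s] ! i"
      using i that inj by (auto simp: ls_def move_def nth_list_update inj_on_eq_iff)
  qed (simp add: ls_def)
  have "(\<Sum>q\<in>steps D. of_real (hopc g (\<lambda>_. 0) q) * \<Psi> (ls (move x q)))
      = (\<Sum>k\<in>D. \<Sum>s\<in>{-1, 1}. of_real (- g) * \<Psi> (ls (move x (k, s))))"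
    unfolding steps_def sum.cartesian_product by (simp add: hopc_def case_prod_beta)
  also have "\<dots> = (\<Sum>k\<in>D. of_real g * (- (\<Psi> (ls (move x (k, -1))) + \<Psi> (ls (move x (k, 1))))))"
    by (intro sum.cong refl) (simp add: algebra_simps)
  also have "\<dots> = (\<Sum>k<p. of_real g * (- (\<Psi> (ls (move x (en k, -1))) + \<Psi> (ls (move x (en k, 1))))))"
    by (rule sum.reindex_bij_betw[OF bij, symmetric])
  also have "\<dots> = (\<Sum>k<p. of_real g * (- (\<Psi> ((ls x)[k := ls x ! k - 1]) + \<Psi> ((ls x)[k := ls x ! k + 1]))))"
    by (intro sum.cong refl) (simp add: upd)
  finally have hop: "(\<Sum>q\<in>steps D. of_real (hopc g (\<lambda>_. 0) q) * \<Psi> (ls (move x q))) = \<dots>" .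
  have "tot D x = (\<Sum>k<p. ls x ! k)"
    unfolding tot_def sum.reindex_bij_betw[OF bij, symmetric] by (intro sum.cong refl) (simp add: nth)
  hence tot: "of_int (tot D x) = (\<Sum>k<p. of_int (ls x ! k) :: real)" by simp
  have pot: "pot v D x = (\<Sum>j<p. \<Sum>i<j. v (ls x ! i - ls x ! j))"
    unfolding pot_def sum.reindex_bij_betw[OF bij, symmetric]
  proof (rule sum.cong[OF refl])
    fix j assume j: "j \<in> {..<p}"
    have "bij_betw en {..<j} {i \<in> D. i < en j}"
      unfolding bij_betw_def
    proof
      show "inj_on en {..<j}" using inj j by (auto intro: inj_on_subset)
      show "en ` {..<j} = {i \<in> D. i < en j}" using j less D by force
    qed
    from sum.reindex_bij_betw[OF this, of "\<lambda>i. v (x i - x (en j))"]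
    have "(\<Sum>i\<in>{i \<in> D. i < en j}. v (x i - x (en j))) = (\<Sum>i<j. v (x (en i) - x (en j)))" by simp
    also have "\<dots> = (\<Sum>i<j. v (ls x ! i - ls x ! j))" using j by (intro sum.cong refl) (simp add: nth)
    finally show "(\<Sum>i\<in>{i \<in> D. i < en j}. v (x i - x (en j))) = (\<Sum>i<j. v (ls x ! i - ls x ! j))" .
  qed
  define a where "a k = complex_of_real g * (- (\<Psi> ((ls x)[k := ls x ! k - 1]) + \<Psi> ((ls x)[k := ls x ! k + 1])))" for k
  define b where "b k = complex_of_real (2 * h * of_int (ls x ! k))" for k
  define c where "c j = (\<Sum>i<j. complex_of_real (v (ls x ! i - ls x ! j)))" for j
  have "Hop g h v p \<Psi> (ls x) = (\<Sum>k<p. a k - b k * \<Psi> (ls x)) + (\<Sum>j<p. c j * \<Psi> (ls x))"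
    unfolding Hop_def a_def b_def c_def sum_distrib_right by (simp add: len)
  hence "Hop g h v p \<Psi> (ls x) = sum a {..<p} + (sum c {..<p} - sum b {..<p}) * \<Psi> (ls x)"
    unfolding sum_subtractf sum_distrib_right[symmetric] by (simp add: algebra_simps)
  moreover have "of_real (U h v D x) = sum c {..<p} - sum b {..<p}"
    by (simp add: U_def pot tot b_def c_def sum_distrib_left)
  ultimately have "Hop g h v p \<Psi> (ls x) = sum a {..<p} + of_real (U h v D x) * \<Psi> (ls x)" by simp
  thus ?thesis unfolding Op_def hop a_def[symmetric] by (simp add: algebra_simps)
qed

text \<open>Unlike \<open>cluster_spec\<close>, this admits the partition into a single part.\<close>

definition part_spec :: "real \<Rightarrow> real \<Rightarrow> (int \<Rightarrow> real) \<Rightarrow> nat \<Rightarrow> real set" where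
  "part_spec g h v p = (\<Union>ps \<in> {ps. ps \<noteq> [] \<and> (\<forall>q\<in>set ps. q > 0) \<and> sum_list ps = p}. msum (map (spec g h v) ps))"

lemma msum_append: "a \<in> msum As \<Longrightarrow> b \<in> msum Bs \<Longrightarrow> a + b \<in> msum (As @ Bs)"
proof (induction As arbitrary: a)
  case Nil thus ?case by simp
next
  case (Cons A As)
  then obtain c d where cd: "a = c + d" "c \<in> A" "d \<in> msum As" by auto
  have "d + b \<in> msum (As @ Bs)" by (rule Cons.IH[OF cd(3) Cons.prems(2)])
  hence "c + (d + b) \<in> msum (A # (As @ Bs))" using cd(2) unfolding msum.simps by blast
  thus ?case using cd(1) by (simp add: add.assoc del: msum.simps)
qed

text \<open>Concatenating two nonempty partitions gives at least two parts, so the sum lands in the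
  cluster spectrum.\<close>

lemma part_spec_add_cluster:
  assumes "a \<in> part_spec g h v p" "b \<in> part_spec g h v q"
  shows "a + b \<in> cluster_spec g h v (p + q)"
proof -
  obtain ps where ps: "ps \<noteq> []" "\<forall>q\<in>set ps. q > 0" "sum_list ps = p" "a \<in> msum (map (spec g h v) ps)"
    using assms(1) by (auto simp: part_spec_def)
  obtain qs where qs: "qs \<noteq> []" "\<forall>q\<in>set qs. q > 0" "sum_list qs = q" "b \<in> msum (map (spec g h v) qs)"
    using assms(2) by (auto simp: part_spec_def)
  have "a + b \<in> msum (map (spec g h v) (ps @ qs))" using msum_append[OF ps(4) qs(4)] by simp
  moreover have "length (ps @ qs) \<ge> 2" using ps(1) qs(1) by (cases ps; cases qs) auto
  moreover have "\<forall>r\<in>set (ps @ qs). r > 0" "sum_list (ps @ qs) = p + q" using ps qs by auto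
  ultimately show ?thesis unfolding cluster_spec_def by blast
qed

lemma cluster_spec_subset: "cluster_spec g h v p \<subseteq> part_spec g h v p"
  unfolding cluster_spec_def part_spec_def by (rule UN_mono) auto

lemma spec_subset_part_spec:
  assumes "p > 0"
  shows "spec g h v p \<subseteq> part_spec g h v p"
proof
  fix a assume "a \<in> spec g h v p"
  hence "a \<in> msum (map (spec g h v) [p])" by simp
  thus "a \<in> part_spec g h v p" unfolding part_spec_def by (rule UN_I[rotated]) (use assms in simp)
qed

text \<open>For each splitting and each \<open>\<alpha>\<close> one of the two cluster bounds must
  hold: if \<open>\<alpha>\<close> and \<open>E - \<alpha>\<close> both lay in the partition
  spectra, their sum \<open>E\<close> would be in the cluster spectrum. Non-real parameters avoid
  these real sets, which supplies the bounds off the real axis.\<close>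

lemma outer_LB_of_clusters:
  fixes E :: complex
  assumes fin: "finite D" and ne: "D \<noteq> {}" and h: "h \<noteq> 0" and v: "\<And>n. \<bar>v n\<bar> \<le> B"
    and v0: "(v \<longlongrightarrow> 0) at_top" "(v \<longlongrightarrow> 0) at_bot"
    and E: "E \<notin> of_real ` cluster_spec g h v (card D)"
    and sub: "\<And>D' (\<beta> :: complex). D' \<subset> D \<Longrightarrow> D' \<noteq> {} \<Longrightarrow> \<beta> \<notin> of_real ` part_spec g h v (card D') \<Longrightarrow> \<exists>C. LB g D' \<theta> (U h v D') \<beta> C"
  shows "\<exists>C L. OLB g D \<theta> (U h v D) E C L"
proof (rule HVZ[OF fin ne h v v0])
  fix D1 D2 assume D: "D1 \<noteq> {}" "D2 \<noteq> {}" "D1 \<inter> D2 = {}" "D1 \<union> D2 = D"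
  have f: "finite D1" "finite D2" using D(4) fin by auto
  have ss: "D1 \<subset> D" "D2 \<subset> D" using D by auto
  have card: "card D = card D1 + card D2" using card_Un_disjoint[OF f D(3)] D(4) by simp
  have nr: "\<beta> \<notin> of_real ` A" if "Im \<beta> \<noteq> 0" for \<beta> and A :: "real set" using that by auto
  show "\<exists>C. LB g D \<theta> (\<lambda>x. U h v D1 x + U h v D2 x) E C"
    unfolding D(4)[symmetric]
  proof (rule two_cluster_LB[OF f D(1-3) h v])
    show "\<exists>C. LB g D1 \<theta> (U h v D1) \<beta> C" if "Im \<beta> \<noteq> 0" for \<beta> by (rule sub[OF ss(1) D(1) nr[OF that]])
    show "\<exists>C. LB g D2 \<theta> (U h v D2) \<beta> C" if "Im \<beta> \<noteq> 0" for \<beta> by (rule sub[OF ss(2) D(2) nr[OF that]])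
    fix \<alpha>
    have "\<alpha> \<notin> of_real ` part_spec g h v (card D1) \<or> E - \<alpha> \<notin> of_real ` part_spec g h v (card D2)"
    proof (rule ccontr)
      assume "\<not> ?thesis"
      then obtain a b where ab: "a \<in> part_spec g h v (card D1)" "b \<in> part_spec g h v (card D2)" "\<alpha> = of_real a" "E - \<alpha> = of_real b"
        by auto
      have "E = of_real (a + b)" using ab(3,4) by (simp add: algebra_simps)
      moreover have "a + b \<in> cluster_spec g h v (card D)" unfolding card by (rule part_spec_add_cluster[OF ab(1,2)])
      ultimately show False using E by blast
    qed
    thus "(\<exists>C. LB g D1 \<theta> (U h v D1) \<alpha> C) \<or> (\<exists>C. LB g D2 \<theta> (U h v D2) (E - \<alpha>) C)"
      using sub[OF ss(1) D(1)] sub[OF ss(2) D(2)] by blast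
  qed
qed

text \<open>For each \<open>x\<close> the tilt with components \<open>t\<close> or \<open>-t\<close>
  according to the signs of the coordinates turns \<open>lin\<close> into \<open>t\<close> times the
  l1 norm. Only finitely many such tilts occur, so their constants can be added.\<close>

lemma uniform_decay:
  assumes fin: "finite D"
  shows "\<exists>K'. \<forall>\<psi>. (\<forall>\<sigma> x. exp (lin D \<sigma> x) * cmod (\<psi> x) \<le> K \<sigma>) \<longrightarrow>
    (\<forall>x. cmod (\<psi> x) \<le> K' * exp (- t * (\<Sum>k\<in>D. real_of_int \<bar>x k\<bar>)))"
proof -
  define \<Sigma> where "\<Sigma> = {\<sigma> :: nat \<Rightarrow> real. \<forall>k. (k \<in> D \<longrightarrow> \<sigma> k \<in> {t, -t}) \<and> (k \<notin> D \<longrightarrow> \<sigma> k = 0)}"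
  have fS: "finite \<Sigma>" unfolding \<Sigma>_def by (rule finite_set_of_finite_funs) (use fin in auto)
  have "cmod (\<psi> x) \<le> (\<Sum>\<sigma>\<in>\<Sigma>. \<bar>K \<sigma>\<bar>) * exp (- t * (\<Sum>k\<in>D. real_of_int \<bar>x k\<bar>))"
    if K: "\<And>\<sigma> x. exp (lin D \<sigma> x) * cmod (\<psi> x) \<le> K \<sigma>" for \<psi> x
  proof -
    define \<sigma> where "\<sigma> k = (if k \<in> D then if x k \<ge> 0 then t else -t else 0)" for k
    have \<sigma>: "\<sigma> \<in> \<Sigma>" by (auto simp: \<Sigma>_def \<sigma>_def)
    have l: "lin D \<sigma> x = t * (\<Sum>k\<in>D. real_of_int \<bar>x k\<bar>)"
      unfolding lin_def sum_distrib_left by (intro sum.cong) (auto simp: \<sigma>_def)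
    have "exp (lin D \<sigma> x) * cmod (\<psi> x) \<le> \<bar>K \<sigma>\<bar>" using K[of \<sigma> x] by linarith
    also have "\<dots> \<le> (\<Sum>\<sigma>\<in>\<Sigma>. \<bar>K \<sigma>\<bar>)" using \<sigma> fS by (intro member_le_sum) auto
    finally have "exp (- lin D \<sigma> x) * (exp (lin D \<sigma> x) * cmod (\<psi> x)) \<le> exp (- lin D \<sigma> x) * (\<Sum>\<sigma>\<in>\<Sigma>. \<bar>K \<sigma>\<bar>)"
      by (intro mult_left_mono) auto
    moreover have "exp (- lin D \<sigma> x) * (exp (lin D \<sigma> x) * cmod (\<psi> x)) = cmod (\<psi> x)" by (simp add: exp_minus)
    ultimately have "cmod (\<psi> x) \<le> (\<Sum>\<sigma>\<in>\<Sigma>. \<bar>K \<sigma>\<bar>) * exp (- lin D \<sigma> x)" by (simp only: mult.commute)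
    thus ?thesis unfolding l by simp
  qed
  thus ?thesis by (intro exI[of _ "\<Sum>\<sigma>\<in>\<Sigma>. \<bar>K \<sigma>\<bar>"]) blast
qed

text \<open>Excluding \<open>part_spec\<close> serves both halves of the induction step: its part
  with several summands gives the outer bound, and its part with one summand contradicts a kernel
  vector. The induction is over all tilts, since decay needs the outer bounds at each of
  them.\<close>

lemma LB_outside_part_spec:
  fixes E :: complex
  assumes h: "h \<noteq> 0" and v: "\<And>n. \<bar>v n\<bar> \<le> B"
    and v0: "(v \<longlongrightarrow> 0) at_top" "(v \<longlongrightarrow> 0) at_bot"
    and "finite D" "D \<noteq> {}" "E \<notin> of_real ` part_spec g h v (card D)"
  shows "\<exists>C. LB g D \<theta> (U h v D) E C"
  using assms(5-7)
proof (induction "card D" arbitrary: D E \<theta> rule: less_induct)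
  case less
  note fin = less.prems(1)
  let ?p = "card D"
  have p: "?p > 0" using less.prems by (simp add: card_gt_0_iff)
  have olb: "\<exists>C L. OLB g D \<theta> (U h v D) E C L" for \<theta>
  proof (rule outer_LB_of_clusters[OF fin less.prems(2) h v v0])
    show "E \<notin> of_real ` cluster_spec g h v ?p" using less.prems(3) cluster_spec_subset by blast
    fix D' and \<beta> :: complex assume "D' \<subset> D" "D' \<noteq> {}" "\<beta> \<notin> of_real ` part_spec g h v (card D')"
    thus "\<exists>C. LB g D' \<theta> (U h v D') \<beta> C"
      using less.hyps[of D' \<beta> \<theta>] psubset_card_mono[OF fin, of D'] finite_subset[of D' D] fin by auto
  qed
  show ?case
  proof (rule ccontr)
    assume nlb: "\<not> ?case"
    obtain C L where "OLB g D \<theta> (U h v D) E C L" using olb by blast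
    from kernel_of_no_LB[OF fin v this nlb] obtain \<phi> z where \<phi>: "\<And>x. Op g D \<theta> (U h v D) E \<phi> x = 0" "\<And>x. cmod (\<phi> x) \<le> 1"
      "\<phi> z \<noteq> 0" "\<And>x y. (\<forall>k\<in>D. x k = y k) \<Longrightarrow> \<phi> x = \<phi> y" by blast
    \<comment> \<open>Removing the tilt gives a solution for the untilted operator that may grow in
      some directions. Its boundedness with the weight of \<open>\<theta>\<close> is enough to start
      the decay argument.\<close>
    define \<psi> where "\<psi> x = of_real (exp (- lin D \<theta> x)) * \<phi> x" for x
    have ev: "Op g D (\<lambda>_. 0) (U h v D) E \<psi> x = 0" for x
      unfolding \<psi>_def Op_weight_linear[OF fin] \<phi>(1) by simp
    have b1: "exp (lin D \<theta> x) * cmod (\<psi> x) \<le> 1" for x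
    proof -
      have "exp (lin D \<theta> x) * cmod (\<psi> x) = cmod (\<phi> x)"
        by (simp add: \<psi>_def norm_mult mult.assoc[symmetric] mult_exp_exp)
      thus ?thesis using \<phi>(2) by simp
    qed
    have dec: "\<exists>K. \<forall>x. exp (lin D \<sigma> x) * cmod (\<psi> x) \<le> K" for \<sigma>
    proof -
      from superexponential_decay[OF fin v olb, of \<sigma>] obtain K L where KL: "\<forall>\<psi> \<theta>0 Bd m. (\<forall>x. Op g D (\<lambda>_. 0) (U h v D) E \<psi> x = 0) \<longrightarrow>
        (\<forall>x. exp (lin D \<theta>0 x) * cmod (\<psi> x) \<le> Bd) \<longrightarrow> (\<forall>x. (\<forall>k\<in>D. \<bar>x k\<bar> \<le> L) \<longrightarrow> cmod (\<psi> x) \<le> m) \<longrightarrow>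
        (\<forall>x. exp (lin D \<sigma> x) * cmod (\<psi> x) \<le> K * m)" by (elim exE)
      define F where "F = (\<Sum>k\<in>D. \<bar>\<theta> k\<bar>) * of_int L"
      have "cmod (\<psi> x) \<le> exp F" if "\<forall>k\<in>D. \<bar>x k\<bar> \<le> L" for x
      proof -
        have "\<bar>lin D \<theta> x\<bar> \<le> F" unfolding F_def by (rule lin_bound) (use that in blast)
        hence "exp (- lin D \<theta> x) * cmod (\<phi> x) \<le> exp F * 1" using \<phi>(2) by (intro mult_mono) auto
        thus ?thesis by (simp add: \<psi>_def norm_mult)
      qed
      hence "\<forall>x. exp (lin D \<sigma> x) * cmod (\<psi> x) \<le> K * exp F"
        by (intro KL[rule_format (no_asm), of \<psi> \<theta> 1] allI impI ev b1)
      thus ?thesis by (rule exI)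
    qed
    hence "\<forall>\<sigma>. \<exists>K. \<forall>x. exp (lin D \<sigma> x) * cmod (\<psi> x) \<le> K" by (rule allI)
    from choice[OF this] obtain K0 where K0: "\<forall>\<sigma> x. exp (lin D \<sigma> x) * cmod (\<psi> x) \<le> K0 \<sigma>" by (rule exE)
    \<comment> \<open>Rate 1 matches \<open>expw\<close> and gives square summability.\<close>
    from uniform_decay[OF fin, of K0 1] obtain K where "\<forall>\<psi>. (\<forall>\<sigma> x. exp (lin D \<sigma> x) * cmod (\<psi> x) \<le> K0 \<sigma>) \<longrightarrow>
      (\<forall>x. cmod (\<psi> x) \<le> K * exp (- 1 * (\<Sum>k\<in>D. real_of_int \<bar>x k\<bar>)))" by (rule exE)
    from mp[OF spec[OF this] K0] have K: "cmod (\<psi> x) \<le> K * exp (- 1 * (\<Sum>k\<in>D. real_of_int \<bar>x k\<bar>))" for x by (rule spec)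
    define en where "en i = sorted_list_of_set D ! i" for i
    have en: "strict_mono_on {..<?p} en"
    proof (rule strict_mono_onI)
      fix i j assume "i \<in> {..<?p}" "j \<in> {..<?p}" "i < j"
      thus "en i < en j" unfolding en_def
        by (intro sorted_wrt_nth_less[OF strict_sorted_list_of_set]) (simp_all add: fin)
    qed
    have "en ` {..<length (sorted_list_of_set D)} = set (sorted_list_of_set D)"
      unfolding en_def by (auto simp: set_conv_nth)
    hence enD: "en ` {..<?p} = D" by (simp add: fin)
    have bij: "bij_betw en {..<?p} D" using strict_mono_on_imp_inj_on[OF en] enD by (simp add: bij_betw_def)
    \<comment> \<open>Inverse of \<open>ls\<close> up to the inert coordinates. Their default 0 does
      not affect \<open>\<psi>\<close>, which depends on the coordinates in \<open>D\<close>
      only.\<close>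
    define cf where "cf xs n = (if n \<in> D then xs ! (inv_into {..<?p} en n) else 0)" for xs :: "int list" and n
    define ls where "ls x = map (\<lambda>i. x (en i)) [0..<?p]" for x :: conf
    define \<Psi> where "\<Psi> xs = (if length xs = ?p then \<psi> (cf xs) else 0)" for xs
    have dep: "\<psi> x = \<psi> y" if "\<forall>k\<in>D. x k = y k" for x y
    proof -
      have "lin D \<theta> x = lin D \<theta> y" unfolding lin_def using that by (intro sum.cong) auto
      thus ?thesis using \<phi>(4)[OF that] by (simp add: \<psi>_def)
    qed
    have cf_en: "cf xs (en i) = xs ! i" if "i < ?p" for xs i
      using that enD bij_betw_inv_into_left[OF bij, of i] by (auto simp: cf_def)
    have ls_cf: "ls (cf xs) = xs" if "length xs = ?p" for xs
      unfolding ls_def using that by (intro nth_equalityI) (auto simp: cf_en)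
    have \<Psi>ls: "\<Psi> (ls x) = \<psi> x" for x
    proof -
      have "cf (ls x) k = x k" if "k \<in> D" for k
      proof -
        from that have "k \<in> en ` {..<?p}" unfolding enD .
        then obtain i where i: "i < ?p" "k = en i" by blast
        thus ?thesis using cf_en[OF i(1), of "ls x"] by (simp add: ls_def)
      qed
      hence "\<psi> (cf (ls x)) = \<psi> x" by (intro dep) blast
      thus ?thesis by (simp add: \<Psi>_def ls_def)
    qed
    have "E \<in> of_real ` spec g h v ?p"
    proof (rule eigenvalue_in_spec[of ?p \<Psi> K])
      show "\<Psi> xs = 0" if "length xs \<noteq> ?p" for xs using that by (simp add: \<Psi>_def)
      show "\<Psi> (ls z) \<noteq> 0" using \<phi>(3) by (simp add: \<Psi>ls \<psi>_def)
      fix xs :: "int list" assume l: "length xs = ?p"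
      have "(\<Sum>k\<in>D. real_of_int \<bar>cf xs k\<bar>) = (\<Sum>i<?p. real_of_int \<bar>xs ! i\<bar>)"
        unfolding sum.reindex_bij_betw[OF bij, symmetric] by (intro sum.cong refl) (simp add: cf_en)
      thus "cmod (\<Psi> xs) \<le> K * expw ?p xs" using K[of "cf xs"] l by (simp add: \<Psi>_def expw_def)
      have "(\<lambda>x. \<Psi> (ls x)) = \<psi>" using \<Psi>ls by auto
      hence "Hop g h v ?p \<Psi> (ls (cf xs)) - E * \<Psi> (ls (cf xs)) = 0"
        using Op_eq_Hop[OF en enD, of g h v E \<Psi> "cf xs"] ev[of "cf xs"] unfolding ls_def by simp
      thus "Hop g h v ?p \<Psi> xs = E * \<Psi> xs" by (simp add: ls_cf[OF l])
    qed
    thus False using less.prems(3) spec_subset_part_spec[OF p] by blast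
  qed
qed

section \<open>Finite multiplicity and the decay estimate\<close>

lemma finite_spanning_of_determined:
  fixes V :: "('a \<Rightarrow> complex) set"
  assumes "finite F" and "\<And>f g c. f \<in> V \<Longrightarrow> g \<in> V \<Longrightarrow> (\<lambda>x. f x - c * g x) \<in> V"
    and "\<And>f. f \<in> V \<Longrightarrow> (\<forall>x\<in>F. f x = 0) \<Longrightarrow> f = (\<lambda>_. 0)"
  shows "\<exists>B. finite B \<and> B \<subseteq> V \<and> (\<forall>f\<in>V. \<exists>c. f = (\<lambda>x. \<Sum>b\<in>B. c b * b x))"
  using assms
proof (induction F arbitrary: V rule: finite_induct)
  case empty
  show ?case by (rule exI[of _ "{}"]) (use empty in auto)
next
  case (insert a F)
  show ?case
  proof (cases "\<forall>f\<in>V. f a = 0")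
    case True
    show ?thesis by (rule insert.IH) (use insert.prems True in auto)
  next
    case False
    then obtain b where b: "b \<in> V" "b a \<noteq> 0" by blast
    \<comment> \<open>One dimension is split off by \<open>b\<close>; the functions vanishing at
      \<open>a\<close> are determined by their values on the smaller set \<open>F\<close>.\<close>
    define V' where "V' = {f \<in> V. f a = 0}"
    have "\<exists>B. finite B \<and> B \<subseteq> V' \<and> (\<forall>f\<in>V'. \<exists>c. f = (\<lambda>x. \<Sum>b\<in>B. c b * b x))"
      by (rule insert.IH) (use insert.prems in \<open>auto simp: V'_def\<close>)
    then obtain B where B: "finite B" "B \<subseteq> V'" "\<And>f. f \<in> V' \<Longrightarrow> \<exists>c. f = (\<lambda>x. \<Sum>b\<in>B. c b * b x)" by blast
    have bB: "b \<notin> B" using B(2) b(2) by (auto simp: V'_def)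
    show ?thesis
    proof (intro exI[of _ "insert b B"] conjI ballI)
      show "finite (insert b B)" using B(1) by simp
      show "insert b B \<subseteq> V" using B(2) b(1) by (auto simp: V'_def)
      fix f assume f: "f \<in> V"
      define f' where "f' = (\<lambda>x. f x - f a / b a * b x)"
      have "f' \<in> V" unfolding f'_def by (rule insert.prems(1)[OF f b(1)])
      moreover have "f' a = 0" using b(2) by (simp add: f'_def)
      ultimately have "f' \<in> V'" by (simp add: V'_def)
      then obtain c where c: "f' = (\<lambda>x. \<Sum>b\<in>B. c b * b x)" using B(3) by blast
      have "f x = (\<Sum>d\<in>insert b B. (c(b := f a / b a)) d * d x)" for x
      proof -
        have "(\<Sum>d\<in>B. (c(b := f a / b a)) d * d x) = (\<Sum>d\<in>B. c d * d x)"
          using bB by (intro sum.cong refl) auto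
        also have "\<dots> = f x - f a / b a * b x" using fun_cong[OF c, of x] by (simp add: f'_def)
        finally show ?thesis using B(1) bB by simp
      qed
      thus "\<exists>c. f = (\<lambda>x. \<Sum>d\<in>insert b B. c d * d x)" by blast
    qed
  qed
qed

lemma l2_diff_cmult:
  assumes "f \<in> l2 M" "g \<in> l2 M"
  shows "(\<lambda>x. f x - c * g x) \<in> l2 M"
proof -
  have "(\<lambda>x. 2 * (cmod (f x))\<^sup>2 + 2 * (cmod c)\<^sup>2 * (cmod (g x))\<^sup>2) summable_on UNIV"
    using assms by (intro summable_on_add summable_on_cmult_right) (auto simp: l2_def)
  moreover have "(cmod (f x - c * g x))\<^sup>2 \<le> 2 * (cmod (f x))\<^sup>2 + 2 * (cmod c)\<^sup>2 * (cmod (g x))\<^sup>2" for x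
  proof -
    have "(cmod (f x - c * g x))\<^sup>2 \<le> (cmod (f x) + cmod (c * g x))\<^sup>2"
      by (intro power_mono norm_triangle_ineq4) simp
    also have "\<dots> \<le> 2 * (cmod (f x))\<^sup>2 + 2 * (cmod (c * g x))\<^sup>2"
      using sum_squares_bound[of "cmod (f x)" "cmod (c * g x)"] by (simp add: power2_sum)
    finally show ?thesis by (simp add: norm_mult power_mult_distrib)
  qed
  ultimately have "(\<lambda>x. (cmod (f x - c * g x))\<^sup>2) summable_on UNIV"
    by (rule summable_on_comparison_test) simp
  thus ?thesis using assms by (simp add: l2_def)
qed

lemma Hop_diff_cmult: "Hop g h v M (\<lambda>x. f x - c * f' x) x = Hop g h v M f x - c * Hop g h v M f' x"
proof (cases "length x = M")
  case True
  have "Hop g h v M (\<lambda>x. f x - c * f' x) x =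
      (\<Sum>k<M. (complex_of_real g * (- (f (x[k := x!k - 1]) + f (x[k := x!k + 1]))) - complex_of_real (2 * h * of_int (x!k)) * f x)
        - c * (complex_of_real g * (- (f' (x[k := x!k - 1]) + f' (x[k := x!k + 1]))) - complex_of_real (2 * h * of_int (x!k)) * f' x))
      + (\<Sum>j<M. \<Sum>i<j. complex_of_real (v (x!i - x!j)) * f x - c * (complex_of_real (v (x!i - x!j)) * f' x))"
    unfolding Hop_def if_P[OF True]
    by (intro arg_cong2[where f = "(+)"] sum.cong refl) (simp_all add: algebra_simps)
  also have "\<dots> = Hop g h v M f x - c * Hop g h v M f' x"
    unfolding Hop_def if_P[OF True] sum_subtractf sum_distrib_left[symmetric] by (simp only: right_diff_distrib distrib_left) simp
  finally show ?thesis .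
qed (simp add: Hop_def)

lemma eigenspace_diff_cmult:
  assumes "f \<in> eigenspace g h v M E" "f' \<in> eigenspace g h v M E"
  shows "(\<lambda>x. f x - c * f' x) \<in> eigenspace g h v M E"
proof -
  have l: "f \<in> l2 M" "f' \<in> l2 M" "Hop g h v M f \<in> l2 M" "Hop g h v M f' \<in> l2 M"
    and e: "Hop g h v M f = (\<lambda>x. E * f x)" "Hop g h v M f' = (\<lambda>x. E * f' x)"
    using assms by (auto simp: eigenspace_def Hdom_def)
  have H: "Hop g h v M (\<lambda>x. f x - c * f' x) = (\<lambda>x. Hop g h v M f x - c * Hop g h v M f' x)"
    by (rule ext) (rule Hop_diff_cmult)
  show ?thesis unfolding eigenspace_def Hdom_def mem_Collect_eq H
    using l2_diff_cmult[OF l(1,2), of c] l2_diff_cmult[OF l(3,4), of c]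
    by (simp add: e algebra_simps)
qed

lemma l2norm_bound:
  assumes "\<psi> \<in> l2 M"
  shows "cmod (\<psi> x) \<le> l2norm \<psi>"
proof -
  have "(\<lambda>x. (cmod (\<psi> x))\<^sup>2) summable_on UNIV" using assms by (simp add: l2_def)
  from finite_sum_le_infsum[OF this, of "{x}"] have "(cmod (\<psi> x))\<^sup>2 \<le> (\<Sum>\<^sub>\<infinity>x. (cmod (\<psi> x))\<^sup>2)" by simp
  thus ?thesis unfolding l2norm_def by (rule real_le_rsqrt)
qed

theorem theorem2:
  fixes g h \<theta> E :: real and N :: nat and v :: "int \<Rightarrow> real"
  assumes "h \<noteq> 0" and "N \<ge> 1"
    and "\<exists>B. \<forall>n. \<bar>v n\<bar> \<le> B"
    and "(v \<longlongrightarrow> 0) at_top" and "(v \<longlongrightarrow> 0) at_bot"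
    and "\<theta> \<ge> 0"
    and "is_eigenvalue g h v N E"
    and "E \<notin> cluster_spec g h v N"
  shows "finite_multiplicity g h v N E \<and>
    (\<exists>C. \<forall>\<psi> \<in> eigenspace g h v N E. l2norm \<psi> = 1 \<longrightarrow>
        (\<forall>x. length x = N \<longrightarrow>
           cmod (\<psi> x) < C * exp (- \<theta> * (\<Sum>i<N. real_of_int \<bar>x!i\<bar>))))"
proof -
  obtain B where v: "\<And>n. \<bar>v n\<bar> \<le> B" using assms(3) by blast
  let ?D = "{..<N}" and ?V = "eigenspace g h v N E" and ?W = "U h v {..<N}"
  have fin: "finite ?D" and ne: "?D \<noteq> {}" using assms(2) by (auto simp: lessThan_empty_iff)
  \<comment> \<open>For the full system, where \<open>E\<close> is an eigenvalue, only the outer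
    bound is sought; the proper subclusters have full lower bounds.\<close>
  have olb: "\<exists>C L. OLB g ?D \<sigma> ?W (of_real E) C L" for \<sigma>
  proof (rule outer_LB_of_clusters[OF fin ne assms(1) v assms(4,5)])
    show "of_real E \<notin> of_real ` cluster_spec g h v (card ?D)" using assms(8) by auto
    fix D' and \<beta> :: complex assume D': "D' \<subset> ?D" "D' \<noteq> {}" "\<beta> \<notin> of_real ` part_spec g h v (card D')"
    have "finite D'" using D'(1) finite_subset[of D' ?D] by auto
    thus "\<exists>C. LB g D' \<sigma> (U h v D') \<beta> C"
      by (rule LB_outside_part_spec[OF assms(1) v assms(4,5) _ D'(2,3)])
  qed
  define ls where "ls x = map x [0..<N]" for x :: conf
  have ls: "ls (\<lambda>k. xs ! k) = xs" if "length xs = N" for xs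
    unfolding ls_def using that by (intro nth_equalityI) auto
  have ev: "Op g ?D (\<lambda>_. 0) ?W (of_real E) (\<lambda>x. \<psi> (ls x)) x = 0" if "\<psi> \<in> ?V" for \<psi> x
  proof -
    have "Hop g h v N \<psi> = (\<lambda>x. of_real E * \<psi> x)" using that by (simp add: eigenspace_def)
    thus ?thesis
      using Op_eq_Hop[of N "\<lambda>i. i" ?D g h v "of_real E" \<psi> x] by (simp add: ls_def strict_mono_on_def)
  qed
  have l2V: "cmod (\<psi> xs) \<le> l2norm \<psi>" if "\<psi> \<in> ?V" for \<psi> xs
    by (rule l2norm_bound[of _ N]) (use that in \<open>simp add: eigenspace_def Hdom_def\<close>)
  have dec: "\<exists>K L. \<forall>\<psi>\<in>?V. \<forall>m. (\<forall>x. (\<forall>k\<in>?D. \<bar>x k\<bar> \<le> L) \<longrightarrow> cmod (\<psi> (ls x)) \<le> m) \<longrightarrow>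
      (\<forall>x. exp (lin ?D \<sigma> x) * cmod (\<psi> (ls x)) \<le> K * m)" for \<sigma>
  proof -
    from superexponential_decay[OF fin v olb, of \<sigma>] obtain K L where KL: "\<forall>\<psi> \<theta>0 Bd m. (\<forall>x. Op g ?D (\<lambda>_. 0) ?W (of_real E) \<psi> x = 0) \<longrightarrow>
        (\<forall>x. exp (lin ?D \<theta>0 x) * cmod (\<psi> x) \<le> Bd) \<longrightarrow> (\<forall>x. (\<forall>k\<in>?D. \<bar>x k\<bar> \<le> L) \<longrightarrow> cmod (\<psi> x) \<le> m) \<longrightarrow>
        (\<forall>x. exp (lin ?D \<sigma> x) * cmod (\<psi> x) \<le> K * m)" by (elim exE)
    show ?thesis
    proof (intro exI[of _ K] exI[of _ L] ballI allI impI)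
      fix \<psi> m x assume psi: "\<psi> \<in> ?V" and m: "\<forall>x. (\<forall>k\<in>?D. \<bar>x k\<bar> \<le> L) \<longrightarrow> cmod (\<psi> (ls x)) \<le> m"
      have "\<forall>x. Op g ?D (\<lambda>_. 0) ?W (of_real E) (\<lambda>x. \<psi> (ls x)) x = 0" using ev[OF psi] by blast
      moreover have "\<forall>x. exp (lin ?D (\<lambda>_. 0) x) * cmod (\<psi> (ls x)) \<le> l2norm \<psi>" using l2V[OF psi] by (simp add: lin_def)
      ultimately show "exp (lin ?D \<sigma> x) * cmod (\<psi> (ls x)) \<le> K * m"
        using spec[OF spec[OF spec[OF spec[OF KL, of "\<lambda>x. \<psi> (ls x)"], of "\<lambda>_. 0"], of "l2norm \<psi>"], of m] m by blast
    qed
  qed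
  \<comment> \<open>With \<open>m = 0\<close> the decay estimate becomes a uniqueness statement: an
    eigenvector vanishing on the finite box vanishes everywhere.\<close>
  have "finite_multiplicity g h v N E"
  proof -
    obtain K L where KL: "\<forall>\<psi>\<in>?V. \<forall>m. (\<forall>x. (\<forall>k\<in>?D. \<bar>x k\<bar> \<le> L) \<longrightarrow> cmod (\<psi> (ls x)) \<le> m) \<longrightarrow>
      (\<forall>x. exp (lin ?D (\<lambda>_. 0) x) * cmod (\<psi> (ls x)) \<le> K * m)" using dec[of "\<lambda>_. 0"] by blast
    define F where "F = {xs. set xs \<subseteq> {-L..L} \<and> length xs = N}"
    have "finite F" unfolding F_def by (rule finite_lists_length_eq) simp
    moreover have "\<psi> = (\<lambda>_. 0)" if psi: "\<psi> \<in> ?V" "\<forall>xs\<in>F. \<psi> xs = 0" for \<psi>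
    proof
      have "cmod (\<psi> (ls x)) \<le> 0" if x: "\<forall>k\<in>?D. \<bar>x k\<bar> \<le> L" for x
      proof -
        have "x k \<in> {-L..L}" if "k < N" for k
        proof -
          have "\<bar>x k\<bar> \<le> L" using x that by blast
          thus ?thesis by auto
        qed
        hence "ls x \<in> F" by (auto simp: F_def ls_def)
        thus ?thesis using psi(2) by simp
      qed
      hence z: "exp (lin ?D (\<lambda>_. 0) x) * cmod (\<psi> (ls x)) \<le> K * 0" for x using KL psi(1) by blast
      fix xs
      show "\<psi> xs = 0"
      proof (cases "length xs = N")
        case True
        thus ?thesis using z[of "\<lambda>k. xs ! k"] by (simp add: ls lin_def)
      next
        case False
        thus ?thesis using psi(1) by (simp add: eigenspace_def Hdom_def l2_def)
      qed
    qed
    ultimately show ?thesis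
      unfolding finite_multiplicity_def
      by (intro finite_spanning_of_determined[where V = ?V and F = F]) (auto intro: eigenspace_diff_cmult)
  qed
  moreover have "\<exists>C. \<forall>\<psi>\<in>?V. l2norm \<psi> = 1 \<longrightarrow> (\<forall>x. length x = N \<longrightarrow>
           cmod (\<psi> x) < C * exp (- \<theta> * (\<Sum>i<N. real_of_int \<bar>x!i\<bar>)))"
  proof -
    have "\<exists>K. \<forall>\<psi>\<in>?V. l2norm \<psi> = 1 \<longrightarrow> (\<forall>x. exp (lin ?D \<sigma> x) * cmod (\<psi> (ls x)) \<le> K)" for \<sigma>
    proof -
      obtain K L where KL: "\<forall>\<psi>\<in>?V. \<forall>m. (\<forall>x. (\<forall>k\<in>?D. \<bar>x k\<bar> \<le> L) \<longrightarrow> cmod (\<psi> (ls x)) \<le> m) \<longrightarrow>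
        (\<forall>x. exp (lin ?D \<sigma> x) * cmod (\<psi> (ls x)) \<le> K * m)" using dec[of \<sigma>] by blast
      \<comment> \<open>Normalisation bounds all values by 1, so \<open>m = 1\<close> gives a
        constant common to all normalised eigenvectors.\<close>
      have "exp (lin ?D \<sigma> x) * cmod (\<psi> (ls x)) \<le> K * 1" if "\<psi> \<in> ?V" "l2norm \<psi> = 1" for \<psi> x
      proof -
        have "\<forall>x. (\<forall>k\<in>?D. \<bar>x k\<bar> \<le> L) \<longrightarrow> cmod (\<psi> (ls x)) \<le> 1" using l2V[OF that(1)] that(2) by simp
        thus ?thesis using KL that(1) by blast
      qed
      thus ?thesis by (intro exI[of _ "K * 1"]) blast
    qed
    hence "\<forall>\<sigma>. \<exists>K. \<forall>\<psi>\<in>?V. l2norm \<psi> = 1 \<longrightarrow> (\<forall>x. exp (lin ?D \<sigma> x) * cmod (\<psi> (ls x)) \<le> K)" by (rule allI)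
    from choice[OF this] obtain K where K: "\<forall>\<sigma>. \<forall>\<psi>\<in>?V. l2norm \<psi> = 1 \<longrightarrow> (\<forall>x. exp (lin ?D \<sigma> x) * cmod (\<psi> (ls x)) \<le> K \<sigma>)" by (rule exE)
    from uniform_decay[OF fin, of K \<theta>] obtain K' where K': "\<forall>\<psi>. (\<forall>\<sigma> x. exp (lin ?D \<sigma> x) * cmod (\<psi> x) \<le> K \<sigma>) \<longrightarrow>
      (\<forall>x. cmod (\<psi> x) \<le> K' * exp (- \<theta> * (\<Sum>k\<in>?D. real_of_int \<bar>x k\<bar>)))" by (rule exE)
    \<comment> \<open>Adding 1 to the constant makes the inequality strict.\<close>
    have "cmod (\<psi> xs) < (K' + 1) * exp (- \<theta> * (\<Sum>i<N. real_of_int \<bar>xs!i\<bar>))"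
      if "\<psi> \<in> ?V" "l2norm \<psi> = 1" "length xs = N" for \<psi> xs
    proof -
      have "\<forall>\<sigma> x. exp (lin ?D \<sigma> x) * cmod (\<psi> (ls x)) \<le> K \<sigma>" using K that(1,2) by blast
      from spec[OF mp[OF spec[OF K', of "\<lambda>x. \<psi> (ls x)"] this], of "\<lambda>k. xs ! k"]
      have "cmod (\<psi> xs) \<le> K' * exp (- \<theta> * (\<Sum>i<N. real_of_int \<bar>xs!i\<bar>))"
        by (simp add: ls that(3))
      also have "\<dots> < (K' + 1) * exp (- \<theta> * (\<Sum>i<N. real_of_int \<bar>xs!i\<bar>))"
        by (intro mult_strict_right_mono) auto
      finally show ?thesis .
    qed
    thus ?thesis by blast
  qed
  ultimately show ?thesis by blast
qed

end
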